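(* Let $\mathcal{C}$ be a groupoidant 2-category, and let $\mathcal{C}_{\mathrm{gpd}}\subset\mathcal{C}$ be the full sub-2-category on the groupoids. Then the restricted Yoneda 2-functor $\mathcal{C}\to 2\mathrm{Fun}(\mathcal{C}_{\mathrm{gpd}}^{\mathrm{op}},\mathbf{Cat})$, $X\mapsto\mathcal{C}(-,X)|_{\mathcal{C}_{\mathrm{gpd}}}$, is strictly fully faithful (an isomorphism on hom-categories). In detail: (i) Two morphisms $f,g:X\to Y$ in $\mathcal{C}$ are equal if and only if the functors $(f_* )_A,(g_* )_A:\mathcal{C}(A,X)\to\mathcal{C}(A,Y)$ are equal for all groupoids $A\in\mathcal{C}$. (ii) Two 2-cells $\alpha,\beta:f\Rightarrow g:X\to Y$ are equal if and only if the natural transformations $(\alpha_* )_A,(\beta_* )_A:(f_* )_A\to(g_* )_A$ are equal for all groupoids $A\in\mathcal{C}$. (iii) Let $X,Y\in\mathcal{C}$ and let $F_A:\mathcal{C}(A,X)\to\mathcal{C}(A,Y)$, for all groupoids $A\in\mathcal{C}$, be a family of functors natural with respect to all morphisms $u:A'\to A$ of groupoids, i.e. $F_Au^*=u^*F_{A'}:\mathcal{C}(A,X)\to\mathcal{C}(A',Y)$. Then there is a (by (i) unique) morphism $f:X\to Y$ with $F_A=(f_* )_A$ for all groupoids $A$. (iv) Let $f,g:X\to Y$ be morphisms in $\mathcal{C}$ and let $\alpha_A:(f_* )_A\to(g_* )_A$, for all groupoids $A\in\mathcal{C}$, be a family of natural transformations which is natural with respect to all morphisms $h:A'\to A$ of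 groupoids, i.e. the whiskerings $\alpha_Ah^*$ and $h^*\alpha_{A'}$, natural transformations between functors $\mathcal{C}(A,X)\to\mathcal{C}(A',Y)$, are equal. Then there is a (by (ii) unique) 2-cell $\alpha:f\Rightarrow g$ with $\alpha_A=(\alpha_* )_A$ for all groupoids $A$.
   Context: Conventions. 2-categories are strict. Composition is in diagrammatic order: $fg$ means first $f$, then $g$ (also for functors and whiskerings). $|\mathcal{C}|$ is the underlying 1-category of $\mathcal{C}$. For $f:X\to Y$, $f_*=(f_* )_A:\mathcal{C}(A,X)\to\mathcal{C}(A,Y)$ is composition with $f$ and $\alpha_*=(\alpha_* )_A$ is whiskering with a 2-cell $\alpha$; for $u:A'\to A$, $u^*:\mathcal{C}(A,X)\to\mathcal{C}(A',X)$ is precomposition. $2\mathrm{Fun}$ denotes the 2-category of strict 2-functors, strict natural transformations and modifications. $[k]$ is the linear order $\{0<\dots<k\}$ viewed as a category, and $\delta_{a_0\dots a_k}:[k]\to[l]$ is the functor $j\mapsto a_j$. Limits. A functor $F$ is an isofibration if every isomorphism $Fx\to b$ lifts to an isomorphism with domain $x$; it is a discrete opfibration (DOF) if every morphism $Fx\to b$ has a unique lift with domain $x$. A morphism $f$ of $\mathcal{C}$ is an isofibration (resp. DOF) if $f_*:\mathcal{C}(A,X)\to\mathcal{C}(A,Y)$ is one for all $A$. A commutative square with vertex $P$ over a cospan $X\to Z\leftarrow Y$ is a strict pullback if $\mathcal{C}(B,P)\to\mathcal{C}(B,X)\times_{\mathcal{C}(B,Z)}\mathcal{C}(B,Y)$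 is an isomorphism of categories for all $B$. A strict terminal object has all $\mathcal{C}(A,\mathbf 1)$ equal to the one-morphism category. A strict cotensor of $X$ with a category $J$ is an object $X^J$ with a functor $\mathrm{ev}:J\to\mathcal{C}(X^J,X)$ inducing isomorphisms of categories $\mathcal{C}(A,X^J)\cong\mathrm{Fun}(J,\mathcal{C}(A,X))$ for all $A$; functors $J\to J'$ induce $X^{J'}\to X^J$. The arrow object is $X^\to=X^{[1]}$, with universal 2-cell $\partial:\partial_0\Rightarrow\partial_1:X^\to\to X$. $\mathcal{C}$ is pita if it has a strict terminal object, strict arrow objects, and strict pullbacks of isofibrations along arbitrary morphisms (it then has cotensors with finite categories). Groupoids and cores. $X$ is a groupoid if every $\mathcal{C}(A,X)$ is a groupoid. $f:A\to X$ is an arrow-wise iso if $\alpha f$ is invertible for every 2-cell $\alpha$ between morphisms into $A$. A core of $X$ is an object $X^{\mathrm{iso}}$ with an arrow-wise iso $i:X^{\mathrm{iso}}\to X$ such that for all $A$, $i_*$ is an isomorphism from $\mathcal{C}(A,X^{\mathrm{iso}})$ onto the subcategory of $\mathcal{C}(A,X)$ of arrow-wise isos and invertible 2-cells. Any $f:X\to Y$ induces $f^{\mathrm{iso}}:X^{\mathrm{iso}}\to Y^{\mathrm{iso}}$ with $f^{\mathrm{iso}}i=if$. Congruences. An internal category $C$ in a 1-category has objects $C_0,C_1,C_2$ and morphisms $\pi_0,\pi_1:C_1\to C_0$ (source, target), $e:C_0\to C_1$ (identities), $\pi_{01},\pi_{12},\pi_{02}:C_2\to C_1$ (first arrow, second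 arrow, composite), with $C_2=C_1\times_{C_0}C_1$ via $\pi_{01}\pi_1=\pi_{12}\pi_0$, satisfying the usual axioms. $C_3=C_2\times_{C_1}C_2$ (along $\pi_{12},\pi_{01}$) is the object of composable triples; $\langle a,b,c\rangle:A\to C_3$ is the morphism with consecutive components $a,b,c:A\to C_1$, and $\pi_{02},\pi_{13}:C_3\to C_1$ give the composite of the first two, resp. last two, arrows. In a pita 2-category $\mathcal{C}$, an internal double category is an internal category in $|\mathcal{C}|$ with $\langle\pi_0,\pi_1\rangle:C_1\to C_0\times C_0$ an isofibration. It is a gbo-congruence if $C_0,C_1,C_2$ are groupoids and $\langle\pi_0,\pi_1\rangle$ is a DOF. Then there is a unique $r:C_0^\to\to C_1$ (the reflection morphism) for which there exists a 2-cell $\bar\rho:r\Rightarrow\partial_1e$ with $\bar\rho\langle\pi_0,\pi_1\rangle=\langle\partial,\mathrm{id}_{\partial_1}\rangle$. Let $\tau:C_0^\to\to C_0^\to$ be the morphism with $\tau\partial=\partial^{-1}$. A gbo-congruence $C$ is complete (a complete congruence) if the square with top $\langle r,\tau r,r\rangle:C_0^\to\to C_3$, left $\langle\partial_0,\partial_1\rangle:C_0^\to\to C_0\times C_0$, right $\langle\pi_{02},\pi_{13}\rangle:C_3\to C_1\times C_1$ and bottom $e\times e$ is a strict pullback. Nerves and quotients. A nerve $\mathrm{Nv}(X)$ of $X$ is the internal double category with objects $X^{\mathrm{iso}},(X^\to)^{\mathrm{iso}},(X^{[2]})^{\mathrm{iso}}$ (for some choice of cores and cotensors) and structure maps $\pi_{jk}=(X^{\delta_{jk}})^{\mathrm{iso}}$,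 $\pi_j=(X^{\delta_j})^{\mathrm{iso}}=\partial_j^{\mathrm{iso}}$, $e=(X^{\delta_{00}})^{\mathrm{iso}}$. A cocone under $C$ with vertex $Y$ is a morphism $\gamma:C_0\to Y$ and a 2-cell $\gamma_{01}:\pi_0\gamma\Rightarrow\pi_1\gamma$ with $e\gamma_{01}=\mathrm{id}_\gamma$ and $\pi_{02}\gamma_{01}=(\pi_{01}\gamma_{01})(\pi_{12}\gamma_{01})$; a morphism $(\gamma,\gamma_{01})\to(\gamma',\gamma'_{01})$ is a 2-cell $\alpha:\gamma\Rightarrow\gamma'$ with $(\pi_0\alpha)\gamma'_{01}=\gamma_{01}(\pi_1\alpha)$. A cocone with vertex $X$ is a strict quotient of $C$ if the induced functor $\mathcal{C}(X,Y)\to\mathrm{Cocone}(C,Y)$ is an isomorphism for all $Y$. The tautological cocone under $\mathrm{Nv}(X)$ is $\gamma=i:X^{\mathrm{iso}}\to X$, $\gamma_{01}=i\partial$ (with $i:(X^\to)^{\mathrm{iso}}\to X^\to$). $\mathcal{C}$ is groupoidant if: it is pita; every object has a core; every complete congruence is a nerve (of some object); and the tautological cocone under any nerve is a strict quotient. *)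

theory Defs
  imports Main "HOL-Library.FuncSet"
begin

text \<open>
  Throughout, composition is written in diagrammatic order: \<open>f \<cdot> g\<close> means first \<open>f\<close>, then \<open>g\<close>.
  Categories and 2-categories are given by carrier sets. Functors, natural transformations,
  2-functors etc. are records containing their source and target; their component functions are
  extensional, so that HOL equality of the records is the mathematical equality.
\<close>

section \<open>Categories, functors and natural transformations\<close>

record ('x, 'm) cat =
  cobj :: "'x set"
  carr :: "'m set"
  cdom :: "'m \<Rightarrow> 'x"
  ccod :: "'m \<Rightarrow> 'x"
  cid :: "'x \<Rightarrow> 'm"
  ccomp :: "'m \<Rightarrow> 'm \<Rightarrow> 'm"  (infixl "\<cdot>\<index>" 70)

definition chom :: "('x, 'm) cat \<Rightarrow> 'x \<Rightarrow> 'x \<Rightarrow> 'm set" where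
  "chom K x y = {m \<in> carr K. cdom K m = x \<and> ccod K m = y}"

locale category =
  fixes K :: "('x, 'm) cat" (structure)
  assumes dom_obj: "m \<in> carr K \<Longrightarrow> cdom K m \<in> cobj K"
    and cod_obj: "m \<in> carr K \<Longrightarrow> ccod K m \<in> cobj K"
    and id_hom: "x \<in> cobj K \<Longrightarrow> cid K x \<in> chom K x x"
    and comp_hom: "\<lbrakk>m \<in> carr K; n \<in> carr K; ccod K m = cdom K n\<rbrakk>
          \<Longrightarrow> m \<cdot> n \<in> chom K (cdom K m) (ccod K n)"
    and id_comp: "m \<in> carr K \<Longrightarrow> cid K (cdom K m) \<cdot> m = m"
    and comp_id: "m \<in> carr K \<Longrightarrow> m \<cdot> cid K (ccod K m) = m"
    and comp_assoc: "\<lbrakk>l \<in> carr K; m \<in> carr K; n \<in> carr K;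
            ccod K l = cdom K m; ccod K m = cdom K n\<rbrakk>
          \<Longrightarrow> (l \<cdot> m) \<cdot> n = l \<cdot> (m \<cdot> n)"

definition is_inverse :: "('x, 'm) cat \<Rightarrow> 'm \<Rightarrow> 'm \<Rightarrow> bool" where
  "is_inverse K m n \<longleftrightarrow> m \<in> carr K \<and> n \<in> carr K \<and>
     cdom K n = ccod K m \<and> ccod K n = cdom K m \<and>
     m \<cdot>\<^bsub>K\<^esub> n = cid K (cdom K m) \<and> n \<cdot>\<^bsub>K\<^esub> m = cid K (ccod K m)"

definition iso_arr :: "('x, 'm) cat \<Rightarrow> 'm \<Rightarrow> bool" where
  "iso_arr K m \<longleftrightarrow> (\<exists>n. is_inverse K m n)"

definition groupoid :: "('x, 'm) cat \<Rightarrow> bool" where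
  "groupoid K \<longleftrightarrow> category K \<and> (\<forall>m \<in> carr K. iso_arr K m)"

definition one_morphism_category :: "('x, 'm) cat \<Rightarrow> bool" where
  "one_morphism_category K \<longleftrightarrow> category K \<and> (\<exists>!m. m \<in> carr K)"

definition cat_prod :: "('x, 'm) cat \<Rightarrow> ('y, 'n) cat \<Rightarrow> ('x \<times> 'y, 'm \<times> 'n) cat" where
  "cat_prod K L =
     \<lparr>cobj = cobj K \<times> cobj L, carr = carr K \<times> carr L,
      cdom = map_prod (cdom K) (cdom L), ccod = map_prod (ccod K) (ccod L),
      cid = map_prod (cid K) (cid L),
      ccomp = (\<lambda>m n. (fst m \<cdot>\<^bsub>K\<^esub> fst n, snd m \<cdot>\<^bsub>L\<^esub> snd n))\<rparr>"

record ('x, 'm, 'y, 'n) fnctr =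
  fdom :: "('x, 'm) cat"
  fcod :: "('y, 'n) cat"
  fo :: "'x \<Rightarrow> 'y"
  fa :: "'m \<Rightarrow> 'n"

definition is_functor :: "('x, 'm, 'y, 'n) fnctr \<Rightarrow> bool" where
  "is_functor F \<longleftrightarrow>
     fo F \<in> cobj (fdom F) \<rightarrow>\<^sub>E cobj (fcod F) \<and>
     fa F \<in> carr (fdom F) \<rightarrow>\<^sub>E carr (fcod F) \<and>
     (\<forall>m \<in> carr (fdom F). cdom (fcod F) (fa F m) = fo F (cdom (fdom F) m) \<and>
                           ccod (fcod F) (fa F m) = fo F (ccod (fdom F) m)) \<and>
     (\<forall>x \<in> cobj (fdom F). fa F (cid (fdom F) x) = cid (fcod F) (fo F x)) \<and>
     (\<forall>m \<in> carr (fdom F). \<forall>n \<in> carr (fdom F). ccod (fdom F) m = cdom (fdom F) n \<longrightarrow>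
        fa F (m \<cdot>\<^bsub>fdom F\<^esub> n) = fa F m \<cdot>\<^bsub>fcod F\<^esub> fa F n)"

definition fid :: "('x, 'm) cat \<Rightarrow> ('x, 'm, 'x, 'm) fnctr" where
  "fid K = \<lparr>fdom = K, fcod = K, fo = (\<lambda>x \<in> cobj K. x), fa = (\<lambda>m \<in> carr K. m)\<rparr>"

definition fcmp ::
  "('x, 'm, 'y, 'n) fnctr \<Rightarrow> ('y, 'n, 'z, 'k) fnctr \<Rightarrow> ('x, 'm, 'z, 'k) fnctr" where
  "fcmp F G =
     \<lparr>fdom = fdom F, fcod = fcod G,
      fo = (\<lambda>x \<in> cobj (fdom F). fo G (fo F x)),
      fa = (\<lambda>m \<in> carr (fdom F). fa G (fa F m))\<rparr>"

definition cat_iso :: "('x, 'm, 'y, 'n) fnctr \<Rightarrow> bool" where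
  "cat_iso F \<longleftrightarrow> is_functor F \<and>
     (\<exists>G. is_functor G \<and> fdom G = fcod F \<and> fcod G = fdom F \<and>
          fcmp F G = fid (fdom F) \<and> fcmp G F = fid (fcod F))"

definition cat_isofibration :: "('x, 'm, 'y, 'n) fnctr \<Rightarrow> bool" where
  "cat_isofibration F \<longleftrightarrow>
     (\<forall>x \<in> cobj (fdom F). \<forall>m. iso_arr (fcod F) m \<and> cdom (fcod F) m = fo F x \<longrightarrow>
        (\<exists>l. iso_arr (fdom F) l \<and> cdom (fdom F) l = x \<and> fa F l = m))"

definition cat_dof :: "('x, 'm, 'y, 'n) fnctr \<Rightarrow> bool" where
  "cat_dof F \<longleftrightarrow>
     (\<forall>x \<in> cobj (fdom F). \<forall>m \<in> carr (fcod F). cdom (fcod F) m = fo F x \<longrightarrow>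
        (\<exists>!l. l \<in> carr (fdom F) \<and> cdom (fdom F) l = x \<and> fa F l = m))"

text \<open>\<open>pair_functor F G L\<close> is the functor into \<open>L\<close> with components \<open>F\<close> and \<open>G\<close>, where \<open>L\<close> is the
  product of their targets or a subcategory of it.\<close>

definition pair_functor ::
  "('x, 'm, 'y, 'n) fnctr \<Rightarrow> ('x, 'm, 'z, 'k) fnctr \<Rightarrow> ('y \<times> 'z, 'n \<times> 'k) cat
     \<Rightarrow> ('x, 'm, 'y \<times> 'z, 'n \<times> 'k) fnctr" where
  "pair_functor F G L =
     \<lparr>fdom = fdom F, fcod = L,
      fo = (\<lambda>x \<in> cobj (fdom F). (fo F x, fo G x)),
      fa = (\<lambda>m \<in> carr (fdom F). (fa F m, fa G m))\<rparr>"

definition cat_pullback ::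
  "('x, 'm, 'z, 'k) fnctr \<Rightarrow> ('y, 'n, 'z, 'k) fnctr \<Rightarrow> ('x \<times> 'y, 'm \<times> 'n) cat" where
  "cat_pullback F G = (cat_prod (fdom F) (fdom G))
     \<lparr>cobj := {(x, y). x \<in> cobj (fdom F) \<and> y \<in> cobj (fdom G) \<and> fo F x = fo G y},
      carr := {(m, n). m \<in> carr (fdom F) \<and> n \<in> carr (fdom G) \<and> fa F m = fa G n}\<rparr>"

record ('x, 'm, 'y, 'n) ntrans =
  nsrc :: "('x, 'm, 'y, 'n) fnctr"
  ntgt :: "('x, 'm, 'y, 'n) fnctr"
  nc :: "'x \<Rightarrow> 'n"

definition is_ntrans :: "('x, 'm, 'y, 'n) ntrans \<Rightarrow> bool" where
  "is_ntrans \<nu> \<longleftrightarrow> (let F = nsrc \<nu>; G = ntgt \<nu>; K = fdom F; L = fcod F in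
     is_functor F \<and> is_functor G \<and> fdom G = K \<and> fcod G = L \<and>
     nc \<nu> \<in> extensional (cobj K) \<and>
     (\<forall>x \<in> cobj K. nc \<nu> x \<in> chom L (fo F x) (fo G x)) \<and>
     (\<forall>m \<in> carr K. fa F m \<cdot>\<^bsub>L\<^esub> nc \<nu> (ccod K m) = nc \<nu> (cdom K m) \<cdot>\<^bsub>L\<^esub> fa G m))"

definition nid :: "('x, 'm, 'y, 'n) fnctr \<Rightarrow> ('x, 'm, 'y, 'n) ntrans" where
  "nid F = \<lparr>nsrc = F, ntgt = F, nc = (\<lambda>x \<in> cobj (fdom F). cid (fcod F) (fo F x))\<rparr>"

definition nvcomp ::
  "('x, 'm, 'y, 'n) ntrans \<Rightarrow> ('x, 'm, 'y, 'n) ntrans \<Rightarrow> ('x, 'm, 'y, 'n) ntrans" where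
  "nvcomp \<mu> \<nu> =
     \<lparr>nsrc = nsrc \<mu>, ntgt = ntgt \<nu>,
      nc = (\<lambda>x \<in> cobj (fdom (nsrc \<mu>)). nc \<mu> x \<cdot>\<^bsub>fcod (nsrc \<mu>)\<^esub> nc \<nu> x)\<rparr>"

definition nhcomp ::
  "('x, 'm, 'y, 'n) ntrans \<Rightarrow> ('y, 'n, 'z, 'k) ntrans \<Rightarrow> ('x, 'm, 'z, 'k) ntrans" where
  "nhcomp \<mu> \<nu> =
     \<lparr>nsrc = fcmp (nsrc \<mu>) (nsrc \<nu>), ntgt = fcmp (ntgt \<mu>) (ntgt \<nu>),
      nc = (\<lambda>x \<in> cobj (fdom (nsrc \<mu>)).
              fa (nsrc \<nu>) (nc \<mu> x) \<cdot>\<^bsub>fcod (nsrc \<nu>)\<^esub> nc \<nu> (fo (ntgt \<mu>) x))\<rparr>"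

text \<open>Whiskerings of a natural transformation with a functor, on either side.\<close>

definition fwhisk ::
  "('x, 'm, 'y, 'n) fnctr \<Rightarrow> ('y, 'n, 'z, 'k) ntrans \<Rightarrow> ('x, 'm, 'z, 'k) ntrans" where
  "fwhisk F \<nu> =
     \<lparr>nsrc = fcmp F (nsrc \<nu>), ntgt = fcmp F (ntgt \<nu>),
      nc = (\<lambda>x \<in> cobj (fdom F). nc \<nu> (fo F x))\<rparr>"

definition whiskf ::
  "('x, 'm, 'y, 'n) ntrans \<Rightarrow> ('y, 'n, 'z, 'k) fnctr \<Rightarrow> ('x, 'm, 'z, 'k) ntrans" where
  "whiskf \<mu> G =
     \<lparr>nsrc = fcmp (nsrc \<mu>) G, ntgt = fcmp (ntgt \<mu>) G,
      nc = (\<lambda>x \<in> cobj (fdom (nsrc \<mu>)). fa G (nc \<mu> x))\<rparr>"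

definition Fun ::
  "('x, 'm) cat \<Rightarrow> ('y, 'n) cat \<Rightarrow> (('x, 'm, 'y, 'n) fnctr, ('x, 'm, 'y, 'n) ntrans) cat" where
  "Fun J K =
     \<lparr>cobj = {F. is_functor F \<and> fdom F = J \<and> fcod F = K},
      carr = {\<nu>. is_ntrans \<nu> \<and> fdom (nsrc \<nu>) = J \<and> fcod (nsrc \<nu>) = K},
      cdom = nsrc, ccod = ntgt, cid = nid, ccomp = nvcomp\<rparr>"

text \<open>The linear order \<open>{0 < \<dots> < k}\<close> as a category, and the functor
  \<open>\<delta>\<close> from the order on the positions of a list \<open>as\<close> to \<open>[l]\<close>, sending \<open>j\<close> to \<open>as ! j\<close>.\<close>

definition ord_cat :: "nat \<Rightarrow> (nat, nat \<times> nat) cat" where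
  "ord_cat k =
     \<lparr>cobj = {0..k}, carr = {(i, j). i \<le> j \<and> j \<le> k}, cdom = fst, ccod = snd,
      cid = (\<lambda>i. (i, i)), ccomp = (\<lambda>p q. (fst p, snd q))\<rparr>"

definition delta :: "nat list \<Rightarrow> nat \<Rightarrow> (nat, nat \<times> nat, nat, nat \<times> nat) fnctr" where
  "delta as l = (let J = ord_cat (length as - 1) in
     \<lparr>fdom = J, fcod = ord_cat l,
      fo = (\<lambda>j \<in> cobj J. as ! j),
      fa = (\<lambda>p \<in> carr J. (as ! fst p, as ! snd p))\<rparr>)"

section \<open>Strict 2-categories\<close>

record ('o, 'a, 'c) two_cat =
  obj :: "'o set"
  mor :: "'a set"
  src :: "'a \<Rightarrow> 'o"
  tgt :: "'a \<Rightarrow> 'o"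
  idm :: "'o \<Rightarrow> 'a"
  cmp :: "'a \<Rightarrow> 'a \<Rightarrow> 'a"  (infixl "\<Zsemi>\<index>" 75)
  cell :: "'c set"
  csrc :: "'c \<Rightarrow> 'a"
  ctgt :: "'c \<Rightarrow> 'a"
  idc :: "'a \<Rightarrow> 'c"
  vcmp :: "'c \<Rightarrow> 'c \<Rightarrow> 'c"  (infixl "\<odot>\<index>" 70)
  hcmp :: "'c \<Rightarrow> 'c \<Rightarrow> 'c"  (infixl "\<star>\<index>" 75)

definition mors :: "('o, 'a, 'c) two_cat \<Rightarrow> 'o \<Rightarrow> 'o \<Rightarrow> 'a set" where
  "mors C X Y = {f \<in> mor C. src C f = X \<and> tgt C f = Y}"

definition cells :: "('o, 'a, 'c) two_cat \<Rightarrow> 'a \<Rightarrow> 'a \<Rightarrow> 'c set" where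
  "cells C f g = {\<alpha> \<in> cell C. csrc C \<alpha> = f \<and> ctgt C \<alpha> = g}"

definition und :: "('o, 'a, 'c) two_cat \<Rightarrow> ('o, 'a) cat" where
  "und C = \<lparr>cobj = obj C, carr = mor C, cdom = src C, ccod = tgt C, cid = idm C, ccomp = cmp C\<rparr>"

definition hom :: "('o, 'a, 'c) two_cat \<Rightarrow> 'o \<Rightarrow> 'o \<Rightarrow> ('a, 'c) cat" where
  "hom C X Y =
     \<lparr>cobj = mors C X Y,
      carr = {\<alpha> \<in> cell C. csrc C \<alpha> \<in> mors C X Y \<and> ctgt C \<alpha> \<in> mors C X Y},
      cdom = csrc C, ccod = ctgt C, cid = idc C, ccomp = vcmp C\<rparr>"

definition whisk_l :: "('o, 'a, 'c) two_cat \<Rightarrow> 'a \<Rightarrow> 'c \<Rightarrow> 'c"  ("(_ \<rhd>\<index> _)" [76, 75] 75) where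
  "whisk_l C f \<alpha> = idc C f \<star>\<^bsub>C\<^esub> \<alpha>"

definition whisk_r :: "('o, 'a, 'c) two_cat \<Rightarrow> 'c \<Rightarrow> 'a \<Rightarrow> 'c"  ("(_ \<lhd>\<index> _)" [75, 76] 75) where
  "whisk_r C \<alpha> f = \<alpha> \<star>\<^bsub>C\<^esub> idc C f"

locale two_category =
  fixes C :: "('o, 'a, 'c) two_cat" (structure)
  assumes und_category: "category (und C)"
    and cell_hom: "\<alpha> \<in> cell C \<Longrightarrow> \<exists>X \<in> obj C. \<exists>Y \<in> obj C. \<alpha> \<in> carr (hom C X Y)"
    and hom_category: "\<lbrakk>X \<in> obj C; Y \<in> obj C\<rbrakk> \<Longrightarrow> category (hom C X Y)"
    and hcmp_cells: "\<lbrakk>\<alpha> \<in> cell C; \<beta> \<in> cell C; tgt C (csrc C \<alpha>) = src C (csrc C \<beta>)\<rbrakk>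
          \<Longrightarrow> \<alpha> \<star> \<beta> \<in> cells C (csrc C \<alpha> \<Zsemi> csrc C \<beta>) (ctgt C \<alpha> \<Zsemi> ctgt C \<beta>)"
    and hcmp_idc: "\<lbrakk>f \<in> mor C; g \<in> mor C; tgt C f = src C g\<rbrakk>
          \<Longrightarrow> idc C f \<star> idc C g = idc C (f \<Zsemi> g)"
    and interchange: "\<lbrakk>\<alpha> \<in> cell C; \<alpha>' \<in> cell C; \<beta> \<in> cell C; \<beta>' \<in> cell C;
            ctgt C \<alpha> = csrc C \<alpha>'; ctgt C \<beta> = csrc C \<beta>';
            tgt C (csrc C \<alpha>) = src C (csrc C \<beta>)\<rbrakk>
          \<Longrightarrow> (\<alpha> \<odot> \<alpha>') \<star> (\<beta> \<odot> \<beta>') = (\<alpha> \<star> \<beta>) \<odot> (\<alpha>' \<star> \<beta>')"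
    and hcmp_id_left: "\<alpha> \<in> cell C \<Longrightarrow> idc C (idm C (src C (csrc C \<alpha>))) \<star> \<alpha> = \<alpha>"
    and hcmp_id_right: "\<alpha> \<in> cell C \<Longrightarrow> \<alpha> \<star> idc C (idm C (tgt C (csrc C \<alpha>))) = \<alpha>"
    and hcmp_assoc: "\<lbrakk>\<alpha> \<in> cell C; \<beta> \<in> cell C; \<gamma> \<in> cell C;
            tgt C (csrc C \<alpha>) = src C (csrc C \<beta>); tgt C (csrc C \<beta>) = src C (csrc C \<gamma>)\<rbrakk>
          \<Longrightarrow> (\<alpha> \<star> \<beta>) \<star> \<gamma> = \<alpha> \<star> (\<beta> \<star> \<gamma>)"

text \<open>\<open>post C A f\<close> is \<open>(f\<^sub>*)\<^sub>A\<close>, and \<open>post2 C A \<alpha>\<close> is \<open>(\<alpha>\<^sub>*)\<^sub>A\<close>. Likewise \<open>pre C u X\<close> is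
  \<open>u\<^sup>* : C(A,X) \<rightarrow> C(A',X)\<close> for \<open>u : A' \<rightarrow> A\<close>, and \<open>pre2\<close> is its analogue for 2-cells.\<close>

definition post :: "('o, 'a, 'c) two_cat \<Rightarrow> 'o \<Rightarrow> 'a \<Rightarrow> ('a, 'c, 'a, 'c) fnctr" where
  "post C A f =
     \<lparr>fdom = hom C A (src C f), fcod = hom C A (tgt C f),
      fo = (\<lambda>u \<in> cobj (hom C A (src C f)). u \<Zsemi>\<^bsub>C\<^esub> f),
      fa = (\<lambda>\<phi> \<in> carr (hom C A (src C f)). \<phi> \<lhd>\<^bsub>C\<^esub> f)\<rparr>"

definition post2 :: "('o, 'a, 'c) two_cat \<Rightarrow> 'o \<Rightarrow> 'c \<Rightarrow> ('a, 'c, 'a, 'c) ntrans" where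
  "post2 C A \<alpha> =
     \<lparr>nsrc = post C A (csrc C \<alpha>), ntgt = post C A (ctgt C \<alpha>),
      nc = (\<lambda>u \<in> cobj (hom C A (src C (csrc C \<alpha>))). u \<rhd>\<^bsub>C\<^esub> \<alpha>)\<rparr>"

definition pre :: "('o, 'a, 'c) two_cat \<Rightarrow> 'a \<Rightarrow> 'o \<Rightarrow> ('a, 'c, 'a, 'c) fnctr" where
  "pre C u X =
     \<lparr>fdom = hom C (tgt C u) X, fcod = hom C (src C u) X,
      fo = (\<lambda>f \<in> cobj (hom C (tgt C u) X). u \<Zsemi>\<^bsub>C\<^esub> f),
      fa = (\<lambda>\<alpha> \<in> carr (hom C (tgt C u) X). u \<rhd>\<^bsub>C\<^esub> \<alpha>)\<rparr>"

definition pre2 :: "('o, 'a, 'c) two_cat \<Rightarrow> 'c \<Rightarrow> 'o \<Rightarrow> ('a, 'c, 'a, 'c) ntrans" where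
  "pre2 C \<phi> X =
     \<lparr>nsrc = pre C (csrc C \<phi>) X, ntgt = pre C (ctgt C \<phi>) X,
      nc = (\<lambda>f \<in> cobj (hom C (tgt C (csrc C \<phi>)) X). \<phi> \<lhd>\<^bsub>C\<^esub> f)\<rparr>"

text \<open>The 2-category obtained by reversing the 1-cells (but not the 2-cells).\<close>

definition op2 :: "('o, 'a, 'c) two_cat \<Rightarrow> ('o, 'a, 'c) two_cat" where
  "op2 C = C\<lparr>src := tgt C, tgt := src C, cmp := (\<lambda>f g. g \<Zsemi>\<^bsub>C\<^esub> f), hcmp := (\<lambda>\<alpha> \<beta>. \<beta> \<star>\<^bsub>C\<^esub> \<alpha>)\<rparr>"

definition full_sub :: "('o, 'a, 'c) two_cat \<Rightarrow> 'o set \<Rightarrow> ('o, 'a, 'c) two_cat" where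
  "full_sub C S = C
     \<lparr>obj := obj C \<inter> S,
      mor := {f \<in> mor C. src C f \<in> S \<and> tgt C f \<in> S},
      cell := {\<alpha> \<in> cell C. src C (csrc C \<alpha>) \<in> S \<and> tgt C (csrc C \<alpha>) \<in> S}\<rparr>"

section \<open>2-functors, strict natural transformations, modifications\<close>

record ('o, 'a, 'c, 'p, 'b, 'd) two_fun =
  tdom :: "('o, 'a, 'c) two_cat"
  tcod :: "('p, 'b, 'd) two_cat"
  to :: "'o \<Rightarrow> 'p"
  tm :: "'a \<Rightarrow> 'b"
  tc :: "'c \<Rightarrow> 'd"

definition two_functor :: "('o, 'a, 'c, 'p, 'b, 'd) two_fun \<Rightarrow> bool" where
  "two_functor F \<longleftrightarrow> (let A = tdom F; B = tcod F in
     to F \<in> obj A \<rightarrow>\<^sub>E obj B \<and> tm F \<in> mor A \<rightarrow>\<^sub>E mor B \<and> tc F \<in> cell A \<rightarrow>\<^sub>E cell B \<and>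
     (\<forall>f \<in> mor A. src B (tm F f) = to F (src A f) \<and> tgt B (tm F f) = to F (tgt A f)) \<and>
     (\<forall>X \<in> obj A. tm F (idm A X) = idm B (to F X)) \<and>
     (\<forall>f \<in> mor A. \<forall>g \<in> mor A. tgt A f = src A g \<longrightarrow>
        tm F (f \<Zsemi>\<^bsub>A\<^esub> g) = tm F f \<Zsemi>\<^bsub>B\<^esub> tm F g) \<and>
     (\<forall>\<alpha> \<in> cell A. csrc B (tc F \<alpha>) = tm F (csrc A \<alpha>) \<and> ctgt B (tc F \<alpha>) = tm F (ctgt A \<alpha>)) \<and>
     (\<forall>f \<in> mor A. tc F (idc A f) = idc B (tm F f)) \<and>
     (\<forall>\<alpha> \<in> cell A. \<forall>\<beta> \<in> cell A. ctgt A \<alpha> = csrc A \<beta> \<longrightarrow>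
        tc F (\<alpha> \<odot>\<^bsub>A\<^esub> \<beta>) = tc F \<alpha> \<odot>\<^bsub>B\<^esub> tc F \<beta>) \<and>
     (\<forall>\<alpha> \<in> cell A. \<forall>\<beta> \<in> cell A. tgt A (csrc A \<alpha>) = src A (csrc A \<beta>) \<longrightarrow>
        tc F (\<alpha> \<star>\<^bsub>A\<^esub> \<beta>) = tc F \<alpha> \<star>\<^bsub>B\<^esub> tc F \<beta>))"

definition hom_functor ::
  "('o, 'a, 'c, 'p, 'b, 'd) two_fun \<Rightarrow> 'o \<Rightarrow> 'o \<Rightarrow> ('a, 'c, 'b, 'd) fnctr" where
  "hom_functor F X Y =
     \<lparr>fdom = hom (tdom F) X Y, fcod = hom (tcod F) (to F X) (to F Y),
      fo = restrict (tm F) (cobj (hom (tdom F) X Y)),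
      fa = restrict (tc F) (carr (hom (tdom F) X Y))\<rparr>"

definition strictly_fully_faithful :: "('o, 'a, 'c, 'p, 'b, 'd) two_fun \<Rightarrow> bool" where
  "strictly_fully_faithful F \<longleftrightarrow>
     (\<forall>X \<in> obj (tdom F). \<forall>Y \<in> obj (tdom F). cat_iso (hom_functor F X Y))"

record ('o, 'a, 'c, 'p, 'b, 'd) two_nat =
  tnsrc :: "('o, 'a, 'c, 'p, 'b, 'd) two_fun"
  tntgt :: "('o, 'a, 'c, 'p, 'b, 'd) two_fun"
  tnc :: "'o \<Rightarrow> 'b"

definition strict_nat :: "('o, 'a, 'c, 'p, 'b, 'd) two_nat \<Rightarrow> bool" where
  "strict_nat \<sigma> \<longleftrightarrow> (let F = tnsrc \<sigma>; G = tntgt \<sigma>; A = tdom F; B = tcod F in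
     two_functor F \<and> two_functor G \<and> tdom G = A \<and> tcod G = B \<and>
     tnc \<sigma> \<in> extensional (obj A) \<and>
     (\<forall>X \<in> obj A. tnc \<sigma> X \<in> mors B (to F X) (to G X)) \<and>
     (\<forall>f \<in> mor A. tm F f \<Zsemi>\<^bsub>B\<^esub> tnc \<sigma> (tgt A f) = tnc \<sigma> (src A f) \<Zsemi>\<^bsub>B\<^esub> tm G f) \<and>
     (\<forall>\<alpha> \<in> cell A. tc F \<alpha> \<lhd>\<^bsub>B\<^esub> tnc \<sigma> (tgt A (csrc A \<alpha>))
                   = tnc \<sigma> (src A (csrc A \<alpha>)) \<rhd>\<^bsub>B\<^esub> tc G \<alpha>))"

record ('o, 'a, 'c, 'p, 'b, 'd) two_mod =
  tmsrc :: "('o, 'a, 'c, 'p, 'b, 'd) two_nat"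
  tmtgt :: "('o, 'a, 'c, 'p, 'b, 'd) two_nat"
  tmc :: "'o \<Rightarrow> 'd"

definition modification :: "('o, 'a, 'c, 'p, 'b, 'd) two_mod \<Rightarrow> bool" where
  "modification \<Theta> \<longleftrightarrow>
    (let \<sigma> = tmsrc \<Theta>; \<theta> = tmtgt \<Theta>; F = tnsrc \<sigma>; G = tntgt \<sigma>; A = tdom F; B = tcod F in
     strict_nat \<sigma> \<and> strict_nat \<theta> \<and> tnsrc \<theta> = F \<and> tntgt \<theta> = G \<and>
     tmc \<Theta> \<in> extensional (obj A) \<and>
     (\<forall>X \<in> obj A. tmc \<Theta> X \<in> cells B (tnc \<sigma> X) (tnc \<theta> X)) \<and>
     (\<forall>f \<in> mor A. tm F f \<rhd>\<^bsub>B\<^esub> tmc \<Theta> (tgt A f) = tmc \<Theta> (src A f) \<lhd>\<^bsub>B\<^esub> tm G f))"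

definition TwoFun ::
  "('o, 'a, 'c) two_cat \<Rightarrow> ('p, 'b, 'd) two_cat \<Rightarrow>
    (('o, 'a, 'c, 'p, 'b, 'd) two_fun,
     ('o, 'a, 'c, 'p, 'b, 'd) two_nat,
     ('o, 'a, 'c, 'p, 'b, 'd) two_mod) two_cat" where
  "TwoFun A B =
     \<lparr>obj = {F. two_functor F \<and> tdom F = A \<and> tcod F = B},
      mor = {\<sigma>. strict_nat \<sigma> \<and> tdom (tnsrc \<sigma>) = A \<and> tcod (tnsrc \<sigma>) = B},
      src = tnsrc,
      tgt = tntgt,
      idm = (\<lambda>F. \<lparr>tnsrc = F, tntgt = F, tnc = (\<lambda>X \<in> obj A. idm B (to F X))\<rparr>),
      cmp = (\<lambda>\<sigma> \<theta>. \<lparr>tnsrc = tnsrc \<sigma>, tntgt = tntgt \<theta>,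
                    tnc = (\<lambda>X \<in> obj A. tnc \<sigma> X \<Zsemi>\<^bsub>B\<^esub> tnc \<theta> X)\<rparr>),
      cell = {\<Theta>. modification \<Theta> \<and> tdom (tnsrc (tmsrc \<Theta>)) = A \<and> tcod (tnsrc (tmsrc \<Theta>)) = B},
      csrc = tmsrc,
      ctgt = tmtgt,
      idc = (\<lambda>\<sigma>. \<lparr>tmsrc = \<sigma>, tmtgt = \<sigma>, tmc = (\<lambda>X \<in> obj A. idc B (tnc \<sigma> X))\<rparr>),
      vcmp = (\<lambda>\<Theta> \<Psi>. \<lparr>tmsrc = tmsrc \<Theta>, tmtgt = tmtgt \<Psi>,
                    tmc = (\<lambda>X \<in> obj A. tmc \<Theta> X \<odot>\<^bsub>B\<^esub> tmc \<Psi> X)\<rparr>),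
      hcmp = (\<lambda>\<Theta> \<Psi>.
        \<lparr>tmsrc = \<lparr>tnsrc = tnsrc (tmsrc \<Theta>), tntgt = tntgt (tmsrc \<Psi>),
                  tnc = (\<lambda>X \<in> obj A. tnc (tmsrc \<Theta>) X \<Zsemi>\<^bsub>B\<^esub> tnc (tmsrc \<Psi>) X)\<rparr>,
         tmtgt = \<lparr>tnsrc = tnsrc (tmtgt \<Theta>), tntgt = tntgt (tmtgt \<Psi>),
                  tnc = (\<lambda>X \<in> obj A. tnc (tmtgt \<Theta>) X \<Zsemi>\<^bsub>B\<^esub> tnc (tmtgt \<Psi>) X)\<rparr>,
         tmc = (\<lambda>X \<in> obj A. tmc \<Theta> X \<star>\<^bsub>B\<^esub> tmc \<Psi> X)\<rparr>)\<rparr>"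

text \<open>The 2-category of all categories with objects in the type \<open>'x\<close> and arrows in the type \<open>'m\<close>.
  For a 2-category with 1-cells in \<open>'x\<close> and 2-cells in \<open>'m\<close> it contains all hom-categories.\<close>

definition Cat ::
  "(('x, 'm) cat, ('x, 'm, 'x, 'm) fnctr, ('x, 'm, 'x, 'm) ntrans) two_cat" where
  "Cat =
     \<lparr>obj = {K. category K},
      mor = {F. is_functor F \<and> category (fdom F) \<and> category (fcod F)},
      src = fdom, tgt = fcod, idm = fid, cmp = fcmp,
      cell = {\<nu>. is_ntrans \<nu> \<and> category (fdom (nsrc \<nu>)) \<and> category (fcod (nsrc \<nu>))},
      csrc = nsrc, ctgt = ntgt, idc = nid, vcmp = nvcomp, hcmp = nhcomp\<rparr>"

section \<open>Limits in a 2-category\<close>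

definition isofibration :: "('o, 'a, 'c) two_cat \<Rightarrow> 'a \<Rightarrow> bool" where
  "isofibration C f \<longleftrightarrow> f \<in> mor C \<and> (\<forall>A \<in> obj C. cat_isofibration (post C A f))"

definition dof :: "('o, 'a, 'c) two_cat \<Rightarrow> 'a \<Rightarrow> bool" where
  "dof C f \<longleftrightarrow> f \<in> mor C \<and> (\<forall>A \<in> obj C. cat_dof (post C A f))"

text \<open>\<open>strict_pullback C p q f g\<close>: the square with vertex \<open>P\<close>, projections \<open>p : P \<rightarrow> X\<close> and
  \<open>q : P \<rightarrow> Y\<close>, over the cospan \<open>f : X \<rightarrow> Z\<close>, \<open>g : Y \<rightarrow> Z\<close>, is a strict pullback.\<close>

definition strict_pullback :: "('o, 'a, 'c) two_cat \<Rightarrow> 'a \<Rightarrow> 'a \<Rightarrow> 'a \<Rightarrow> 'a \<Rightarrow> bool" where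
  "strict_pullback C p q f g \<longleftrightarrow>
     p \<in> mors C (src C p) (src C f) \<and> q \<in> mors C (src C p) (src C g) \<and>
     f \<in> mors C (src C f) (tgt C f) \<and> g \<in> mors C (src C g) (tgt C f) \<and>
     p \<Zsemi>\<^bsub>C\<^esub> f = q \<Zsemi>\<^bsub>C\<^esub> g \<and>
     (\<forall>B \<in> obj C.
        cat_iso (pair_functor (post C B p) (post C B q) (cat_pullback (post C B f) (post C B g))))"

definition strict_product :: "('o, 'a, 'c) two_cat \<Rightarrow> 'o \<Rightarrow> 'o \<Rightarrow> 'o \<Rightarrow> 'a \<Rightarrow> 'a \<Rightarrow> bool" where
  "strict_product C X Y P p q \<longleftrightarrow>
     p \<in> mors C P X \<and> q \<in> mors C P Y \<and>
     (\<forall>B \<in> obj C. cat_iso (pair_functor (post C B p) (post C B q)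
                              (cat_prod (hom C B X) (hom C B Y))))"

definition strict_terminal :: "('o, 'a, 'c) two_cat \<Rightarrow> 'o \<Rightarrow> bool" where
  "strict_terminal C T \<longleftrightarrow> T \<in> obj C \<and> (\<forall>A \<in> obj C. one_morphism_category (hom C A T))"

text \<open>For \<open>ev : J \<rightarrow> C(P,X)\<close>, the comparison functor \<open>C(A,P) \<rightarrow> Fun(J, C(A,X))\<close>.\<close>

definition cotensor_functor ::
  "('o, 'a, 'c) two_cat \<Rightarrow> ('j, 'k) cat \<Rightarrow> 'o \<Rightarrow> 'o \<Rightarrow> ('j, 'k, 'a, 'c) fnctr \<Rightarrow> 'o \<Rightarrow>
    ('a, 'c, ('j, 'k, 'a, 'c) fnctr, ('j, 'k, 'a, 'c) ntrans) fnctr" where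
  "cotensor_functor C J X P ev A =
     \<lparr>fdom = hom C A P, fcod = Fun J (hom C A X),
      fo = (\<lambda>u \<in> cobj (hom C A P). fcmp ev (pre C u X)),
      fa = (\<lambda>\<phi> \<in> carr (hom C A P). fwhisk ev (pre2 C \<phi> X))\<rparr>"

definition is_cotensor ::
  "('o, 'a, 'c) two_cat \<Rightarrow> ('j, 'k) cat \<Rightarrow> 'o \<Rightarrow> 'o \<Rightarrow> ('j, 'k, 'a, 'c) fnctr \<Rightarrow> bool" where
  "is_cotensor C J X P ev \<longleftrightarrow>
     X \<in> obj C \<and> P \<in> obj C \<and> is_functor ev \<and> fdom ev = J \<and> fcod ev = hom C P X \<and>
     (\<forall>A \<in> obj C. cat_iso (cotensor_functor C J X P ev A))"

text \<open>For cotensors \<open>(P, ev)\<close> with \<open>J\<close> and \<open>(P', ev')\<close> with \<open>J'\<close> of \<open>X\<close>, and \<open>\<delta> : J \<rightarrow> J'\<close>: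
  \<open>t\<close> is the induced morphism \<open>P' \<rightarrow> P\<close>.\<close>

definition is_cotensor_map ::
  "('o, 'a, 'c) two_cat \<Rightarrow> 'o \<Rightarrow> 'o \<Rightarrow> ('j', 'k', 'a, 'c) fnctr \<Rightarrow> 'o \<Rightarrow> ('j, 'k, 'a, 'c) fnctr \<Rightarrow>
    ('j, 'k, 'j', 'k') fnctr \<Rightarrow> 'a \<Rightarrow> bool" where
  "is_cotensor_map C X P' ev' P ev \<delta> t \<longleftrightarrow>
     t \<in> mors C P' P \<and> fcmp ev (pre C t X) = fcmp \<delta> ev'"

text \<open>\<open>X\<close> itself is the cotensor of \<open>X\<close> with \<open>[0]\<close>.\<close>

definition ev0 :: "('o, 'a, 'c) two_cat \<Rightarrow> 'o \<Rightarrow> (nat, nat \<times> nat, 'a, 'c) fnctr" where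
  "ev0 C X =
     \<lparr>fdom = ord_cat 0, fcod = hom C X X,
      fo = (\<lambda>_ \<in> cobj (ord_cat 0). idm C X),
      fa = (\<lambda>_ \<in> carr (ord_cat 0). idc C (idm C X))\<rparr>"

abbreviation is_arrow_object ::
  "('o, 'a, 'c) two_cat \<Rightarrow> 'o \<Rightarrow> 'o \<Rightarrow> (nat, nat \<times> nat, 'a, 'c) fnctr \<Rightarrow> bool" where
  "is_arrow_object C X P ev \<equiv> is_cotensor C (ord_cat 1) X P ev"

text \<open>For an arrow object \<open>(P, ev)\<close>, the morphisms \<open>\<partial>\<^sub>0\<close>, \<open>\<partial>\<^sub>1\<close> and the universal 2-cell \<open>\<partial>\<close>.\<close>

abbreviation (input) bd0 :: "(nat, nat \<times> nat, 'a, 'c) fnctr \<Rightarrow> 'a" where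
  "bd0 ev \<equiv> fo ev 0"

abbreviation (input) bd1 :: "(nat, nat \<times> nat, 'a, 'c) fnctr \<Rightarrow> 'a" where
  "bd1 ev \<equiv> fo ev 1"

abbreviation (input) bd :: "(nat, nat \<times> nat, 'a, 'c) fnctr \<Rightarrow> 'c" where
  "bd ev \<equiv> fa ev (0, 1)"

definition pita :: "('o, 'a, 'c) two_cat \<Rightarrow> bool" where
  "pita C \<longleftrightarrow> two_category C \<and>
     (\<exists>T. strict_terminal C T) \<and>
     (\<forall>X \<in> obj C. \<exists>P ev. is_arrow_object C X P ev) \<and>
     (\<forall>f g. isofibration C f \<and> g \<in> mor C \<and> tgt C g = tgt C f \<longrightarrow>
        (\<exists>p q. strict_pullback C p q f g))"

section \<open>Groupoids and cores\<close>

definition groupoid_obj :: "('o, 'a, 'c) two_cat \<Rightarrow> 'o \<Rightarrow> bool" where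
  "groupoid_obj C X \<longleftrightarrow> X \<in> obj C \<and> (\<forall>A \<in> obj C. groupoid (hom C A X))"

definition gpds :: "('o, 'a, 'c) two_cat \<Rightarrow> 'o set" where
  "gpds C = {X. groupoid_obj C X}"

definition arrowwise_iso :: "('o, 'a, 'c) two_cat \<Rightarrow> 'a \<Rightarrow> bool" where
  "arrowwise_iso C f \<longleftrightarrow> f \<in> mor C \<and>
     (\<forall>B \<in> obj C. \<forall>\<alpha> \<in> carr (hom C B (src C f)). iso_arr (hom C B (tgt C f)) (\<alpha> \<lhd>\<^bsub>C\<^esub> f))"

definition arrowwise_iso_cat :: "('o, 'a, 'c) two_cat \<Rightarrow> 'o \<Rightarrow> 'o \<Rightarrow> ('a, 'c) cat" where
  "arrowwise_iso_cat C A X = (hom C A X)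
     \<lparr>cobj := {f \<in> mors C A X. arrowwise_iso C f},
      carr := {\<alpha> \<in> carr (hom C A X). iso_arr (hom C A X) \<alpha> \<and>
                 arrowwise_iso C (csrc C \<alpha>) \<and> arrowwise_iso C (ctgt C \<alpha>)}\<rparr>"

definition is_core :: "('o, 'a, 'c) two_cat \<Rightarrow> 'o \<Rightarrow> 'o \<Rightarrow> 'a \<Rightarrow> bool" where
  "is_core C X K i \<longleftrightarrow> X \<in> obj C \<and> K \<in> obj C \<and> i \<in> mors C K X \<and> arrowwise_iso C i \<and>
     (\<forall>A \<in> obj C. cat_iso ((post C A i)\<lparr>fcod := arrowwise_iso_cat C A X\<rparr>))"

text \<open>For cores \<open>i : K \<rightarrow> X\<close> and \<open>j : L \<rightarrow> Y\<close> and \<open>f : X \<rightarrow> Y\<close>: \<open>h = f\<^sup>i\<^sup>s\<^sup>o : K \<rightarrow> L\<close>.\<close>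

definition is_core_map :: "('o, 'a, 'c) two_cat \<Rightarrow> 'a \<Rightarrow> 'a \<Rightarrow> 'a \<Rightarrow> 'a \<Rightarrow> bool" where
  "is_core_map C i j f h \<longleftrightarrow> h \<in> mors C (src C i) (src C j) \<and> h \<Zsemi>\<^bsub>C\<^esub> j = i \<Zsemi>\<^bsub>C\<^esub> f"

section \<open>Internal categories and congruences\<close>

definition is_pullback :: "('x, 'm) cat \<Rightarrow> 'm \<Rightarrow> 'm \<Rightarrow> 'm \<Rightarrow> 'm \<Rightarrow> bool" where
  "is_pullback K p q f g \<longleftrightarrow>
     p \<in> chom K (cdom K p) (cdom K f) \<and> q \<in> chom K (cdom K p) (cdom K g) \<and>
     f \<in> chom K (cdom K f) (ccod K f) \<and> g \<in> chom K (cdom K g) (ccod K f) \<and>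
     p \<cdot>\<^bsub>K\<^esub> f = q \<cdot>\<^bsub>K\<^esub> g \<and>
     (\<forall>A \<in> cobj K. \<forall>a \<in> chom K A (cdom K f). \<forall>b \<in> chom K A (cdom K g).
        a \<cdot>\<^bsub>K\<^esub> f = b \<cdot>\<^bsub>K\<^esub> g \<longrightarrow>
        (\<exists>!t. t \<in> chom K A (cdom K p) \<and> t \<cdot>\<^bsub>K\<^esub> p = a \<and> t \<cdot>\<^bsub>K\<^esub> q = b))"

record ('x, 'm) icat =
  c0 :: 'x
  c1 :: 'x
  c2 :: 'x
  pi0 :: 'm
  pi1 :: 'm
  ie :: 'm
  pi01 :: 'm
  pi12 :: 'm
  pi02 :: 'm

text \<open>The axioms for units and associativity use generalized elements: \<open>s : A \<rightarrow> C\<^sub>2\<close> is the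
  composable pair of \<open>s \<cdot> \<pi>\<^sub>0\<^sub>1\<close> and \<open>s \<cdot> \<pi>\<^sub>1\<^sub>2\<close>, with composite \<open>s \<cdot> \<pi>\<^sub>0\<^sub>2\<close>. In the last axiom,
  \<open>s = \<langle>a,b\<rangle>\<close>, \<open>t = \<langle>b,c\<rangle>\<close>, \<open>u = \<langle>ab,c\<rangle>\<close> and \<open>v = \<langle>a,bc\<rangle>\<close>.\<close>

locale internal_category =
  fixes K :: "('x, 'm) cat" (structure) and D :: "('x, 'm) icat"
  assumes types:
      "c0 D \<in> cobj K" "c1 D \<in> cobj K" "c2 D \<in> cobj K"
      "pi0 D \<in> chom K (c1 D) (c0 D)" "pi1 D \<in> chom K (c1 D) (c0 D)"
      "ie D \<in> chom K (c0 D) (c1 D)"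
      "pi01 D \<in> chom K (c2 D) (c1 D)" "pi12 D \<in> chom K (c2 D) (c1 D)"
      "pi02 D \<in> chom K (c2 D) (c1 D)"
    and pullback: "is_pullback K (pi01 D) (pi12 D) (pi1 D) (pi0 D)"
    and unit_src: "ie D \<cdot> pi0 D = cid K (c0 D)"
    and unit_tgt: "ie D \<cdot> pi1 D = cid K (c0 D)"
    and comp_src: "pi02 D \<cdot> pi0 D = pi01 D \<cdot> pi0 D"
    and comp_tgt: "pi02 D \<cdot> pi1 D = pi12 D \<cdot> pi1 D"
    and unit_left: "\<lbrakk>s \<in> chom K (c1 D) (c2 D);
            s \<cdot> pi01 D = pi0 D \<cdot> ie D; s \<cdot> pi12 D = cid K (c1 D)\<rbrakk>
          \<Longrightarrow> s \<cdot> pi02 D = cid K (c1 D)"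
    and unit_right: "\<lbrakk>s \<in> chom K (c1 D) (c2 D);
            s \<cdot> pi01 D = cid K (c1 D); s \<cdot> pi12 D = pi1 D \<cdot> ie D\<rbrakk>
          \<Longrightarrow> s \<cdot> pi02 D = cid K (c1 D)"
    and assoc: "\<lbrakk>s \<in> chom K A (c2 D); t \<in> chom K A (c2 D); u \<in> chom K A (c2 D); v \<in> chom K A (c2 D);
            s \<cdot> pi12 D = t \<cdot> pi01 D;
            u \<cdot> pi01 D = s \<cdot> pi02 D; u \<cdot> pi12 D = t \<cdot> pi12 D;
            v \<cdot> pi01 D = s \<cdot> pi01 D; v \<cdot> pi12 D = t \<cdot> pi02 D\<rbrakk>
          \<Longrightarrow> u \<cdot> pi02 D = v \<cdot> pi02 D"

text \<open>\<open>h\<close> is the morphism \<open>\<langle>a,b\<rangle>\<close> into the product \<open>P\<close> with projections \<open>p, q\<close>.\<close>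

definition is_pairing :: "('o, 'a, 'c) two_cat \<Rightarrow> 'o \<Rightarrow> 'a \<Rightarrow> 'a \<Rightarrow> 'a \<Rightarrow> 'a \<Rightarrow> 'a \<Rightarrow> bool" where
  "is_pairing C P p q a b h \<longleftrightarrow> h \<in> mors C (src C a) P \<and> h \<Zsemi>\<^bsub>C\<^esub> p = a \<and> h \<Zsemi>\<^bsub>C\<^esub> q = b"

text \<open>Products, arrow objects and objects of composable triples are unique up to isomorphism and exist
  in the situations below (\<open>C\<close> pita), so the definitions may pick any of them.\<close>

definition internal_double_category :: "('o, 'a, 'c) two_cat \<Rightarrow> ('o, 'a) icat \<Rightarrow> bool" where
  "internal_double_category C D \<longleftrightarrow> internal_category (und C) D \<and>
     (\<exists>P p q h. strict_product C (c0 D) (c0 D) P p q \<and>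
        is_pairing C P p q (pi0 D) (pi1 D) h \<and> isofibration C h)"

definition gbo_congruence :: "('o, 'a, 'c) two_cat \<Rightarrow> ('o, 'a) icat \<Rightarrow> bool" where
  "gbo_congruence C D \<longleftrightarrow> internal_double_category C D \<and>
     groupoid_obj C (c0 D) \<and> groupoid_obj C (c1 D) \<and> groupoid_obj C (c2 D) \<and>
     (\<exists>P p q h. strict_product C (c0 D) (c0 D) P p q \<and>
        is_pairing C P p q (pi0 D) (pi1 D) h \<and> dof C h)"

text \<open>The equation \<open>\<rho>\<langle>\<pi>\<^sub>0,\<pi>\<^sub>1\<rangle> = \<langle>\<partial>, id\<rangle>\<close> of 2-cells into the product is stated by its two components.\<close>

definition is_reflection ::
  "('o, 'a, 'c) two_cat \<Rightarrow> ('o, 'a) icat \<Rightarrow> 'o \<Rightarrow> (nat, nat \<times> nat, 'a, 'c) fnctr \<Rightarrow> 'a \<Rightarrow> bool" where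
  "is_reflection C D P ev r \<longleftrightarrow> r \<in> mors C P (c1 D) \<and>
     (\<exists>\<rho> \<in> cells C r (bd1 ev \<Zsemi>\<^bsub>C\<^esub> ie D).
        \<rho> \<lhd>\<^bsub>C\<^esub> pi0 D = bd ev \<and> \<rho> \<lhd>\<^bsub>C\<^esub> pi1 D = idc C (bd1 ev))"

text \<open>Below, \<open>(E, ev)\<close> is the arrow object of \<open>C\<^sub>0\<close>; \<open>l, m : C\<^sub>3 \<rightarrow> C\<^sub>2\<close> project to the first two and the
  last two of three composable arrows, so \<open>l\<pi>\<^sub>0\<^sub>2, m\<pi>\<^sub>0\<^sub>2 : C\<^sub>3 \<rightarrow> C\<^sub>1\<close> are the maps called
  \<open>\<pi>\<^sub>0\<^sub>2, \<pi>\<^sub>1\<^sub>3\<close> on triples; \<open>P = C\<^sub>0 \<times> C\<^sub>0\<close> and \<open>Q = C\<^sub>1 \<times> C\<^sub>1\<close>. The four sides of the square are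
  \<open>top = \<langle>r, \<tau>r, r\<rangle>\<close>, \<open>left = \<langle>\<partial>\<^sub>0, \<partial>\<^sub>1\<rangle>\<close>, \<open>right = \<langle>\<pi>\<^sub>0\<^sub>2, \<pi>\<^sub>1\<^sub>3\<rangle>\<close> and \<open>bot = e \<times> e\<close>.\<close>

definition complete_congruence :: "('o, 'a, 'c) two_cat \<Rightarrow> ('o, 'a) icat \<Rightarrow> bool" where
  "complete_congruence C D \<longleftrightarrow> gbo_congruence C D \<and>
     (\<exists>E ev r \<tau> l m P p q Q p' q' top left right bot.
        is_arrow_object C (c0 D) E ev \<and>
        is_reflection C D E ev r \<and>
        \<tau> \<in> mors C E E \<and> is_inverse (hom C E (c0 D)) (bd ev) (\<tau> \<rhd>\<^bsub>C\<^esub> bd ev) \<and>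
        is_pullback (und C) l m (pi12 D) (pi01 D) \<and>
        strict_product C (c0 D) (c0 D) P p q \<and>
        strict_product C (c1 D) (c1 D) Q p' q' \<and>
        top \<in> mors C E (src C l) \<and>
        top \<Zsemi>\<^bsub>C\<^esub> l \<Zsemi>\<^bsub>C\<^esub> pi01 D = r \<and>
        top \<Zsemi>\<^bsub>C\<^esub> l \<Zsemi>\<^bsub>C\<^esub> pi12 D = \<tau> \<Zsemi>\<^bsub>C\<^esub> r \<and>
        top \<Zsemi>\<^bsub>C\<^esub> m \<Zsemi>\<^bsub>C\<^esub> pi12 D = r \<and>
        is_pairing C P p q (bd0 ev) (bd1 ev) left \<and>
        is_pairing C Q p' q' (l \<Zsemi>\<^bsub>C\<^esub> pi02 D) (m \<Zsemi>\<^bsub>C\<^esub> pi02 D) right \<and>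
        is_pairing C Q p' q' (p \<Zsemi>\<^bsub>C\<^esub> ie D) (q \<Zsemi>\<^bsub>C\<^esub> ie D) bot \<and>
        strict_pullback C top left right bot)"

section \<open>Nerves and quotients\<close>

text \<open>For cotensors \<open>(P', ev')\<close>, \<open>(P, ev)\<close> of \<open>X\<close> with \<open>J'\<close>, \<open>J\<close> and cores \<open>i'\<close>, \<open>i\<close> of \<open>P'\<close>, \<open>P\<close>:
  \<open>h\<close> is the morphism induced on the cores by \<open>\<delta> : J \<rightarrow> J'\<close>.\<close>

definition is_nerve_map ::
  "('o, 'a, 'c) two_cat \<Rightarrow> 'o \<Rightarrow> 'o \<Rightarrow> ('j', 'k', 'a, 'c) fnctr \<Rightarrow> 'a \<Rightarrow>
    'o \<Rightarrow> ('j, 'k, 'a, 'c) fnctr \<Rightarrow> 'a \<Rightarrow> ('j, 'k, 'j', 'k') fnctr \<Rightarrow> 'a \<Rightarrow> bool" where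
  "is_nerve_map C X P' ev' i' P ev i \<delta> h \<longleftrightarrow>
     (\<exists>t. is_cotensor_map C X P' ev' P ev \<delta> t \<and> is_core_map C i' i t h)"

definition is_nerve_via ::
  "('o, 'a, 'c) two_cat \<Rightarrow> 'o \<Rightarrow> ('o, 'a) icat \<Rightarrow> 'a \<Rightarrow>
    'o \<Rightarrow> (nat, nat \<times> nat, 'a, 'c) fnctr \<Rightarrow> 'a \<Rightarrow>
    'o \<Rightarrow> (nat, nat \<times> nat, 'a, 'c) fnctr \<Rightarrow> 'a \<Rightarrow> bool" where
  "is_nerve_via C X D i0 X1 ev1 i1 X2 ev2 i2 \<longleftrightarrow>
     internal_double_category C D \<and>
     is_cotensor C (ord_cat 1) X X1 ev1 \<and> is_cotensor C (ord_cat 2) X X2 ev2 \<and>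
     is_core C X (c0 D) i0 \<and> is_core C X1 (c1 D) i1 \<and> is_core C X2 (c2 D) i2 \<and>
     is_nerve_map C X X2 ev2 i2 X1 ev1 i1 (delta [0, 1] 2) (pi01 D) \<and>
     is_nerve_map C X X2 ev2 i2 X1 ev1 i1 (delta [1, 2] 2) (pi12 D) \<and>
     is_nerve_map C X X2 ev2 i2 X1 ev1 i1 (delta [0, 2] 2) (pi02 D) \<and>
     is_nerve_map C X X1 ev1 i1 X (ev0 C X) i0 (delta [0] 1) (pi0 D) \<and>
     is_nerve_map C X X1 ev1 i1 X (ev0 C X) i0 (delta [1] 1) (pi1 D) \<and>
     is_nerve_map C X X (ev0 C X) i0 X1 ev1 i1 (delta [0, 0] 0) (ie D)"

definition is_nerve :: "('o, 'a, 'c) two_cat \<Rightarrow> 'o \<Rightarrow> ('o, 'a) icat \<Rightarrow> bool" where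
  "is_nerve C X D \<longleftrightarrow>
     (\<exists>i0 X1 ev1 i1 X2 ev2 i2. is_nerve_via C X D i0 X1 ev1 i1 X2 ev2 i2)"

definition is_cocone :: "('o, 'a, 'c) two_cat \<Rightarrow> ('o, 'a) icat \<Rightarrow> 'o \<Rightarrow> 'a \<times> 'c \<Rightarrow> bool" where
  "is_cocone C D Y \<gamma>\<gamma> \<longleftrightarrow> (case \<gamma>\<gamma> of (\<gamma>, \<gamma>01) \<Rightarrow>
     \<gamma> \<in> mors C (c0 D) Y \<and> \<gamma>01 \<in> cells C (pi0 D \<Zsemi>\<^bsub>C\<^esub> \<gamma>) (pi1 D \<Zsemi>\<^bsub>C\<^esub> \<gamma>) \<and>
     ie D \<rhd>\<^bsub>C\<^esub> \<gamma>01 = idc C \<gamma> \<and>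
     pi02 D \<rhd>\<^bsub>C\<^esub> \<gamma>01 = (pi01 D \<rhd>\<^bsub>C\<^esub> \<gamma>01) \<odot>\<^bsub>C\<^esub> (pi12 D \<rhd>\<^bsub>C\<^esub> \<gamma>01))"

text \<open>An arrow of the category of cocones is a triple of source, underlying 2-cell and target.\<close>

definition Cocone ::
  "('o, 'a, 'c) two_cat \<Rightarrow> ('o, 'a) icat \<Rightarrow> 'o \<Rightarrow>
    ('a \<times> 'c, ('a \<times> 'c) \<times> 'c \<times> ('a \<times> 'c)) cat" where
  "Cocone C D Y =
     \<lparr>cobj = {\<gamma>. is_cocone C D Y \<gamma>},
      carr = {(\<gamma>, \<alpha>, \<gamma>'). is_cocone C D Y \<gamma> \<and> is_cocone C D Y \<gamma>' \<and>
                \<alpha> \<in> cells C (fst \<gamma>) (fst \<gamma>') \<and>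
                (pi0 D \<rhd>\<^bsub>C\<^esub> \<alpha>) \<odot>\<^bsub>C\<^esub> snd \<gamma>' = snd \<gamma> \<odot>\<^bsub>C\<^esub> (pi1 D \<rhd>\<^bsub>C\<^esub> \<alpha>)},
      cdom = fst,
      ccod = (\<lambda>a. snd (snd a)),
      cid = (\<lambda>\<gamma>. (\<gamma>, idc C (fst \<gamma>), \<gamma>)),
      ccomp = (\<lambda>a b. (fst a, fst (snd a) \<odot>\<^bsub>C\<^esub> fst (snd b), snd (snd b)))\<rparr>"

definition cocone_post :: "('o, 'a, 'c) two_cat \<Rightarrow> 'a \<times> 'c \<Rightarrow> 'a \<Rightarrow> 'a \<times> 'c" where
  "cocone_post C \<gamma> f = (fst \<gamma> \<Zsemi>\<^bsub>C\<^esub> f, snd \<gamma> \<lhd>\<^bsub>C\<^esub> f)"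

definition cocone_functor ::
  "('o, 'a, 'c) two_cat \<Rightarrow> ('o, 'a) icat \<Rightarrow> 'o \<Rightarrow> 'a \<times> 'c \<Rightarrow> 'o \<Rightarrow>
    ('a, 'c, 'a \<times> 'c, ('a \<times> 'c) \<times> 'c \<times> ('a \<times> 'c)) fnctr" where
  "cocone_functor C D X \<gamma> Y =
     \<lparr>fdom = hom C X Y, fcod = Cocone C D Y,
      fo = (\<lambda>f \<in> cobj (hom C X Y). cocone_post C \<gamma> f),
      fa = (\<lambda>\<alpha> \<in> carr (hom C X Y).
              (cocone_post C \<gamma> (csrc C \<alpha>), fst \<gamma> \<rhd>\<^bsub>C\<^esub> \<alpha>, cocone_post C \<gamma> (ctgt C \<alpha>)))\<rparr>"

definition strict_quotient ::
  "('o, 'a, 'c) two_cat \<Rightarrow> ('o, 'a) icat \<Rightarrow> 'o \<Rightarrow> 'a \<times> 'c \<Rightarrow> bool" where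
  "strict_quotient C D X \<gamma> \<longleftrightarrow> X \<in> obj C \<and> is_cocone C D X \<gamma> \<and>
     (\<forall>Y \<in> obj C. cat_iso (cocone_functor C D X \<gamma> Y))"

definition groupoidant :: "('o, 'a, 'c) two_cat \<Rightarrow> bool" where
  "groupoidant C \<longleftrightarrow> pita C \<and>
     (\<forall>X \<in> obj C. \<exists>K i. is_core C X K i) \<and>
     (\<forall>D. complete_congruence C D \<longrightarrow> (\<exists>X \<in> obj C. is_nerve C X D)) \<and>
     (\<forall>X D i0 X1 ev1 i1 X2 ev2 i2. is_nerve_via C X D i0 X1 ev1 i1 X2 ev2 i2 \<longrightarrow>
        strict_quotient C D X (i0, i1 \<rhd>\<^bsub>C\<^esub> bd ev1))"

section \<open>The restricted Yoneda 2-functor\<close>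

definition gpd :: "('o, 'a, 'c) two_cat \<Rightarrow> ('o, 'a, 'c) two_cat" where
  "gpd C = full_sub C (gpds C)"

definition yo_obj ::
  "('o, 'a, 'c) two_cat \<Rightarrow> 'o \<Rightarrow>
    ('o, 'a, 'c, ('a, 'c) cat, ('a, 'c, 'a, 'c) fnctr, ('a, 'c, 'a, 'c) ntrans) two_fun" where
  "yo_obj C X =
     \<lparr>tdom = op2 (gpd C), tcod = Cat,
      to = (\<lambda>A \<in> obj (gpd C). hom C A X),
      tm = (\<lambda>u \<in> mor (gpd C). pre C u X),
      tc = (\<lambda>\<phi> \<in> cell (gpd C). pre2 C \<phi> X)\<rparr>"

definition yo_mor ::
  "('o, 'a, 'c) two_cat \<Rightarrow> 'a \<Rightarrow>
    ('o, 'a, 'c, ('a, 'c) cat, ('a, 'c, 'a, 'c) fnctr, ('a, 'c, 'a, 'c) ntrans) two_nat" where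
  "yo_mor C f =
     \<lparr>tnsrc = yo_obj C (src C f), tntgt = yo_obj C (tgt C f),
      tnc = (\<lambda>A \<in> obj (gpd C). post C A f)\<rparr>"

definition yo_cell ::
  "('o, 'a, 'c) two_cat \<Rightarrow> 'c \<Rightarrow>
    ('o, 'a, 'c, ('a, 'c) cat, ('a, 'c, 'a, 'c) fnctr, ('a, 'c, 'a, 'c) ntrans) two_mod" where
  "yo_cell C \<alpha> =
     \<lparr>tmsrc = yo_mor C (csrc C \<alpha>), tmtgt = yo_mor C (ctgt C \<alpha>),
      tmc = (\<lambda>A \<in> obj (gpd C). post2 C A \<alpha>)\<rparr>"

definition restricted_yoneda where
  "restricted_yoneda C =
     \<lparr>tdom = C, tcod = TwoFun (op2 (gpd C)) Cat,
      to = restrict (yo_obj C) (obj C),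
      tm = restrict (yo_mor C) (mor C),
      tc = restrict (yo_cell C) (cell C)\<rparr>"

end

theory Submission
  imports Defs
begin

text \<open>
  The arrow object, the object of composable pairs (a pullback of arrow objects) and their cores
  form the nerve of \<open>X\<close>, so \<open>X\<close> is the strict quotient of a diagram of groupoids. Every morphism
  from a groupoid \<open>A\<close> to \<open>X\<close> is an arrow-wise isomorphism and hence factors through
  \<open>i : X\<^sup>i\<^sup>s\<^sup>o \<rightarrow> X\<close>, and every 2-cell between such morphisms is a whiskering of the tautological
  2-cell on \<open>(X\<^sup>\<rightarrow>)\<^sup>i\<^sup>s\<^sup>o\<close>. By naturality a family \<open>F\<^sub>A : C(A,X) \<rightarrow> C(A,Y)\<close> is therefore determined by
  its values on these two, which form a cocone under the nerve because each \<open>F\<^sub>A\<close> is a functor; the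
  quotient property turns the cocone into a morphism \<open>X \<rightarrow> Y\<close>. Families of natural transformations
  correspond to morphisms of cocones in the same way.
\<close>

section \<open>Isomorphisms of categories\<close>

text \<open>The quotient axiom speaks of nerves, so most of the work is to show that every object
  has one. A pita 2-category offers only arrow objects, a terminal object and pullbacks of
  isofibrations. Hence \<open>X^[2]\<close> is taken as the pullback of the target morphism of the
  arrow object along its source morphism, which requires the former to be an isofibration, and the
  product in the isofibration condition on the nerve is a pullback over the terminal object. Both
  isofibrations rest on one fact: an arrow can be conjugated by isomorphisms at its two ends. Taking
  cores preserves composable pairs because a morphism into \<open>X^[2]\<close> is an arrow-wise iso
  as soon as its two projections to the arrow object are. The composition law of a cocone is an
  equation of 2-cells on the core of \<open>X^[2]\<close>; that core is a groupoid too, so the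
  equation follows from functoriality of the member of the family at this groupoid.\<close>

lemma is_functorD:
  assumes "is_functor F"
  shows "x \<in> cobj (fdom F) \<Longrightarrow> fo F x \<in> cobj (fcod F)"
    and "m \<in> carr (fdom F) \<Longrightarrow> fa F m \<in> carr (fcod F)"
    and "m \<in> carr (fdom F) \<Longrightarrow> cdom (fcod F) (fa F m) = fo F (cdom (fdom F) m)"
    and "m \<in> carr (fdom F) \<Longrightarrow> ccod (fcod F) (fa F m) = fo F (ccod (fdom F) m)"
    and "x \<in> cobj (fdom F) \<Longrightarrow> fa F (cid (fdom F) x) = cid (fcod F) (fo F x)"
    and "\<lbrakk>m \<in> carr (fdom F); n \<in> carr (fdom F); ccod (fdom F) m = cdom (fdom F) n\<rbrakk>
      \<Longrightarrow> fa F (m \<cdot>\<^bsub>fdom F\<^esub> n) = fa F m \<cdot>\<^bsub>fcod F\<^esub> fa F n"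
    and "fo F \<in> extensional (cobj (fdom F))"
    and "fa F \<in> extensional (carr (fdom F))"
  using assms unfolding is_functor_def by (auto simp: PiE_iff)

lemma functor_eqI:
  assumes "is_functor F" "is_functor G" "fdom F = fdom G" "fcod F = fcod G"
    and "\<And>x. x \<in> cobj (fdom F) \<Longrightarrow> fo F x = fo G x"
    and "\<And>m. m \<in> carr (fdom F) \<Longrightarrow> fa F m = fa G m"
  shows "F = G"
proof -
  have "fo F = fo G"
    by (rule extensionalityI[where A="cobj (fdom F)"])
       (use assms is_functorD(7)[OF assms(1)] is_functorD(7)[OF assms(2)] in auto)
  moreover have "fa F = fa G"
    by (rule extensionalityI[where A="carr (fdom F)"])
       (use assms is_functorD(8)[OF assms(1)] is_functorD(8)[OF assms(2)] in auto)
  ultimately show ?thesis using assms by (auto intro: fnctr.equality)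
qed

lemma ntrans_eqI:
  assumes "is_ntrans \<mu>" "is_ntrans \<nu>" "nsrc \<mu> = nsrc \<nu>" "ntgt \<mu> = ntgt \<nu>"
    and "\<And>x. x \<in> cobj (fdom (nsrc \<mu>)) \<Longrightarrow> nc \<mu> x = nc \<nu> x"
  shows "\<mu> = \<nu>"
proof -
  have "nc \<mu> = nc \<nu>"
    by (rule extensionalityI[where A="cobj (fdom (nsrc \<mu>))"])
       (use assms in \<open>auto simp: is_ntrans_def Let_def\<close>)
  then show ?thesis using assms by (auto intro: ntrans.equality)
qed

lemma is_ntransD:
  assumes "is_ntrans \<nu>"
  shows "is_functor (nsrc \<nu>)" "is_functor (ntgt \<nu>)"
    and "fdom (ntgt \<nu>) = fdom (nsrc \<nu>)" "fcod (ntgt \<nu>) = fcod (nsrc \<nu>)"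
    and "nc \<nu> \<in> extensional (cobj (fdom (nsrc \<nu>)))"
    and "x \<in> cobj (fdom (nsrc \<nu>)) \<Longrightarrow> nc \<nu> x \<in> chom (fcod (nsrc \<nu>)) (fo (nsrc \<nu>) x) (fo (ntgt \<nu>) x)"
    and "m \<in> carr (fdom (nsrc \<nu>)) \<Longrightarrow>
      fa (nsrc \<nu>) m \<cdot>\<^bsub>fcod (nsrc \<nu>)\<^esub> nc \<nu> (ccod (fdom (nsrc \<nu>)) m) =
      nc \<nu> (cdom (fdom (nsrc \<nu>)) m) \<cdot>\<^bsub>fcod (nsrc \<nu>)\<^esub> fa (ntgt \<nu>) m"
  using assms unfolding is_ntrans_def Let_def by auto

text \<open>With \<open>cat_isoI\<close> this trades an isomorphism of categories for bijections on
  objects and on arrows. Every universal property is then used as two unique-existence statements,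
  one for morphisms and one for 2-cells.\<close>

lemma cat_isoD:
  assumes "cat_iso F"
  shows "is_functor F" "bij_betw (fo F) (cobj (fdom F)) (cobj (fcod F))"
    and "bij_betw (fa F) (carr (fdom F)) (carr (fcod F))"
proof -
  obtain G where F: "is_functor F" and G: "is_functor G" "fdom G = fcod F" "fcod G = fdom F"
    and FG: "fcmp F G = fid (fdom F)" and GF: "fcmp G F = fid (fcod F)"
    using assms unfolding cat_iso_def by auto
  show "is_functor F" by fact
  have 1: "fo (fcmp F G) x = x" if "x \<in> cobj (fdom F)" for x
    using that FG by (simp add: fid_def)
  have 2: "fo (fcmp G F) x = x" if "x \<in> cobj (fcod F)" for x
    using that GF by (simp add: fid_def)
  have 3: "fa (fcmp F G) x = x" if "x \<in> carr (fdom F)" for x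
    using that FG by (simp add: fid_def)
  have 4: "fa (fcmp G F) x = x" if "x \<in> carr (fcod F)" for x
    using that GF by (simp add: fid_def)
  show "bij_betw (fo F) (cobj (fdom F)) (cobj (fcod F))"
    by (rule bij_betw_byWitness[where f'="fo G"])
       (use 1 2 is_functorD[OF F] is_functorD[OF G(1)] G in \<open>auto simp: fcmp_def\<close>)
  show "bij_betw (fa F) (carr (fdom F)) (carr (fcod F))"
    by (rule bij_betw_byWitness[where f'="fa G"])
       (use 3 4 is_functorD[OF F] is_functorD[OF G(1)] G in \<open>auto simp: fcmp_def\<close>)
qed

text \<open>The inverse functions of a functor that is bijective on objects and arrows preserve the
  structure by themselves. Category laws are asked of the source only: the targets met later,
  \<open>Fun\<close> and the hom-categories of \<open>TwoFun\<close>, are given as bare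
  records.\<close>

lemma cat_isoI:
  assumes F: "is_functor F" and cat: "category (fdom F)"
    and bo: "bij_betw (fo F) (cobj (fdom F)) (cobj (fcod F))"
    and ba: "bij_betw (fa F) (carr (fdom F)) (carr (fcod F))"
  shows "cat_iso F"
proof -
  interpret category "fdom F" by fact
  define G where "G = \<lparr>fdom = fcod F, fcod = fdom F,
    fo = (\<lambda>x \<in> cobj (fcod F). inv_into (cobj (fdom F)) (fo F) x),
    fa = (\<lambda>m \<in> carr (fcod F). inv_into (carr (fdom F)) (fa F) m)\<rparr>"
  have Gsel: "fdom G = fcod F" "fcod G = fdom F" by (simp_all add: G_def)
  have Fo: "fo F x \<in> cobj (fcod F)" "fo G (fo F x) = x" if "x \<in> cobj (fdom F)" for x
    using that bo is_functorD(1)[OF F] by (auto simp: G_def bij_betw_def)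
  have Fa: "fa F m \<in> carr (fcod F)" "fa G (fa F m) = m" if "m \<in> carr (fdom F)" for m
    using that ba is_functorD(2)[OF F] by (auto simp: G_def bij_betw_def)
  have exo: "\<exists>y\<in>cobj (fdom F). x = fo F y" if "x \<in> cobj (fcod F)" for x
    using that bo by (auto simp: bij_betw_def)
  have exa: "\<exists>y\<in>carr (fdom F). x = fa F y" if "x \<in> carr (fcod F)" for x
    using that ba by (auto simp: bij_betw_def)
  have injo: "x = y" if "fo F x = fo F y" "x \<in> cobj (fdom F)" "y \<in> cobj (fdom F)" for x y
    using that bo by (auto simp: bij_betw_def inj_on_def)
  have G: "is_functor G"
    unfolding is_functor_def Gsel
  proof (intro conjI ballI impI)
    show "fo G \<in> cobj (fcod F) \<rightarrow>\<^sub>E cobj (fdom F)"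
      using Fo exo by (fastforce simp: PiE_iff G_def)
    show "fa G \<in> carr (fcod F) \<rightarrow>\<^sub>E carr (fdom F)"
      using Fa exa by (fastforce simp: PiE_iff G_def)
    fix m assume "m \<in> carr (fcod F)"
    then obtain l where l: "l \<in> carr (fdom F)" "m = fa F l" using exa by blast
    show "cdom (fdom F) (fa G m) = fo G (cdom (fcod F) m)"
      and "ccod (fdom F) (fa G m) = fo G (ccod (fcod F) m)"
      using l Fa Fo is_functorD(3,4)[OF F] dom_obj cod_obj by auto
    fix n assume "n \<in> carr (fcod F)" and mn: "ccod (fcod F) m = cdom (fcod F) n"
    then obtain k where k: "k \<in> carr (fdom F)" "n = fa F k" using exa by blast
    \<comment> \<open>Composability of the preimages is recovered from that of the images by
      injectivity on objects.\<close>
    have lk: "ccod (fdom F) l = cdom (fdom F) k"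
      using mn l k is_functorD(3,4)[OF F] dom_obj cod_obj by (auto intro!: injo)
    have c: "l \<cdot>\<^bsub>fdom F\<^esub> k \<in> carr (fdom F)" using comp_hom[OF l(1) k(1) lk] by (simp add: chom_def)
    show "fa G (m \<cdot>\<^bsub>fcod F\<^esub> n) = fa G m \<cdot>\<^bsub>fdom F\<^esub> fa G n"
      using is_functorD(6)[OF F l(1) k(1) lk] Fa(2)[OF c] Fa(2)[OF l(1)] Fa(2)[OF k(1)] l k by simp
  next
    fix x assume "x \<in> cobj (fcod F)"
    then obtain y where y: "y \<in> cobj (fdom F)" "x = fo F y" using exo by blast
    have "cid (fdom F) y \<in> carr (fdom F)" using id_hom[OF y(1)] by (simp add: chom_def)
    from Fa(2)[OF this] show "fa G (cid (fcod F) x) = cid (fdom F) (fo G x)"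
      using is_functorD(5)[OF F y(1)] Fo y by simp
  qed
  have "fcmp F G = fid (fdom F)"
    unfolding fcmp_def fid_def using Fo Fa by (auto simp: Gsel restrict_def)
  moreover have "fcmp G F = fid (fcod F)"
  proof -
    have "fo F (fo G x) = x" if "x \<in> cobj (fcod F)" for x using exo[OF that] Fo by auto
    moreover have "fa F (fa G x) = x" if "x \<in> carr (fcod F)" for x using exa[OF that] Fa by auto
    ultimately show ?thesis unfolding fcmp_def fid_def by (auto simp: Gsel restrict_def)
  qed
  ultimately show ?thesis unfolding cat_iso_def using F G Gsel by blast
qed

lemma bij_betw_ex1I:
  assumes "\<And>x. x \<in> A \<Longrightarrow> f x \<in> B" and "\<And>y. y \<in> B \<Longrightarrow> \<exists>!x. x \<in> A \<and> f x = y"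
  shows "bij_betw f A B"
  unfolding bij_betw_def inj_on_def using assms by (auto simp: image_iff) metis+

lemma bij_betw_ex1D: "\<lbrakk>bij_betw f A B; y \<in> B\<rbrakk> \<Longrightarrow> \<exists>!x. x \<in> A \<and> f x = y"
  unfolding bij_betw_def inj_on_def by (auto simp: image_iff)

lemma (in category) inverse_unique:
  assumes "is_inverse K m n" "is_inverse K m n'"
  shows "n = n'"
proof -
  have M: "m \<in> carr K" "n \<in> carr K" "n' \<in> carr K" "ccod K n = cdom K m" "cdom K n = ccod K m"
    "cdom K n' = ccod K m" "m \<cdot> n' = cid K (cdom K m)" "n \<cdot> m = cid K (ccod K m)"
    using assms unfolding is_inverse_def by blast+
  have "n = n \<cdot> (m \<cdot> n')" using M(4,7) comp_id[OF M(2)] by simp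
  also have "\<dots> = (n \<cdot> m) \<cdot> n'" using comp_assoc[OF M(2,1,3,4)] M(6) by simp
  also have "\<dots> = n'" using M(6,8) id_comp[OF M(3)] by simp
  finally show ?thesis .
qed

lemma (in category) iso_arr_comp:
  assumes "iso_arr K m" "iso_arr K n" "ccod K m = cdom K n"
  shows "iso_arr K (m \<cdot> n)"
proof -
  obtain m' n' where m: "is_inverse K m m'" and n: "is_inverse K n n'"
    using assms unfolding iso_arr_def by auto
  note M = m[unfolded is_inverse_def] and N = n[unfolded is_inverse_def]
  have h: "m \<cdot> n \<in> chom K (cdom K m) (ccod K n)" "n' \<cdot> m' \<in> chom K (ccod K n) (cdom K m)"
    using comp_hom[of m n] comp_hom[of n' m'] M N assms by auto
  have mm: "m' \<cdot> (m \<cdot> n) = n"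
    using comp_assoc[of m' m n] M N assms(3) id_comp[of n] by simp
  have nn: "n \<cdot> (n' \<cdot> m') = m'"
    using comp_assoc[of n n' m'] M N assms(3) id_comp[of m'] by simp
  have "(m \<cdot> n) \<cdot> (n' \<cdot> m') = cid K (cdom K m)"
    using comp_assoc[of m n "n' \<cdot> m'"] h M N assms(3) nn by (simp add: chom_def)
  moreover have "(n' \<cdot> m') \<cdot> (m \<cdot> n) = cid K (ccod K n)"
    using comp_assoc[of n' m' "m \<cdot> n"] h M N assms(3) mm by (simp add: chom_def)
  ultimately have "is_inverse K (m \<cdot> n) (n' \<cdot> m')"
    using h by (simp add: is_inverse_def chom_def)
  then show ?thesis by (auto simp: iso_arr_def)
qed

lemma functor_inverse:
  assumes "is_functor F" "is_inverse (fdom F) m n" "category (fdom F)"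
  shows "is_inverse (fcod F) (fa F m) (fa F n)"
proof -
  interpret category "fdom F" by fact
  note F = is_functorD[OF assms(1)]
  have M: "m \<in> carr (fdom F)" "n \<in> carr (fdom F)"
    "cdom (fdom F) n = ccod (fdom F) m" "ccod (fdom F) n = cdom (fdom F) m"
    "m \<cdot>\<^bsub>fdom F\<^esub> n = cid (fdom F) (cdom (fdom F) m)"
    "n \<cdot>\<^bsub>fdom F\<^esub> m = cid (fdom F) (ccod (fdom F) m)"
    using assms(2) unfolding is_inverse_def by blast+
  show ?thesis unfolding is_inverse_def
    using F(6)[OF M(1,2) M(3)[symmetric]] F(6)[OF M(2,1) M(4)]
    by (simp add: F(2-5) M dom_obj cod_obj)
qed

lemma functor_iso_arr:
  assumes "is_functor F" "iso_arr (fdom F) m" "category (fdom F)"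
  shows "iso_arr (fcod F) (fa F m)"
proof -
  obtain n where "is_inverse (fdom F) m n" using assms(2) unfolding iso_arr_def by (rule exE)
  from functor_inverse[OF assms(1) this assms(3)] show ?thesis unfolding iso_arr_def by (rule exI)
qed

lemma is_functor_fcmp:
  assumes "is_functor F" "is_functor G" "fcod F = fdom G" "category (fdom F)"
  shows "is_functor (fcmp F G)"
proof -
  interpret category "fdom F" by fact
  note F = is_functorD[OF assms(1)] and G = is_functorD[OF assms(2)]
  \<comment> \<open>The components of \<open>fcmp\<close> compute only on the carriers, so
    composites and identities must first be placed there.\<close>
  have c: "m \<cdot>\<^bsub>fdom F\<^esub> n \<in> carr (fdom F)"
    if "m \<in> carr (fdom F)" "n \<in> carr (fdom F)" "ccod (fdom F) m = cdom (fdom F) n" for m n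
    using comp_hom[OF that] by (simp add: chom_def)
  have i: "cid (fdom F) x \<in> carr (fdom F)" if "x \<in> cobj (fdom F)" for x
    using id_hom[OF that] by (simp add: chom_def)
  have sel: "fdom (fcmp F G) = fdom F" "fcod (fcmp F G) = fcod G" by (simp_all add: fcmp_def)
  have o: "fo (fcmp F G) x = fo G (fo F x)" if "x \<in> cobj (fdom F)" for x
    using that by (simp add: fcmp_def)
  have a: "fa (fcmp F G) m = fa G (fa F m)" if "m \<in> carr (fdom F)" for m
    using that by (simp add: fcmp_def)
  show ?thesis unfolding is_functor_def sel
  proof (intro conjI ballI impI)
    show "fo (fcmp F G) \<in> cobj (fdom F) \<rightarrow>\<^sub>E cobj (fcod G)"
      "fa (fcmp F G) \<in> carr (fdom F) \<rightarrow>\<^sub>E carr (fcod G)"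
      using F(1,2) G(1,2) assms(3) by (simp_all add: fcmp_def PiE_iff)
    fix m assume m: "m \<in> carr (fdom F)"
    show "cdom (fcod G) (fa (fcmp F G) m) = fo (fcmp F G) (cdom (fdom F) m)"
      "ccod (fcod G) (fa (fcmp F G) m) = fo (fcmp F G) (ccod (fdom F) m)"
      using F(2-4)[OF m] G(3,4)[of "fa F m"] dom_obj[OF m] cod_obj[OF m] m assms(3) by (simp_all add: o a)
    fix n assume n: "n \<in> carr (fdom F)" "ccod (fdom F) m = cdom (fdom F) n"
    show "fa (fcmp F G) (m \<cdot>\<^bsub>fdom F\<^esub> n) = fa (fcmp F G) m \<cdot>\<^bsub>fcod G\<^esub> fa (fcmp F G) n"
      using F(2-4)[OF m] F(2-4)[OF n(1)] F(6)[OF m n] G(6)[of "fa F m" "fa F n"] c[OF m n] n m assms(3)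
      by (simp add: o a)
  next
    fix x assume x: "x \<in> cobj (fdom F)"
    show "fa (fcmp F G) (cid (fdom F) x) = cid (fcod G) (fo (fcmp F G) x)"
      using F(1,5)[OF x] G(5)[of "fo F x"] i[OF x] x assms(3) by (simp add: o a)
  qed
qed

section \<open>Whiskering calculus\<close>

context two_category
begin

lemma und_simps [simp]:
  "cobj (und C) = obj C" "carr (und C) = mor C" "cdom (und C) = src C" "ccod (und C) = tgt C"
  "cid (und C) = idm C" "ccomp (und C) = cmp C"
  by (simp_all add: und_def)

lemma hom_simps [simp]:
  "cobj (hom C X Y) = mors C X Y" "cdom (hom C X Y) = csrc C" "ccod (hom C X Y) = ctgt C"
  "cid (hom C X Y) = idc C" "ccomp (hom C X Y) = vcmp C"
  by (simp_all add: hom_def)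

lemma mor_obj [simp]: "f \<in> mor C \<Longrightarrow> src C f \<in> obj C" "f \<in> mor C \<Longrightarrow> tgt C f \<in> obj C"
  using category.dom_obj[OF und_category, of f] category.cod_obj[OF und_category, of f] by simp_all

lemma idm_mor [simp]:
  "X \<in> obj C \<Longrightarrow> idm C X \<in> mor C" "X \<in> obj C \<Longrightarrow> src C (idm C X) = X"
  "X \<in> obj C \<Longrightarrow> tgt C (idm C X) = X"
  using category.id_hom[OF und_category, of X] by (simp_all add: chom_def)

lemma cmp_mor [simp]:
  assumes "f \<in> mor C" "g \<in> mor C" "tgt C f = src C g"
  shows "f \<Zsemi> g \<in> mor C" "src C (f \<Zsemi> g) = src C f" "tgt C (f \<Zsemi> g) = tgt C g"
  using category.comp_hom[OF und_category, of f g] assms by (simp_all add: chom_def)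

lemma idm_cmp [simp]: "f \<in> mor C \<Longrightarrow> src C f = X \<Longrightarrow> idm C X \<Zsemi> f = f"
  using category.id_comp[OF und_category, of f] by auto

lemma cmp_idm [simp]: "f \<in> mor C \<Longrightarrow> tgt C f = X \<Longrightarrow> f \<Zsemi> idm C X = f"
  using category.comp_id[OF und_category, of f] by auto

lemma cmp_assoc:
  "\<lbrakk>f \<in> mor C; g \<in> mor C; h \<in> mor C; tgt C f = src C g; tgt C g = src C h\<rbrakk>
    \<Longrightarrow> (f \<Zsemi> g) \<Zsemi> h = f \<Zsemi> (g \<Zsemi> h)"
  using category.comp_assoc[OF und_category, of f g h] by simp

lemma cell_mor [simp]:
  assumes "\<alpha> \<in> cell C"
  shows "csrc C \<alpha> \<in> mor C" "ctgt C \<alpha> \<in> mor C"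
    "src C (ctgt C \<alpha>) = src C (csrc C \<alpha>)" "tgt C (ctgt C \<alpha>) = tgt C (csrc C \<alpha>)"
  using cell_hom[OF assms] by (auto simp: hom_def mors_def)

text \<open>Both ends of a 2-cell are parallel by \<open>cell_mor\<close>, so the ends of
  \<open>csrc C \<alpha>\<close> alone decide membership. Hom-categories are used in this form from
  here on.\<close>

lemma carr_hom: "\<alpha> \<in> carr (hom C X Y) \<longleftrightarrow> \<alpha> \<in> cell C \<and> src C (csrc C \<alpha>) = X \<and> tgt C (csrc C \<alpha>) = Y"
  by (auto simp: hom_def mors_def)

lemma idc_cell [simp]:
  assumes "f \<in> mor C" shows "idc C f \<in> cell C" "csrc C (idc C f) = f" "ctgt C (idc C f) = f"
  using category.id_hom[OF hom_category, of "src C f" "tgt C f" f] assms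
  by (simp_all add: chom_def carr_hom mors_def)

lemma vcmp_cell [simp]:
  assumes "\<alpha> \<in> cell C" "\<beta> \<in> cell C" "ctgt C \<alpha> = csrc C \<beta>"
  shows "\<alpha> \<odot> \<beta> \<in> cell C" "csrc C (\<alpha> \<odot> \<beta>) = csrc C \<alpha>" "ctgt C (\<alpha> \<odot> \<beta>) = ctgt C \<beta>"
proof -
  have "src C (csrc C \<beta>) = src C (csrc C \<alpha>)" "tgt C (csrc C \<beta>) = tgt C (csrc C \<alpha>)"
    using assms cell_mor(3,4)[OF assms(1)] by auto
  then show "\<alpha> \<odot> \<beta> \<in> cell C" "csrc C (\<alpha> \<odot> \<beta>) = csrc C \<alpha>" "ctgt C (\<alpha> \<odot> \<beta>) = ctgt C \<beta>"
    using category.comp_hom[OF hom_category, of "src C (csrc C \<alpha>)" "tgt C (csrc C \<alpha>)" \<alpha> \<beta>] assms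
    by (simp_all add: chom_def carr_hom mors_def)
qed

lemma idc_vcmp [simp]: "\<alpha> \<in> cell C \<Longrightarrow> csrc C \<alpha> = f \<Longrightarrow> idc C f \<odot> \<alpha> = \<alpha>"
  using category.id_comp[OF hom_category, of "src C (csrc C \<alpha>)" "tgt C (csrc C \<alpha>)" \<alpha>]
  by (auto simp: carr_hom)

lemma vcmp_idc [simp]: "\<alpha> \<in> cell C \<Longrightarrow> ctgt C \<alpha> = f \<Longrightarrow> \<alpha> \<odot> idc C f = \<alpha>"
  using category.comp_id[OF hom_category, of "src C (csrc C \<alpha>)" "tgt C (csrc C \<alpha>)" \<alpha>]
  by (auto simp: carr_hom)

lemma vcmp_assoc:
  assumes "\<alpha> \<in> cell C" "\<beta> \<in> cell C" "\<gamma> \<in> cell C" "ctgt C \<alpha> = csrc C \<beta>" "ctgt C \<beta> = csrc C \<gamma>"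
  shows "(\<alpha> \<odot> \<beta>) \<odot> \<gamma> = \<alpha> \<odot> (\<beta> \<odot> \<gamma>)"
proof -
  have "src C (csrc C \<beta>) = src C (csrc C \<alpha>)" "tgt C (csrc C \<beta>) = tgt C (csrc C \<alpha>)"
     "src C (csrc C \<gamma>) = src C (csrc C \<beta>)" "tgt C (csrc C \<gamma>) = tgt C (csrc C \<beta>)"
    using assms cell_mor(3,4)[OF assms(1)] cell_mor(3,4)[OF assms(2)] by auto
  then show ?thesis
    using category.comp_assoc[OF hom_category, of "src C (csrc C \<alpha>)" "tgt C (csrc C \<alpha>)" \<alpha> \<beta> \<gamma>] assms
    by (simp add: carr_hom)
qed

lemma hcmp_cell [simp]:
  assumes "\<alpha> \<in> cell C" "\<beta> \<in> cell C" "tgt C (csrc C \<alpha>) = src C (csrc C \<beta>)"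
  shows "\<alpha> \<star> \<beta> \<in> cell C" "csrc C (\<alpha> \<star> \<beta>) = csrc C \<alpha> \<Zsemi> csrc C \<beta>"
    "ctgt C (\<alpha> \<star> \<beta>) = ctgt C \<alpha> \<Zsemi> ctgt C \<beta>"
  using hcmp_cells[OF assms] by (simp_all add: cells_def)

lemma whisk_l_cell [simp]:
  assumes "u \<in> mor C" "\<alpha> \<in> cell C" "tgt C u = src C (csrc C \<alpha>)"
  shows "u \<rhd> \<alpha> \<in> cell C" "csrc C (u \<rhd> \<alpha>) = u \<Zsemi> csrc C \<alpha>" "ctgt C (u \<rhd> \<alpha>) = u \<Zsemi> ctgt C \<alpha>"
  using assms by (simp_all add: whisk_l_def)

lemma whisk_r_cell [simp]:
  assumes "u \<in> mor C" "\<alpha> \<in> cell C" "tgt C (csrc C \<alpha>) = src C u"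
  shows "\<alpha> \<lhd> u \<in> cell C" "csrc C (\<alpha> \<lhd> u) = csrc C \<alpha> \<Zsemi> u" "ctgt C (\<alpha> \<lhd> u) = ctgt C \<alpha> \<Zsemi> u"
  using assms by (simp_all add: whisk_r_def)

lemma whisk_idc [simp]:
  assumes "f \<in> mor C" "g \<in> mor C" "tgt C f = src C g"
  shows "f \<rhd> idc C g = idc C (f \<Zsemi> g)" "idc C f \<lhd> g = idc C (f \<Zsemi> g)"
  using assms by (simp_all add: whisk_r_def whisk_l_def hcmp_idc)

lemma whisk_idm [simp]:
  assumes "\<alpha> \<in> cell C"
  shows "src C (csrc C \<alpha>) = X \<Longrightarrow> idm C X \<rhd> \<alpha> = \<alpha>" "tgt C (csrc C \<alpha>) = X \<Longrightarrow> \<alpha> \<lhd> idm C X = \<alpha>"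
  using assms hcmp_id_left hcmp_id_right by (auto simp: whisk_r_def whisk_l_def)

lemma whisk_l_cmp:
  assumes "u \<in> mor C" "v \<in> mor C" "\<alpha> \<in> cell C" "tgt C u = src C v" "tgt C v = src C (csrc C \<alpha>)"
  shows "(u \<Zsemi> v) \<rhd> \<alpha> = u \<rhd> (v \<rhd> \<alpha>)"
  using assms hcmp_assoc[of "idc C u" "idc C v" \<alpha>] by (simp add: whisk_l_def hcmp_idc)

lemma whisk_r_cmp:
  assumes "u \<in> mor C" "v \<in> mor C" "\<alpha> \<in> cell C" "tgt C u = src C v" "tgt C (csrc C \<alpha>) = src C u"
  shows "\<alpha> \<lhd> (u \<Zsemi> v) = (\<alpha> \<lhd> u) \<lhd> v"
  using assms hcmp_assoc[of \<alpha> "idc C u" "idc C v"] by (simp add: whisk_r_def hcmp_idc)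

lemma whisk_lr:
  assumes "u \<in> mor C" "v \<in> mor C" "\<alpha> \<in> cell C" "tgt C u = src C (csrc C \<alpha>)" "tgt C (csrc C \<alpha>) = src C v"
  shows "(u \<rhd> \<alpha>) \<lhd> v = u \<rhd> (\<alpha> \<lhd> v)"
  using assms hcmp_assoc[of "idc C u" \<alpha> "idc C v"] by (simp add: whisk_r_def whisk_l_def)

lemma whisk_l_vcmp:
  assumes "u \<in> mor C" "\<alpha> \<in> cell C" "\<beta> \<in> cell C" "ctgt C \<alpha> = csrc C \<beta>" "tgt C u = src C (csrc C \<alpha>)"
  shows "u \<rhd> (\<alpha> \<odot> \<beta>) = (u \<rhd> \<alpha>) \<odot> (u \<rhd> \<beta>)"
  using assms interchange[of "idc C u" "idc C u" \<alpha> \<beta>] by (simp add: whisk_l_def)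

lemma whisk_r_vcmp:
  assumes "u \<in> mor C" "\<alpha> \<in> cell C" "\<beta> \<in> cell C" "ctgt C \<alpha> = csrc C \<beta>" "tgt C (csrc C \<alpha>) = src C u"
  shows "(\<alpha> \<odot> \<beta>) \<lhd> u = (\<alpha> \<lhd> u) \<odot> (\<beta> \<lhd> u)"
  using assms interchange[of \<alpha> \<beta> "idc C u" "idc C u"] cell_mor(4)[OF assms(2)]
  by (simp add: whisk_r_def)

text \<open>Insert identity 2-cells and apply interchange. Equating the two decompositions gives a
  naturality square: it is the naturality of \<open>post2\<close> and \<open>pre2\<close>, and it
  turns every 2-cell into an arrow object into a commutative square.\<close>

lemma hcmp_whisk:
  assumes "\<alpha> \<in> cell C" "\<beta> \<in> cell C" "tgt C (csrc C \<alpha>) = src C (csrc C \<beta>)"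
  shows "\<alpha> \<star> \<beta> = (\<alpha> \<lhd> csrc C \<beta>) \<odot> (ctgt C \<alpha> \<rhd> \<beta>)" "\<alpha> \<star> \<beta> = (csrc C \<alpha> \<rhd> \<beta>) \<odot> (\<alpha> \<lhd> ctgt C \<beta>)"
  using assms interchange[of \<alpha> "idc C (ctgt C \<alpha>)" "idc C (csrc C \<beta>)" \<beta>]
    interchange[of "idc C (csrc C \<alpha>)" \<alpha> \<beta> "idc C (ctgt C \<beta>)"]
  by (simp_all add: whisk_r_def whisk_l_def)

lemma is_functor_post:
  assumes "f \<in> mor C" "A \<in> obj C"
  shows "is_functor (post C A f)"
  unfolding is_functor_def using assms
  by (auto simp: post_def mors_def carr_hom PiE_iff whisk_r_vcmp)

lemma is_functor_pre:
  assumes "u \<in> mor C" "X \<in> obj C"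
  shows "is_functor (pre C u X)"
  unfolding is_functor_def using assms
  by (auto simp: pre_def mors_def carr_hom PiE_iff whisk_l_vcmp)

lemma post_simps [simp]:
  "fdom (post C A f) = hom C A (src C f)" "fcod (post C A f) = hom C A (tgt C f)"
  "u \<in> mors C A (src C f) \<Longrightarrow> fo (post C A f) u = u \<Zsemi> f"
  "\<phi> \<in> carr (hom C A (src C f)) \<Longrightarrow> fa (post C A f) \<phi> = \<phi> \<lhd> f"
  by (simp_all add: post_def)

lemma pre_simps [simp]:
  "fdom (pre C u X) = hom C (tgt C u) X" "fcod (pre C u X) = hom C (src C u) X"
  "f \<in> mors C (tgt C u) X \<Longrightarrow> fo (pre C u X) f = u \<Zsemi> f"
  "\<phi> \<in> carr (hom C (tgt C u) X) \<Longrightarrow> fa (pre C u X) \<phi> = u \<rhd> \<phi>"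
  by (simp_all add: pre_def)

lemma is_ntrans_post2:
  assumes "\<alpha> \<in> cell C" "A \<in> obj C"
  shows "is_ntrans (post2 C A \<alpha>)"
  using assms is_functor_post[of "csrc C \<alpha>" A] is_functor_post[of "ctgt C \<alpha>" A]
  by (auto simp: is_ntrans_def Let_def post2_def chom_def carr_hom mors_def hcmp_whisk[symmetric])

lemma is_ntrans_pre2:
  assumes "\<phi> \<in> cell C" "X \<in> obj C"
  shows "is_ntrans (pre2 C \<phi> X)"
  using assms is_functor_pre[of "csrc C \<phi>" X] is_functor_pre[of "ctgt C \<phi>" X]
  by (auto simp: is_ntrans_def Let_def pre2_def chom_def carr_hom mors_def hcmp_whisk[symmetric])

lemma post_iso_arr:
  assumes "iso_arr (hom C A (src C f)) \<alpha>" "f \<in> mor C" "A \<in> obj C"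
  shows "iso_arr (hom C A (tgt C f)) (\<alpha> \<lhd> f)"
proof -
  have "\<alpha> \<in> carr (hom C A (src C f))" using assms by (auto simp: iso_arr_def is_inverse_def)
  then show ?thesis
    using functor_iso_arr[OF is_functor_post[OF assms(2,3)], of \<alpha>] assms hom_category[of A "src C f"] by simp
qed

lemma pre_iso_arr:
  assumes "iso_arr (hom C (tgt C u) X) \<alpha>" "u \<in> mor C" "X \<in> obj C"
  shows "iso_arr (hom C (src C u) X) (u \<rhd> \<alpha>)"
proof -
  have "\<alpha> \<in> carr (hom C (tgt C u) X)" using assms by (auto simp: iso_arr_def is_inverse_def)
  then show ?thesis
    using functor_iso_arr[OF is_functor_pre[OF assms(2,3)], of \<alpha>] assms hom_category[of "tgt C u" X] by simp
qed

end

section \<open>Functors on finite linear orders\<close>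

lemma ord_cat_simps [simp]:
  "cobj (ord_cat n) = {0..n}" "carr (ord_cat n) = {(i, j). i \<le> j \<and> j \<le> n}"
  "cdom (ord_cat n) = fst" "ccod (ord_cat n) = snd" "cid (ord_cat n) i = (i, i)"
  "ccomp (ord_cat n) p q = (fst p, snd q)"
  by (simp_all add: ord_cat_def)

lemma category_ord_cat: "category (ord_cat n)"
  by unfold_locales (auto simp: chom_def)

text \<open>Functors out of \<open>ord_cat n\<close> are built for single arrows
  (\<open>n = 1\<close>) and composable pairs (\<open>n = 2\<close>), in order to feed them to
  cotensors. One general shape lets both share a single functoriality proof.\<close>

definition chain_functor ::
  "nat \<Rightarrow> ('x, 'm) cat \<Rightarrow> (nat \<Rightarrow> 'x) \<Rightarrow> (nat \<Rightarrow> nat \<Rightarrow> 'm) \<Rightarrow> (nat, nat \<times> nat, 'x, 'm) fnctr" where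
  "chain_functor n K ob ar =
     \<lparr>fdom = ord_cat n, fcod = K, fo = (\<lambda>j \<in> {0..n}. ob j),
      fa = (\<lambda>p \<in> carr (ord_cat n). ar (fst p) (snd p))\<rparr>"

lemma chain_functor_simps [simp]:
  "fdom (chain_functor n K ob ar) = ord_cat n" "fcod (chain_functor n K ob ar) = K"
  "j \<le> n \<Longrightarrow> fo (chain_functor n K ob ar) j = ob j"
  "\<lbrakk>i \<le> j; j \<le> n\<rbrakk> \<Longrightarrow> fa (chain_functor n K ob ar) (i, j) = ar i j"
  by (simp_all add: chain_functor_def)

lemma is_functor_chain:
  assumes "category K"
    and ar: "\<And>i j. \<lbrakk>i \<le> j; j \<le> n\<rbrakk> \<Longrightarrow> ar i j \<in> chom K (ob i) (ob j)"
    and "\<And>i. i \<le> n \<Longrightarrow> ar i i = cid K (ob i)"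
    and "\<And>i j k. \<lbrakk>i \<le> j; j \<le> k; k \<le> n\<rbrakk> \<Longrightarrow> ar i k = ccomp K (ar i j) (ar j k)"
  shows "is_functor (chain_functor n K ob ar)"
proof -
  interpret category K by fact
  have "ob i \<in> cobj K" if "i \<le> n" for i
    using ar[of i i] that dom_obj[of "ar i i"] by (simp add: chom_def)
  then show ?thesis
    unfolding is_functor_def chain_functor_simps
  proof (intro conjI ballI impI)
    fix m l assume "m \<in> carr (ord_cat n)" "l \<in> carr (ord_cat n)" "ccod (ord_cat n) m = cdom (ord_cat n) l"
    then show "fa (chain_functor n K ob ar) (m \<cdot>\<^bsub>ord_cat n\<^esub> l) =
        fa (chain_functor n K ob ar) m \<cdot>\<^bsub>K\<^esub> fa (chain_functor n K ob ar) l"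
      using assms(4)[of "fst m" "snd m" "snd l"] by (auto simp: chain_functor_def)
  qed (use assms(2,3) in \<open>auto simp: chain_functor_def PiE_iff chom_def\<close>)
qed

text \<open>The objects are the ends of the one non-identity arrow, and the other two arrows are
  identities.\<close>

lemma functor_eq_ord1:
  assumes F: "is_functor F" "fdom F = ord_cat 1" and G: "is_functor G" "fdom G = ord_cat 1"
    and "fcod F = fcod G" and e: "fa F (0, 1) = fa G (0, 1)"
  shows "F = G"
proof -
  note FD = is_functorD[OF F(1), unfolded F(2)] and GD = is_functorD[OF G(1), unfolded G(2)]
  have o: "fo F 0 = fo G 0" "fo F 1 = fo G 1"
    using FD(3,4)[of "(0, 1)"] GD(3,4)[of "(0, 1)"] assms by simp_all
  have o': "fo F j = fo G j" if "j \<le> 1" for j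
    using that o by (auto simp: le_Suc_eq)
  have i: "fa F (j, j) = fa G (j, j)" if "j \<le> 1" for j
    using FD(5)[of j] GD(5)[of j] that o' assms by simp
  show ?thesis
  proof (rule functor_eqI[OF F(1) G(1)])
    fix m assume "m \<in> carr (fdom F)"
    then have "m = (0, 0) \<or> m = (0, 1) \<or> m = (1, 1)" using F by (auto simp: le_Suc_eq)
    then show "fa F m = fa G m" using e i by auto
  qed (use assms o' in auto)
qed

text \<open>Apart from identities only \<open>(0, 2)\<close> remains, and it is the composite of the
  two given arrows.\<close>

lemma functor_eq_ord2:
  assumes F: "is_functor F" "fdom F = ord_cat 2" and G: "is_functor G" "fdom G = ord_cat 2"
    and c: "fcod F = fcod G" and e: "fa F (0, 1) = fa G (0, 1)" "fa F (1, 2) = fa G (1, 2)"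
  shows "F = G"
proof -
  note FD = is_functorD[OF F(1), unfolded F(2)] and GD = is_functorD[OF G(1), unfolded G(2)]
  have o: "fo F 0 = fo G 0" "fo F 1 = fo G 1" "fo F 2 = fo G 2"
    using FD(3,4)[of "(0, 1)"] GD(3,4)[of "(0, 1)"] FD(3,4)[of "(1, 2)"] GD(3,4)[of "(1, 2)"] assms
    by simp_all
  have o': "fo F j = fo G j" if "j \<le> 2" for j
    using that o by (auto simp: le_Suc_eq numeral_2_eq_2)
  have i: "fa F (j, j) = fa G (j, j)" if "j \<le> 2" for j
    using FD(5)[of j] GD(5)[of j] that o' assms by simp
  have e2: "fa F (0, 2) = fa G (0, 2)"
    using FD(6)[of "(0, 1)" "(1, 2)"] GD(6)[of "(0, 1)" "(1, 2)"] e c by simp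
  show ?thesis
  proof (rule functor_eqI[OF F(1) G(1)])
    fix m assume "m \<in> carr (fdom F)"
    then have "m = (0, 0) \<or> m = (0, 1) \<or> m = (1, 1) \<or> m = (0, 2) \<or> m = (1, 2) \<or> m = (2, 2)"
      using F by (auto simp: le_Suc_eq numeral_2_eq_2)
    then show "fa F m = fa G m" using e e2 i by auto
  qed (use assms o' in auto)
qed

lemma (in category) id_id: "x \<in> cobj K \<Longrightarrow> cid K x \<cdot> cid K x = cid K x"
  using id_hom[of x] id_comp[of "cid K x"] by (simp add: chom_def)

definition arrow_functor :: "('x, 'm) cat \<Rightarrow> 'm \<Rightarrow> (nat, nat \<times> nat, 'x, 'm) fnctr" where
  "arrow_functor K m = (let ob = (\<lambda>i. if i = 0 then cdom K m else ccod K m) in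
     chain_functor 1 K ob (\<lambda>i j. if i = j then cid K (ob i) else m))"

lemma arrow_functor:
  assumes "category K" "m \<in> carr K"
  shows "is_functor (arrow_functor K m)" "fdom (arrow_functor K m) = ord_cat 1"
    "fcod (arrow_functor K m) = K" "fa (arrow_functor K m) (0, 1) = m"
proof -
  interpret category K by fact
  show "is_functor (arrow_functor K m)"
    unfolding arrow_functor_def Let_def
    by (rule is_functor_chain)
       (use assms id_comp comp_id id_hom dom_obj cod_obj id_id in
         \<open>auto simp: chom_def le_Suc_eq split: if_splits\<close>)
qed (simp_all add: arrow_functor_def Let_def)

text \<open>For \<open>i < j \<le> 2\<close> the test \<open>j = 1\<close> singles out the first
  arrow, \<open>i = 1\<close> the second, and what is left is \<open>(0, 2)\<close>, the
  composite.\<close>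

definition pair_chain :: "('x, 'm) cat \<Rightarrow> 'm \<Rightarrow> 'm \<Rightarrow> (nat, nat \<times> nat, 'x, 'm) fnctr" where
  "pair_chain K m n =
    (let ob = (\<lambda>i. if i = 0 then cdom K m else if i = 1 then ccod K m else ccod K n) in
     chain_functor 2 K ob
       (\<lambda>i j. if i = j then cid K (ob i) else if j = 1 then m else if i = 1 then n
              else ccomp K m n))"

lemma pair_chain:
  assumes "category K" "m \<in> carr K" "n \<in> carr K" "ccod K m = cdom K n"
  shows "is_functor (pair_chain K m n)" "fdom (pair_chain K m n) = ord_cat 2"
    "fcod (pair_chain K m n) = K" "fa (pair_chain K m n) (0, 1) = m"
    "fa (pair_chain K m n) (1, 2) = n" "fa (pair_chain K m n) (0, 2) = ccomp K m n"
proof -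
  interpret category K by fact
  show "is_functor (pair_chain K m n)"
    unfolding pair_chain_def Let_def
    apply (rule is_functor_chain)
    using assms id_comp comp_id id_hom dom_obj cod_obj id_id comp_hom[OF assms(2-4)]
      id_comp[of "m \<cdot>\<^bsub>K\<^esub> n"] comp_id[of "m \<cdot>\<^bsub>K\<^esub> n"]
      comp_id[OF assms(2)]
    by (auto simp: chom_def le_Suc_eq numeral_2_eq_2 split: if_splits)
qed (simp_all add: pair_chain_def Let_def)

text \<open>Naturality at the two identities of \<open>ord_cat 1\<close> is automatic, so a
  transformation of functors on it is one commutative square.\<close>

lemma is_ntransI_ord1:
  assumes F: "is_functor F" "fdom F = ord_cat 1" and G: "is_functor G" "fdom G = ord_cat 1"
    and cc: "fcod F = K" "fcod G = K" and "category K"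
    and c: "\<And>j. j \<le> 1 \<Longrightarrow> c j \<in> chom K (fo F j) (fo G j)"
    and nat: "ccomp K (fa F (0, 1)) (c 1) = ccomp K (c 0) (fa G (0, 1))"
  shows "is_ntrans \<lparr>nsrc = F, ntgt = G, nc = (\<lambda>j \<in> {0..1}. c j)\<rparr>"
proof -
  interpret category K by fact
  note FD = is_functorD[OF F(1), unfolded F(2)] and GD = is_functorD[OF G(1), unfolded G(2)]
  have i: "ccomp K (fa F (j, j)) (c j) = ccomp K (c j) (fa G (j, j))" if "j \<le> 1" for j
    using FD(5)[of j] GD(5)[of j] that c[OF that] id_comp[of "c j"] comp_id[of "c j"] cc
    by (simp add: chom_def)
  have "ccomp K (fa F m) (c (snd m)) = ccomp K (c (fst m)) (fa G m)" if "m \<in> carr (ord_cat 1)" for m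
  proof -
    have "m = (0, 0) \<or> m = (0, 1) \<or> m = (1, 1)" using that by (auto simp: le_Suc_eq)
    then show ?thesis using i[of 0] i[of 1] nat by auto
  qed
  then show ?thesis unfolding is_ntrans_def Let_def using assms by auto
qed

lemma is_ntrans_fwhisk:
  assumes "is_functor F" "is_ntrans \<nu>" "fcod F = fdom (nsrc \<nu>)" "category (fdom F)"
  shows "is_ntrans (fwhisk F \<nu>)"
proof -
  interpret category "fdom F" by fact
  note F = is_functorD[OF assms(1), unfolded assms(3)] and N = is_ntransD[OF assms(2)]
  have "is_functor (fcmp F (nsrc \<nu>))" "is_functor (fcmp F (ntgt \<nu>))"
    using assms N by (auto intro: is_functor_fcmp)
  moreover have "nc \<nu> (fo F x) \<in> chom (fcod (nsrc \<nu>)) (fo (nsrc \<nu>) (fo F x)) (fo (ntgt \<nu>) (fo F x))"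
    if "x \<in> cobj (fdom F)" for x
    using N(6) F(1) that by blast
  moreover have "fa (nsrc \<nu>) (fa F m) \<cdot>\<^bsub>fcod (nsrc \<nu>)\<^esub> nc \<nu> (fo F (ccod (fdom F) m)) =
      nc \<nu> (fo F (cdom (fdom F) m)) \<cdot>\<^bsub>fcod (nsrc \<nu>)\<^esub> fa (ntgt \<nu>) (fa F m)"
    if "m \<in> carr (fdom F)" for m
    using N(7)[of "fa F m"] F(2-4) that by simp
  ultimately show ?thesis
    unfolding is_ntrans_def Let_def fwhisk_def using N(3,4) dom_obj cod_obj
    by (simp add: fcmp_def)
qed

section \<open>Universal properties of limits\<close>

context two_category
begin

lemma pre2_simps [simp]:
  "nsrc (pre2 C \<phi> X) = pre C (csrc C \<phi>) X" "ntgt (pre2 C \<phi> X) = pre C (ctgt C \<phi>) X"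
  "f \<in> mors C (tgt C (csrc C \<phi>)) X \<Longrightarrow> nc (pre2 C \<phi> X) f = \<phi> \<lhd> f"
  by (simp_all add: pre2_def)

lemma fwhisk_simps:
  "nsrc (fwhisk F \<nu>) = fcmp F (nsrc \<nu>)" "ntgt (fwhisk F \<nu>) = fcmp F (ntgt \<nu>)"
  "x \<in> cobj (fdom F) \<Longrightarrow> nc (fwhisk F \<nu>) x = nc \<nu> (fo F x)"
  by (simp_all add: fwhisk_def)

lemma fcmp_simps:
  "fdom (fcmp F G) = fdom F" "fcod (fcmp F G) = fcod G"
  "x \<in> cobj (fdom F) \<Longrightarrow> fo (fcmp F G) x = fo G (fo F x)"
  "m \<in> carr (fdom F) \<Longrightarrow> fa (fcmp F G) m = fa G (fa F m)"
  by (simp_all add: fcmp_def)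

text \<open>Functoriality of the comparison for an arbitrary candidate \<open>ev\<close>, not yet
  known to be universal. It prepares the use of \<open>cat_isoI\<close> when the pullback of arrow
  objects is recognized as a cotensor with \<open>ord_cat 2\<close>.\<close>

lemma is_functor_cotensor_functor:
  assumes ev: "is_functor ev" "fdom ev = J" "fcod ev = hom C P X" and "category J"
    and obj: "X \<in> obj C" "P \<in> obj C" "A \<in> obj C"
  shows "is_functor (cotensor_functor C J X P ev A)"
proof -
  note E = is_functorD[OF ev(1), unfolded ev(2,3), simplified]
  have f: "is_functor (fcmp ev (pre C u X))" if "u \<in> mors C A P" for u
    using that assms by (intro is_functor_fcmp is_functor_pre) (auto simp: mors_def)
  have n: "is_ntrans (fwhisk ev (pre2 C \<phi> X))" if "\<phi> \<in> carr (hom C A P)" for \<phi>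
    using that assms by (intro is_ntrans_fwhisk is_ntrans_pre2) (auto simp: carr_hom)
  have i: "fwhisk ev (pre2 C (idc C u) X) = nid (fcmp ev (pre C u X))" if "u \<in> mors C A P" for u
    using that E(1) obj by (auto simp: fwhisk_def nid_def fcmp_def mors_def ev intro!: restrict_ext)
  have v: "fwhisk ev (pre2 C (\<phi> \<odot> \<psi>) X) = nvcomp (fwhisk ev (pre2 C \<phi> X)) (fwhisk ev (pre2 C \<psi> X))"
    if "\<phi> \<in> carr (hom C A P)" "\<psi> \<in> carr (hom C A P)" "ctgt C \<phi> = csrc C \<psi>" for \<phi> \<psi>
    using that E(1) obj
    by (auto simp: fwhisk_def nvcomp_def fcmp_def carr_hom mors_def ev whisk_r_vcmp intro!: restrict_ext)
  let ?T = "cotensor_functor C J X P ev A"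
  have T: "fdom ?T = hom C A P" "fcod ?T = Fun J (hom C A X)"
    "\<And>u. u \<in> mors C A P \<Longrightarrow> fo ?T u = fcmp ev (pre C u X)"
    "\<And>\<phi>. \<phi> \<in> carr (hom C A P) \<Longrightarrow> fa ?T \<phi> = fwhisk ev (pre2 C \<phi> X)"
    "fo ?T \<in> extensional (mors C A P)" "fa ?T \<in> extensional (carr (hom C A P))"
    by (simp_all add: cotensor_functor_def)
  show ?thesis
    unfolding is_functor_def T hom_simps
  proof (intro conjI ballI impI)
    show "fo ?T \<in> mors C A P \<rightarrow>\<^sub>E cobj (Fun J (hom C A X))"
      using T(3,5) f by (auto simp: PiE_iff Fun_def fcmp_simps ev mors_def)
    show "fa ?T \<in> carr (hom C A P) \<rightarrow>\<^sub>E carr (Fun J (hom C A X))"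
      using T(4,6) n by (auto simp: PiE_iff Fun_def fwhisk_simps fcmp_simps ev carr_hom)
    fix m assume m: "m \<in> carr (hom C A P)"
    then have m': "csrc C m \<in> mors C A P" "ctgt C m \<in> mors C A P" by (auto simp: carr_hom mors_def)
    show "cdom (Fun J (hom C A X)) (fa ?T m) = fo ?T (csrc C m)"
      "ccod (Fun J (hom C A X)) (fa ?T m) = fo ?T (ctgt C m)"
      using T(4)[OF m] m' by (simp_all add: T(3) Fun_def fwhisk_simps)
    fix k assume k: "k \<in> carr (hom C A P)" and mk: "ctgt C m = csrc C k"
    have "m \<odot> k \<in> carr (hom C A P)" using m k mk by (simp add: carr_hom)
    then show "fa ?T (m \<odot> k) = fa ?T m \<cdot>\<^bsub>Fun J (hom C A X)\<^esub> fa ?T k"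
      using T(4) m k v[OF m k mk] by (simp add: Fun_def)
  next
    fix u assume u: "u \<in> mors C A P"
    then have "idc C u \<in> carr (hom C A P)" by (simp add: carr_hom mors_def)
    then show "fa ?T (idc C u) = cid (Fun J (hom C A X)) (fo ?T u)"
      using T(3,4) u i[OF u] by (simp add: Fun_def)
  qed
qed

lemma cat_iso_cotensorD:
  assumes "is_cotensor C J X P ev" "A \<in> obj C" "category J"
  shows "\<lbrakk>is_functor F; fdom F = J; fcod F = hom C A X\<rbrakk> \<Longrightarrow> \<exists>!u. u \<in> mors C A P \<and> fcmp ev (pre C u X) = F"
    and "\<lbrakk>is_ntrans \<nu>; fdom (nsrc \<nu>) = J; fcod (nsrc \<nu>) = hom C A X\<rbrakk>
      \<Longrightarrow> \<exists>!\<phi>. \<phi> \<in> carr (hom C A P) \<and> fwhisk ev (pre2 C \<phi> X) = \<nu>"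
proof -
  let ?T = "cotensor_functor C J X P ev A"
  have T: "cat_iso ?T" using assms unfolding is_cotensor_def by blast
  show "\<exists>!u. u \<in> mors C A P \<and> fcmp ev (pre C u X) = F"
    if "is_functor F" "fdom F = J" "fcod F = hom C A X"
    using bij_betw_ex1D[OF cat_isoD(2)[OF T], of F] that
    by (auto simp: cotensor_functor_def Fun_def cong: conj_cong)
  show "\<exists>!\<phi>. \<phi> \<in> carr (hom C A P) \<and> fwhisk ev (pre2 C \<phi> X) = \<nu>"
    if "is_ntrans \<nu>" "fdom (nsrc \<nu>) = J" "fcod (nsrc \<nu>) = hom C A X"
    using bij_betw_ex1D[OF cat_isoD(3)[OF T], of \<nu>] that
    by (auto simp: cotensor_functor_def Fun_def cong: conj_cong)
qed

end

text \<open>The arrow object freed from functors on \<open>ord_cat 1\<close>: a morphism into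
  \<open>P\<close> is a 2-cell into \<open>X\<close>, and a 2-cell into \<open>P\<close> is a
  commutative square with sides \<open>a\<close> and \<open>b\<close>. Later constructions on
  \<open>P\<close> work in this form; the evaluation functor returns only when the nerve is
  assembled.\<close>

locale arrow_object = two_category C
  for C :: "('o, 'a, 'c) two_cat" (structure) +
  fixes X P :: 'o and d :: 'c
  assumes P_obj [simp]: "P \<in> obj C"
    and d_cell [simp]: "d \<in> cell C" "src C (csrc C d) = P" "tgt C (csrc C d) = X"
    and mor_ump: "\<lbrakk>\<phi> \<in> cell C; tgt C (csrc C \<phi>) = X\<rbrakk>
      \<Longrightarrow> \<exists>!u. u \<in> mors C (src C (csrc C \<phi>)) P \<and> u \<rhd> d = \<phi>"
    and cell_ump: "\<lbrakk>u \<in> mors C A P; v \<in> mors C A P;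
        a \<in> cells C (u \<Zsemi> csrc C d) (v \<Zsemi> csrc C d); b \<in> cells C (u \<Zsemi> ctgt C d) (v \<Zsemi> ctgt C d);
        a \<odot> (v \<rhd> d) = (u \<rhd> d) \<odot> b\<rbrakk>
      \<Longrightarrow> \<exists>!\<chi>. \<chi> \<in> cells C u v \<and> \<chi> \<lhd> csrc C d = a \<and> \<chi> \<lhd> ctgt C d = b"

context two_category
begin

lemma functor_to_homD:
  assumes "is_functor ev" "fdom ev = ord_cat n" "fcod ev = hom C P X"
  shows "j \<le> n \<Longrightarrow> fo ev j \<in> mor C" "j \<le> n \<Longrightarrow> src C (fo ev j) = P" "j \<le> n \<Longrightarrow> tgt C (fo ev j) = X"
    and "i \<le> j \<Longrightarrow> j \<le> n \<Longrightarrow> fa ev (i, j) \<in> cell C"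
    and "i \<le> j \<Longrightarrow> j \<le> n \<Longrightarrow> csrc C (fa ev (i, j)) = fo ev i"
    and "i \<le> j \<Longrightarrow> j \<le> n \<Longrightarrow> ctgt C (fa ev (i, j)) = fo ev j"
    and "j \<le> n \<Longrightarrow> fa ev (j, j) = idc C (fo ev j)"
    and "i \<le> j \<Longrightarrow> j \<le> k \<Longrightarrow> k \<le> n \<Longrightarrow> fa ev (i, k) = fa ev (i, j) \<odot> fa ev (j, k)"
proof -
  note E = is_functorD[OF assms(1), unfolded assms(2,3), simplified]
  show "j \<le> n \<Longrightarrow> fo ev j \<in> mor C" "j \<le> n \<Longrightarrow> src C (fo ev j) = P" "j \<le> n \<Longrightarrow> tgt C (fo ev j) = X"
    using E(1) by (auto simp: mors_def)
  show "i \<le> j \<Longrightarrow> j \<le> n \<Longrightarrow> fa ev (i, j) \<in> cell C"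
    using E(2)[of "(i, j)"] by (simp add: carr_hom)
  show "i \<le> j \<Longrightarrow> j \<le> n \<Longrightarrow> csrc C (fa ev (i, j)) = fo ev i"
    using E(3)[of "(i, j)"] by simp
  show "i \<le> j \<Longrightarrow> j \<le> n \<Longrightarrow> ctgt C (fa ev (i, j)) = fo ev j"
    using E(4)[of "(i, j)"] by simp
  show "j \<le> n \<Longrightarrow> fa ev (j, j) = idc C (fo ev j)"
    using E(5)[of j] by simp
  show "i \<le> j \<Longrightarrow> j \<le> k \<Longrightarrow> k \<le> n \<Longrightarrow> fa ev (i, k) = fa ev (i, j) \<odot> fa ev (j, k)"
    using E(6)[of "(i, j)" "(j, k)"] by simp
qed

text \<open>A functor from \<open>ord_cat 1\<close> to a hom-category is a single 2-cell, and a
  natural transformation of such functors is a commutative square. The proof translates both halves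
  of the cotensor property along this dictionary.\<close>

lemma arrow_object_ump:
  assumes "is_arrow_object C X P ev"
  shows "arrow_object C X P (fa ev (0, 1))"
proof -
  have ev: "is_functor ev" "fdom ev = ord_cat 1" "fcod ev = hom C P X" and obj: "X \<in> obj C" "P \<in> obj C"
    using assms by (auto simp: is_cotensor_def)
  note E = functor_to_homD[OF ev]
  define d where "d = fa ev (0, 1)"
  have d: "d \<in> cell C" "csrc C d = fo ev 0" "ctgt C d = fo ev 1" "src C (csrc C d) = P" "tgt C (csrc C d) = X"
    unfolding d_def using E(4,5,6)[of 0 1] E(2,3)[of 0] by simp_all
  have f: "is_functor (fcmp ev (pre C u X))" if "u \<in> mors C A P" for u A
    using that ev obj by (intro is_functor_fcmp is_functor_pre) (auto simp: mors_def category_ord_cat)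
  have s: "fdom (fcmp ev (pre C u X)) = ord_cat 1" "fcod (fcmp ev (pre C u X)) = hom C A X"
      "fa (fcmp ev (pre C u X)) (0, 1) = u \<rhd> d"
    if "u \<in> mors C A P" for u A
    using that d ev unfolding d_def by (simp_all add: fcmp_simps mors_def carr_hom)
  have so: "fo (fcmp ev (pre C u X)) j = u \<Zsemi> fo ev j"
    if "u \<in> mors C A P" "j \<le> 1" for u A j
    using that ev E(1-3) by (auto simp: fcmp_simps mors_def)
  have "arrow_object C X P d"
  proof (unfold_locales)
    fix \<phi> assume \<phi>: "\<phi> \<in> cell C" "tgt C (csrc C \<phi>) = X"
    let ?A = "src C (csrc C \<phi>)"
    have A: "?A \<in> obj C" "category (hom C ?A X)" and \<phi>': "\<phi> \<in> carr (hom C ?A X)"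
      using \<phi> hom_category[of ?A X] obj by (simp_all add: carr_hom)
    note F = arrow_functor[OF A(2) \<phi>']
    have iff: "fcmp ev (pre C u X) = arrow_functor (hom C ?A X) \<phi> \<longleftrightarrow> u \<rhd> d = \<phi>" if "u \<in> mors C ?A P" for u
      using functor_eq_ord1[OF f[OF that] s(1)[OF that] F(1,2)] s(2,3)[OF that] F(3,4) by auto
    show "\<exists>!u. u \<in> mors C ?A P \<and> u \<rhd> d = \<phi>"
      using cat_iso_cotensorD(1)[OF assms A(1) category_ord_cat F(1,2,3)] iff by (auto cong: conj_cong)
  next
    fix u A v a b
    assume u: "u \<in> mors C A P" and v: "v \<in> mors C A P"
      and a: "a \<in> cells C (u \<Zsemi> csrc C d) (v \<Zsemi> csrc C d)" and b: "b \<in> cells C (u \<Zsemi> ctgt C d) (v \<Zsemi> ctgt C d)"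
      and n: "a \<odot> (v \<rhd> d) = (u \<rhd> d) \<odot> b"
    have A: "A \<in> obj C" "category (hom C A X)" using u obj hom_category by (auto simp: mors_def)
    define \<nu> where "\<nu> = \<lparr>nsrc = fcmp ev (pre C u X), ntgt = fcmp ev (pre C v X), nc = (\<lambda>j \<in> {0..1::nat}. if j = 0 then a else b)\<rparr>"
    have nt: "is_ntrans \<nu>"
      unfolding \<nu>_def
    proof (rule is_ntransI_ord1[OF f[OF u] s(1)[OF u] f[OF v] s(1)[OF v] s(2)[OF u] s(2)[OF v] A(2)])
      fix j :: nat assume "j \<le> 1"
      then have "j = 0 \<or> j = 1" by auto
      then show "(if j = 0 then a else b) \<in> chom (hom C A X) (fo (fcmp ev (pre C u X)) j) (fo (fcmp ev (pre C v X)) j)"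
        using so[OF u, of j] so[OF v, of j] a b d u v E(1-3)[of 0] E(1-3)[of 1]
        by (elim disjE) (simp_all add: chom_def carr_hom cells_def mors_def)
    qed (simp add: s(3)[OF u] s(3)[OF v] n del: One_nat_def)
    have \<nu>s: "nsrc \<nu> = fcmp ev (pre C u X)" "ntgt \<nu> = fcmp ev (pre C v X)" "nc \<nu> 0 = a" "nc \<nu> 1 = b"
      by (simp_all add: \<nu>_def)
    obtain \<chi> where \<chi>: "\<chi> \<in> carr (hom C A P)" "fwhisk ev (pre2 C \<chi> X) = \<nu>"
      and \<chi>u: "\<And>\<chi>'. \<chi>' \<in> carr (hom C A P) \<Longrightarrow> fwhisk ev (pre2 C \<chi>' X) = \<nu> \<Longrightarrow> \<chi>' = \<chi>"
      using cat_iso_cotensorD(2)[OF assms A(1) category_ord_cat nt] s(1,2)[OF u] unfolding \<nu>s by blast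
    \<comment> \<open>The cotensor property for transformations yields a 2-cell \<chi> whose ends
      are not prescribed. Injectivity on morphisms identifies them with \<open>u\<close> and
      \<open>v\<close>.\<close>
    have inj: "w = w'" if "w \<in> mors C A P" "w' \<in> mors C A P" "fcmp ev (pre C w X) = fcmp ev (pre C w' X)" for w w'
      using cat_iso_cotensorD(1)[OF assms A(1) category_ord_cat f[OF that(1)] s(1,2)[OF that(1)]] that by metis
    have cc: "nc (fwhisk ev (pre2 C \<chi>' X)) 0 = \<chi>' \<lhd> csrc C d" "nc (fwhisk ev (pre2 C \<chi>' X)) 1 = \<chi>' \<lhd> ctgt C d"
      if "\<chi>' \<in> carr (hom C A P)" for \<chi>'
      using that E(1-3) ev d by (auto simp: fwhisk_simps carr_hom mors_def)
    have "nsrc (fwhisk ev (pre2 C \<chi> X)) = fcmp ev (pre C u X)" "ntgt (fwhisk ev (pre2 C \<chi> X)) = fcmp ev (pre C v X)"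
      unfolding \<chi>(2) by (simp_all only: \<nu>s)
    then have "fcmp ev (pre C (csrc C \<chi>) X) = fcmp ev (pre C u X)" "fcmp ev (pre C (ctgt C \<chi>) X) = fcmp ev (pre C v X)"
      by (simp_all add: fwhisk_simps)
    then have "\<chi> \<in> cells C u v"
      using \<chi>(1) u v inj by (auto simp: cells_def carr_hom mors_def)
    moreover have "\<chi> \<lhd> csrc C d = a" "\<chi> \<lhd> ctgt C d = b"
      using cc[OF \<chi>(1)] unfolding \<chi>(2) \<nu>s by simp_all
    moreover have "\<chi>' = \<chi>" if "\<chi>' \<in> cells C u v" "\<chi>' \<lhd> csrc C d = a" "\<chi>' \<lhd> ctgt C d = b" for \<chi>'
    proof (rule \<chi>u)
      show c: "\<chi>' \<in> carr (hom C A P)" using that(1) u by (simp add: cells_def carr_hom mors_def)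
      have "is_ntrans (fwhisk ev (pre2 C \<chi>' X))"
        using c ev obj by (intro is_ntrans_fwhisk is_ntrans_pre2) (auto simp: carr_hom category_ord_cat)
      then show "fwhisk ev (pre2 C \<chi>' X) = \<nu>"
      proof (rule ntrans_eqI[OF _ nt])
        show "nsrc (fwhisk ev (pre2 C \<chi>' X)) = nsrc \<nu>" "ntgt (fwhisk ev (pre2 C \<chi>' X)) = ntgt \<nu>"
          using that(1) by (simp_all add: \<nu>s fwhisk_simps cells_def)
        fix j assume "j \<in> cobj (fdom (nsrc (fwhisk ev (pre2 C \<chi>' X))))"
        then have "j = 0 \<or> j = 1" using ev by (auto simp: fwhisk_simps fcmp_simps)
        then show "nc (fwhisk ev (pre2 C \<chi>' X)) j = nc \<nu> j"
          using cc[OF c] \<nu>s(3,4) that(2,3) by auto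
      qed
    qed
    ultimately show "\<exists>!\<chi>. \<chi> \<in> cells C u v \<and> \<chi> \<lhd> csrc C d = a \<and> \<chi> \<lhd> ctgt C d = b" by blast
  qed (use d obj in auto)
  then show ?thesis by (simp add: d_def)
qed

section \<open>Unique-existence forms of pullbacks, products and cores\<close>

lemma strict_pullbackD:
  assumes "strict_pullback C p q f g"
  shows "p \<in> mors C (src C p) (src C f)" "q \<in> mors C (src C p) (src C g)" "f \<in> mor C" "g \<in> mor C"
    "tgt C g = tgt C f" "p \<Zsemi> f = q \<Zsemi> g"
  using assms by (auto simp: strict_pullback_def mors_def)

lemma strict_pullback_ump:
  assumes "strict_pullback C p q f g"
  shows "\<lbrakk>a \<in> mors C B (src C f); b \<in> mors C B (src C g); a \<Zsemi> f = b \<Zsemi> g\<rbrakk>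
      \<Longrightarrow> \<exists>!t. t \<in> mors C B (src C p) \<and> t \<Zsemi> p = a \<and> t \<Zsemi> q = b"
    and "\<lbrakk>\<alpha> \<in> carr (hom C B (src C f)); \<beta> \<in> carr (hom C B (src C g)); \<alpha> \<lhd> f = \<beta> \<lhd> g\<rbrakk>
      \<Longrightarrow> \<exists>!\<chi>. \<chi> \<in> carr (hom C B (src C p)) \<and> \<chi> \<lhd> p = \<alpha> \<and> \<chi> \<lhd> q = \<beta>"
proof -
  let ?T = "\<lambda>B. pair_functor (post C B p) (post C B q) (cat_pullback (post C B f) (post C B g))"
  note D = strict_pullbackD[OF assms]
  have T: "cat_iso (?T B)" if "B \<in> obj C" for B using assms that unfolding strict_pullback_def by blast
  have s: "src C q = src C p" "tgt C p = src C f" "tgt C q = src C g" using D by (auto simp: mors_def)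
  show "\<exists>!t. t \<in> mors C B (src C p) \<and> t \<Zsemi> p = a \<and> t \<Zsemi> q = b"
    if "a \<in> mors C B (src C f)" "b \<in> mors C B (src C g)" "a \<Zsemi> f = b \<Zsemi> g"
  proof -
    have "B \<in> obj C" using that by (auto simp: mors_def)
    from bij_betw_ex1D[OF cat_isoD(2)[OF T[OF this]], of "(a, b)"] that s show ?thesis
      by (auto simp: pair_functor_def cat_pullback_def cat_prod_def cong: conj_cong)
  qed
  show "\<exists>!\<chi>. \<chi> \<in> carr (hom C B (src C p)) \<and> \<chi> \<lhd> p = \<alpha> \<and> \<chi> \<lhd> q = \<beta>"
    if "\<alpha> \<in> carr (hom C B (src C f))" "\<beta> \<in> carr (hom C B (src C g))" "\<alpha> \<lhd> f = \<beta> \<lhd> g"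
  proof -
    have "B \<in> obj C" using that by (auto simp: carr_hom)
    from bij_betw_ex1D[OF cat_isoD(3)[OF T[OF this]], of "(\<alpha>, \<beta>)"] that s show ?thesis
      by (auto simp: pair_functor_def cat_pullback_def cat_prod_def cong: conj_cong)
  qed
qed

lemma strict_productD:
  assumes "strict_product C X Y P p q"
  shows "p \<in> mors C P X" "q \<in> mors C P Y"
  using assms by (auto simp: strict_product_def)

lemma strict_product_ump:
  assumes "strict_product C X Y P p q"
  shows "\<lbrakk>a \<in> mors C B X; b \<in> mors C B Y\<rbrakk> \<Longrightarrow> \<exists>!t. t \<in> mors C B P \<and> t \<Zsemi> p = a \<and> t \<Zsemi> q = b"
    and "\<lbrakk>\<alpha> \<in> carr (hom C B X); \<beta> \<in> carr (hom C B Y)\<rbrakk>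
      \<Longrightarrow> \<exists>!\<chi>. \<chi> \<in> carr (hom C B P) \<and> \<chi> \<lhd> p = \<alpha> \<and> \<chi> \<lhd> q = \<beta>"
proof -
  let ?T = "\<lambda>B. pair_functor (post C B p) (post C B q) (cat_prod (hom C B X) (hom C B Y))"
  note D = strict_productD[OF assms]
  have T: "cat_iso (?T B)" if "B \<in> obj C" for B using assms that unfolding strict_product_def by blast
  have s: "src C q = P" "tgt C p = X" "tgt C q = Y" "src C p = P" using D by (auto simp: mors_def)
  show "\<exists>!t. t \<in> mors C B P \<and> t \<Zsemi> p = a \<and> t \<Zsemi> q = b"
    if "a \<in> mors C B X" "b \<in> mors C B Y"
  proof -
    have "B \<in> obj C" using that by (auto simp: mors_def)
    from bij_betw_ex1D[OF cat_isoD(2)[OF T[OF this]], of "(a, b)"] that s show ?thesis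
      by (auto simp: pair_functor_def cat_prod_def cong: conj_cong)
  qed
  show "\<exists>!\<chi>. \<chi> \<in> carr (hom C B P) \<and> \<chi> \<lhd> p = \<alpha> \<and> \<chi> \<lhd> q = \<beta>"
    if "\<alpha> \<in> carr (hom C B X)" "\<beta> \<in> carr (hom C B Y)"
  proof -
    have "B \<in> obj C" using that by (auto simp: carr_hom)
    from bij_betw_ex1D[OF cat_isoD(3)[OF T[OF this]], of "(\<alpha>, \<beta>)"] that s show ?thesis
      by (auto simp: pair_functor_def cat_prod_def cong: conj_cong)
  qed
qed

lemma is_coreD:
  assumes "is_core C X K i"
  shows "X \<in> obj C" "K \<in> obj C" "i \<in> mor C" "src C i = K" "tgt C i = X" "arrowwise_iso C i"
  using assms by (auto simp: is_core_def mors_def)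

text \<open>The first two clauses are bijectivity of composition with \<open>i\<close>; the last two
  express that its values lie in \<open>arrowwise_iso_cat\<close>. The fourth is what makes
  \<open>K\<close> a groupoid.\<close>

lemma is_core_ump:
  assumes "is_core C X K i"
  shows "\<lbrakk>a \<in> mors C A X; arrowwise_iso C a\<rbrakk> \<Longrightarrow> \<exists>!u. u \<in> mors C A K \<and> u \<Zsemi> i = a"
    and "\<lbrakk>iso_arr (hom C A X) \<alpha>; arrowwise_iso C (csrc C \<alpha>); arrowwise_iso C (ctgt C \<alpha>)\<rbrakk>
      \<Longrightarrow> \<exists>!\<chi>. \<chi> \<in> carr (hom C A K) \<and> \<chi> \<lhd> i = \<alpha>"
    and "u \<in> mors C A K \<Longrightarrow> arrowwise_iso C (u \<Zsemi> i)"
    and "\<chi> \<in> carr (hom C A K) \<Longrightarrow> iso_arr (hom C A X) (\<chi> \<lhd> i)"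
proof -
  let ?T = "\<lambda>A. (post C A i)\<lparr>fcod := arrowwise_iso_cat C A X\<rparr>"
  note D = is_coreD[OF assms]
  have T: "cat_iso (?T A)" if "A \<in> obj C" for A using assms that unfolding is_core_def by blast
  show "\<exists>!u. u \<in> mors C A K \<and> u \<Zsemi> i = a" if "a \<in> mors C A X" "arrowwise_iso C a"
  proof -
    have "A \<in> obj C" using that by (auto simp: mors_def)
    from bij_betw_ex1D[OF cat_isoD(2)[OF T[OF this]], of a] that D show ?thesis
      by (auto simp: arrowwise_iso_cat_def cong: conj_cong)
  qed
  show "\<exists>!\<chi>. \<chi> \<in> carr (hom C A K) \<and> \<chi> \<lhd> i = \<alpha>"
    if "iso_arr (hom C A X) \<alpha>" "arrowwise_iso C (csrc C \<alpha>)" "arrowwise_iso C (ctgt C \<alpha>)"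
  proof -
    have c: "\<alpha> \<in> carr (hom C A X)" using that by (auto simp: iso_arr_def is_inverse_def)
    then have "A \<in> obj C" by (auto simp: carr_hom)
    from bij_betw_ex1D[OF cat_isoD(3)[OF T[OF this]], of \<alpha>] that c D show ?thesis
      by (auto simp: arrowwise_iso_cat_def cong: conj_cong)
  qed
  show "arrowwise_iso C (u \<Zsemi> i)" if "u \<in> mors C A K"
  proof -
    have "A \<in> obj C" using that by (auto simp: mors_def)
    from is_functorD(1)[OF cat_isoD(1)[OF T[OF this]], of u] that D show ?thesis
      by (auto simp: arrowwise_iso_cat_def)
  qed
  show "iso_arr (hom C A X) (\<chi> \<lhd> i)" if "\<chi> \<in> carr (hom C A K)"
  proof -
    have "A \<in> obj C" using that by (auto simp: carr_hom)
    from is_functorD(2)[OF cat_isoD(1)[OF T[OF this]], of \<chi>] that D show ?thesis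
      by (auto simp: arrowwise_iso_cat_def)
  qed
qed

section \<open>Invertible 2-cells\<close>

lemma is_inverse_hom:
  "is_inverse (hom C A X) a b \<longleftrightarrow> a \<in> carr (hom C A X) \<and> b \<in> carr (hom C A X) \<and>
     csrc C b = ctgt C a \<and> ctgt C b = csrc C a \<and> a \<odot> b = idc C (csrc C a) \<and> b \<odot> a = idc C (ctgt C a)"
  by (auto simp: is_inverse_def)

lemma iso_homE:
  assumes "iso_arr (hom C A X) a"
  obtains b where "a \<in> cell C" "src C (csrc C a) = A" "tgt C (csrc C a) = X"
    "b \<in> cell C" "csrc C b = ctgt C a" "ctgt C b = csrc C a"
    "a \<odot> b = idc C (csrc C a)" "b \<odot> a = idc C (ctgt C a)"
  using assms unfolding iso_arr_def is_inverse_hom by (auto simp: carr_hom)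

lemma iso_homI:
  assumes "a \<in> cell C" "src C (csrc C a) = A" "tgt C (csrc C a) = X"
    "b \<in> cell C" "csrc C b = ctgt C a" "ctgt C b = csrc C a"
    "a \<odot> b = idc C (csrc C a)" "b \<odot> a = idc C (ctgt C a)"
  shows "iso_arr (hom C A X) a"
  using assms cell_mor(3,4)[of a] unfolding iso_arr_def is_inverse_hom by (auto simp: carr_hom)

lemma iso_idc:
  "u \<in> mors C A X \<Longrightarrow> iso_arr (hom C A X) (idc C u)"
  by (rule iso_homI[where b="idc C u"]) (auto simp: mors_def)

lemma iso_vcmp:
  assumes "iso_arr (hom C A X) a" "iso_arr (hom C A X) b" "ctgt C a = csrc C b"
  shows "iso_arr (hom C A X) (a \<odot> b)"
proof -
  have "A \<in> obj C" "X \<in> obj C" using assms by (auto elim!: iso_homE)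
  from category.iso_arr_comp[OF hom_category[OF this]] assms show ?thesis by simp
qed

lemma iso_inv:
  assumes "iso_arr (hom C A X) a"
  obtains b where "iso_arr (hom C A X) b" "csrc C b = ctgt C a" "ctgt C b = csrc C a"
    "a \<odot> b = idc C (csrc C a)" "b \<odot> a = idc C (ctgt C a)"
  using assms unfolding iso_arr_def is_inverse_hom by metis

text \<open>\<beta> is the composite of the inverse of \<open>a\<close> with \<alpha> and
  \<open>b\<close>. It serves to carry invertibility across a naturality square with two invertible
  parallel sides.\<close>

lemma iso_conj:
  assumes "\<alpha> \<in> cell C" "\<beta> \<in> cell C" "iso_arr (hom C A X) a" "iso_arr (hom C A X) b"
    "\<alpha> \<odot> b = a \<odot> \<beta>" "ctgt C \<alpha> = csrc C b" "ctgt C a = csrc C \<beta>" "iso_arr (hom C A X) \<alpha>"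
  shows "iso_arr (hom C A X) \<beta>"
proof -
  obtain a' where a': "iso_arr (hom C A X) a'" "csrc C a' = ctgt C a" "ctgt C a' = csrc C a"
    "a' \<odot> a = idc C (ctgt C a)" by (rule iso_inv[OF assms(3)])
  have c: "a \<in> cell C" "a' \<in> cell C" "b \<in> cell C" using a'(1) assms(3,4) by (auto elim!: iso_homE)
  have s: "csrc C a = csrc C \<alpha>"
    using vcmp_cell(2)[OF assms(1) c(3) assms(6)] vcmp_cell(2)[OF c(1) assms(2,7)] assms(5) by simp
  have "\<beta> = (a' \<odot> a) \<odot> \<beta>" using a' assms by simp
  also have "\<dots> = a' \<odot> (a \<odot> \<beta>)" by (rule vcmp_assoc) (use a' assms c in auto)
  also have "\<dots> = a' \<odot> (\<alpha> \<odot> b)" using assms by simp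
  finally have "\<beta> = a' \<odot> (\<alpha> \<odot> b)" .
  moreover have "iso_arr (hom C A X) (a' \<odot> (\<alpha> \<odot> b))"
    using a' s assms c by (intro iso_vcmp) simp_all
  ultimately show ?thesis by simp
qed

end

section \<open>Isomorphisms into an arrow object\<close>

context arrow_object
begin

lemma X_obj [simp]: "X \<in> obj C"
  using mor_obj(2)[of "csrc C d"] by simp

lemma d_simps [simp]:
  "csrc C d \<in> mor C" "ctgt C d \<in> mor C" "src C (ctgt C d) = P" "tgt C (ctgt C d) = X"
  by simp_all

lemma mor_eqI: "\<lbrakk>u \<in> mors C A P; v \<in> mors C A P; u \<rhd> d = v \<rhd> d\<rbrakk> \<Longrightarrow> u = v"
  using mor_ump[of "u \<rhd> d"] by (auto simp: mors_def)

lemma mor_ex: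
  assumes "\<phi> \<in> cell C" "tgt C (csrc C \<phi>) = X" "src C (csrc C \<phi>) = A"
  obtains u where "u \<in> mors C A P" "u \<rhd> d = \<phi>" "u \<Zsemi> csrc C d = csrc C \<phi>" "u \<Zsemi> ctgt C d = ctgt C \<phi>"
proof -
  obtain u where u: "u \<in> mors C A P" "u \<rhd> d = \<phi>" using mor_ump[OF assms(1,2)] assms(3) by auto
  then have "csrc C (u \<rhd> d) = u \<Zsemi> csrc C d" "ctgt C (u \<rhd> d) = u \<Zsemi> ctgt C d"
    using whisk_l_cell(2,3)[of u d] by (auto simp: mors_def)
  with u that show ?thesis by simp
qed

text \<open>Both sides are the horizontal composite of \<chi> and \<open>d\<close>.\<close>

lemma cell_natural:
  assumes "\<chi> \<in> cells C u v" "u \<in> mors C A P"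
  shows "(\<chi> \<lhd> csrc C d) \<odot> (v \<rhd> d) = (u \<rhd> d) \<odot> (\<chi> \<lhd> ctgt C d)"
  using hcmp_whisk[of \<chi> d] assms by (auto simp: cells_def mors_def)

lemma cell_eqI:
  assumes "\<chi> \<in> cells C u v" "\<chi>' \<in> cells C u v" "u \<in> mors C A P"
    "\<chi> \<lhd> csrc C d = \<chi>' \<lhd> csrc C d" "\<chi> \<lhd> ctgt C d = \<chi>' \<lhd> ctgt C d"
  shows "\<chi> = \<chi>'"
proof -
  have v: "v \<in> mors C A P" using assms(1,3) cell_mor(2-4)[of \<chi>] by (auto simp: cells_def mors_def)
  have "\<exists>!\<chi>. \<chi> \<in> cells C u v \<and> \<chi> \<lhd> csrc C d = \<chi>' \<lhd> csrc C d \<and> \<chi> \<lhd> ctgt C d = \<chi>' \<lhd> ctgt C d"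
    by (rule cell_ump[OF assms(3) v _ _ cell_natural[OF assms(2,3)]])
       (use assms v in \<open>auto simp: cells_def mors_def\<close>)
  then show ?thesis using assms by blast
qed

text \<open>The inverses of the two sides of a commutative square form a commutative square again,
  which classifies the candidate inverse of \<chi>. That it is an inverse is checked on the two
  sides by \<open>cell_eqI\<close>.\<close>

lemma cell_iso:
  assumes \<chi>: "\<chi> \<in> cells C u v" and u: "u \<in> mors C A P"
    and i0: "iso_arr (hom C A X) (\<chi> \<lhd> csrc C d)" and i1: "iso_arr (hom C A X) (\<chi> \<lhd> ctgt C d)"
  shows "iso_arr (hom C A P) \<chi>"
proof -
  have v: "v \<in> mors C A P" using assms(1,2) cell_mor(2-4)[of \<chi>] by (auto simp: cells_def mors_def)
  have s: "\<chi> \<in> cell C" "csrc C \<chi> = u" "ctgt C \<chi> = v" "u \<in> mor C" "v \<in> mor C"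
    "src C u = A" "tgt C u = P" "src C v = A" "tgt C v = P"
    using \<chi> u v by (auto simp: cells_def mors_def)
  obtain a' where a': "iso_arr (hom C A X) a'" "csrc C a' = v \<Zsemi> csrc C d" "ctgt C a' = u \<Zsemi> csrc C d"
    "(\<chi> \<lhd> csrc C d) \<odot> a' = idc C (u \<Zsemi> csrc C d)" "a' \<odot> (\<chi> \<lhd> csrc C d) = idc C (v \<Zsemi> csrc C d)"
    using iso_inv[OF i0] s by auto
  obtain b' where b': "iso_arr (hom C A X) b'" "csrc C b' = v \<Zsemi> ctgt C d" "ctgt C b' = u \<Zsemi> ctgt C d"
    "(\<chi> \<lhd> ctgt C d) \<odot> b' = idc C (u \<Zsemi> ctgt C d)" "b' \<odot> (\<chi> \<lhd> ctgt C d) = idc C (v \<Zsemi> ctgt C d)"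
    using iso_inv[OF i1] s by auto
  have c: "a' \<in> cell C" "b' \<in> cell C" using a'(1) b'(1) by (auto elim!: iso_homE)
  \<comment> \<open>Naturality of \<chi>, composed with \<open>a'\<close> in front and
    \<open>b'\<close> behind, becomes the naturality of the inverse pair.\<close>
  have "a' \<odot> (u \<rhd> d) = a' \<odot> ((u \<rhd> d) \<odot> ((\<chi> \<lhd> ctgt C d) \<odot> b'))"
    using b' s c by simp
  also have "\<dots> = a' \<odot> (((u \<rhd> d) \<odot> (\<chi> \<lhd> ctgt C d)) \<odot> b')"
    using b' s c by (simp add: vcmp_assoc)
  also have "\<dots> = a' \<odot> (((\<chi> \<lhd> csrc C d) \<odot> (v \<rhd> d)) \<odot> b')"
    using cell_natural[OF \<chi> u] by simp
  also have "\<dots> = (a' \<odot> (\<chi> \<lhd> csrc C d)) \<odot> ((v \<rhd> d) \<odot> b')"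
    using a'(2,3) b'(2,3) s c by (simp add: vcmp_assoc)
  also have "\<dots> = (v \<rhd> d) \<odot> b'"
    using a' b' s c by simp
  finally have n: "a' \<odot> (u \<rhd> d) = (v \<rhd> d) \<odot> b'" .
  obtain \<chi>' where \<chi>': "\<chi>' \<in> cells C v u" "\<chi>' \<lhd> csrc C d = a'" "\<chi>' \<lhd> ctgt C d = b'"
    using cell_ump[OF v u _ _ n] a' b' c by (auto simp: cells_def)
  have s': "\<chi>' \<in> cell C" "csrc C \<chi>' = v" "ctgt C \<chi>' = u" using \<chi>' by (auto simp: cells_def)
  have "\<chi> \<odot> \<chi>' = idc C u"
    by (rule cell_eqI[where u=u and v=u, OF _ _ u])
       (use s s' \<chi>' a' b' in \<open>simp_all add: cells_def whisk_r_vcmp\<close>)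
  moreover have "\<chi>' \<odot> \<chi> = idc C v"
    by (rule cell_eqI[where u=v and v=v, OF _ _ v])
       (use s s' \<chi>' a' b' in \<open>simp_all add: cells_def whisk_r_vcmp\<close>)
  ultimately show ?thesis
    using s s' by (intro iso_homI[where b=\<chi>']) simp_all
qed

text \<open>This says that \<open>\<langle>\<partial>\<^sub>0, \<partial>\<^sub>1\<rangle>\<close> is an isofibration, without mentioning products.\<close>

lemma iso_transport:
  assumes u: "u \<in> mors C A P" and a: "iso_arr (hom C A X) a" "csrc C a = u \<Zsemi> csrc C d"
    and b: "iso_arr (hom C A X) b" "csrc C b = u \<Zsemi> ctgt C d"
  obtains v \<chi> where "v \<in> mors C A P" "\<chi> \<in> cells C u v" "\<chi> \<lhd> csrc C d = a" "\<chi> \<lhd> ctgt C d = b"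
    "iso_arr (hom C A P) \<chi>"
proof -
  have s: "u \<in> mor C" "src C u = A" "tgt C u = P" using u by (auto simp: mors_def)
  obtain a' where a': "iso_arr (hom C A X) a'" "csrc C a' = ctgt C a" "ctgt C a' = csrc C a"
    "a \<odot> a' = idc C (csrc C a)" by (rule iso_inv[OF a(1)])
  have c: "a \<in> cell C" "a' \<in> cell C" "b \<in> cell C" using a'(1) a(1) b(1) by (auto elim!: iso_homE)
  have ac: "src C (csrc C a) = A" "tgt C (csrc C a) = X" "src C (csrc C b) = A" "tgt C (csrc C b) = X"
    using a(1) b(1) by (auto elim!: iso_homE)
  \<comment> \<open>The arrow classified by \<open>u\<close>, conjugated by the given isomorphisms:
    the only arrow that turns \<open>a\<close> and \<open>b\<close> into the sides of a commutative
    square. Its classifying morphism is the new end \<open>v\<close>.\<close>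
  let ?\<phi> = "(a' \<odot> (u \<rhd> d)) \<odot> b"
  have \<phi>: "?\<phi> \<in> cell C" "csrc C ?\<phi> = ctgt C a" "ctgt C ?\<phi> = ctgt C b"
    using a a' b c s by simp_all
  obtain v where v: "v \<in> mors C A P" "v \<rhd> d = ?\<phi>" "v \<Zsemi> csrc C d = csrc C ?\<phi>" "v \<Zsemi> ctgt C d = ctgt C ?\<phi>"
    using mor_ex[OF \<phi>(1)] c ac unfolding \<phi> by auto
  have "a \<odot> ?\<phi> = (a \<odot> a') \<odot> ((u \<rhd> d) \<odot> b)"
    using a(2) a'(2,3) b c s by (simp add: vcmp_assoc)
  also have "\<dots> = (u \<rhd> d) \<odot> b" using a' a b c s by simp
  finally have n: "a \<odot> (v \<rhd> d) = (u \<rhd> d) \<odot> b" using v by simp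
  obtain \<chi> where \<chi>: "\<chi> \<in> cells C u v" "\<chi> \<lhd> csrc C d = a" "\<chi> \<lhd> ctgt C d = b"
    using cell_ump[OF u v(1) _ _ n] a b c v(3,4) \<phi> by (auto simp: cells_def)
  show ?thesis
    using cell_iso[OF \<chi>(1) u] \<chi> a b v by (intro that) auto
qed

text \<open>Transport with the identity at the source of the arrow. The statement is needed because
  pita provides pullbacks of isofibrations only, and composable pairs form the pullback of
  \<open>ctgt C d\<close> along \<open>csrc C d\<close>.\<close>

lemma isofibration_d1: "isofibration C (ctgt C d)"
  unfolding isofibration_def cat_isofibration_def
proof (intro conjI ballI allI impI)
  fix A u m assume A: "A \<in> obj C" and u: "u \<in> cobj (fdom (post C A (ctgt C d)))"
    and m: "iso_arr (fcod (post C A (ctgt C d))) m \<and>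
      cdom (fcod (post C A (ctgt C d))) m = fo (post C A (ctgt C d)) u"
  have u': "u \<in> mors C A P" using u by simp
  have i: "iso_arr (hom C A X) (idc C (u \<Zsemi> csrc C d))"
    using u' by (intro iso_idc) (simp add: mors_def)
  from m u' have m': "iso_arr (hom C A X) m" "csrc C m = u \<Zsemi> ctgt C d" by simp_all
  obtain v \<chi> where v: "v \<in> mors C A P" "\<chi> \<in> cells C u v" "\<chi> \<lhd> ctgt C d = m" "iso_arr (hom C A P) \<chi>"
    by (rule iso_transport[OF u' i _ m']) (use u' in \<open>auto simp: mors_def\<close>)
  then have "\<chi> \<in> carr (hom C A P)" "csrc C \<chi> = u" using u' by (auto simp: cells_def carr_hom mors_def)
  with v show "\<exists>l. iso_arr (fdom (post C A (ctgt C d))) l \<and>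
      cdom (fdom (post C A (ctgt C d))) l = u \<and> fa (post C A (ctgt C d)) l = m"
    by (intro exI[of _ \<chi>]) simp
qed simp

end

section \<open>The object of composable pairs as a cotensor with the order of three elements\<close>

locale composable_pairs = arrow_object C X P d
  for C :: "('o, 'a, 'c) two_cat" (structure) and X P d +
  fixes p q :: 'a
  assumes pullback: "strict_pullback C p q (ctgt C d) (csrc C d)"
begin

abbreviation "Q \<equiv> src C p"

lemma pq_simps [simp]:
  "p \<in> mor C" "q \<in> mor C" "src C q = Q" "tgt C p = P" "tgt C q = P" "Q \<in> obj C"
  using strict_pullbackD[OF pullback] by (auto simp: mors_def)

lemma pq_eq: "p \<Zsemi> ctgt C d = q \<Zsemi> csrc C d"
  using strict_pullbackD(6)[OF pullback] .

lemma pair_ex1: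
  "\<lbrakk>v \<in> mors C A P; w \<in> mors C A P; v \<Zsemi> ctgt C d = w \<Zsemi> csrc C d\<rbrakk>
    \<Longrightarrow> \<exists>!t. t \<in> mors C A Q \<and> t \<Zsemi> p = v \<and> t \<Zsemi> q = w"
  using strict_pullback_ump(1)[OF pullback, of v A w] by simp

lemma pair_cell_ex1:
  "\<lbrakk>\<alpha> \<in> carr (hom C A P); \<beta> \<in> carr (hom C A P); \<alpha> \<lhd> ctgt C d = \<beta> \<lhd> csrc C d\<rbrakk>
    \<Longrightarrow> \<exists>!\<chi>. \<chi> \<in> carr (hom C A Q) \<and> \<chi> \<lhd> p = \<alpha> \<and> \<chi> \<lhd> q = \<beta>"
  using strict_pullback_ump(2)[OF pullback, of \<alpha> A \<beta>] by simp

lemma pair_eqI: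
  assumes "t \<in> mors C A Q" "t' \<in> mors C A Q" "t \<Zsemi> p = t' \<Zsemi> p" "t \<Zsemi> q = t' \<Zsemi> q"
  shows "t = t'"
proof -
  have "(t' \<Zsemi> p) \<Zsemi> ctgt C d = (t' \<Zsemi> q) \<Zsemi> csrc C d"
    using assms(2) pq_eq by (simp add: cmp_assoc mors_def)
  then have "\<exists>!t. t \<in> mors C A Q \<and> t \<Zsemi> p = t' \<Zsemi> p \<and> t \<Zsemi> q = t' \<Zsemi> q"
    using assms(2) by (intro pair_ex1) (auto simp: mors_def)
  then show ?thesis using assms by blast
qed

lemma pair_cell_eqI:
  assumes "t \<in> carr (hom C A Q)" "t' \<in> carr (hom C A Q)" "t \<lhd> p = t' \<lhd> p" "t \<lhd> q = t' \<lhd> q"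
  shows "t = t'"
proof -
  have "(t' \<lhd> p) \<lhd> ctgt C d = (t' \<lhd> q) \<lhd> csrc C d"
    using assms(2) pq_eq by (simp add: whisk_r_cmp[symmetric] carr_hom)
  then have "\<exists>!t. t \<in> carr (hom C A Q) \<and> t \<lhd> p = t' \<lhd> p \<and> t \<lhd> q = t' \<lhd> q"
    using assms(2) by (intro pair_cell_ex1) (auto simp: carr_hom)
  then show ?thesis using assms by blast
qed

text \<open>The inverses of the two projections of \<chi> have the same image in \<open>X\<close>,
  since inverses are unique; hence they pair to a 2-cell into the pullback. This is the fact that
  lets cores commute with this pullback.\<close>

lemma pair_cell_iso:
  assumes \<chi>: "\<chi> \<in> carr (hom C A Q)"
    and "iso_arr (hom C A P) (\<chi> \<lhd> p)" "iso_arr (hom C A P) (\<chi> \<lhd> q)"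
  shows "iso_arr (hom C A Q) \<chi>"
proof -
  obtain u v where s: "\<chi> \<in> cell C" "csrc C \<chi> = u" "ctgt C \<chi> = v" "u \<in> mor C" "v \<in> mor C"
    "src C u = A" "tgt C u = Q" "src C v = A" "tgt C v = Q"
    using \<chi> by (auto simp: carr_hom)
  obtain a where a: "iso_arr (hom C A P) a" "csrc C a = v \<Zsemi> p" "ctgt C a = u \<Zsemi> p"
    "(\<chi> \<lhd> p) \<odot> a = idc C (u \<Zsemi> p)" "a \<odot> (\<chi> \<lhd> p) = idc C (v \<Zsemi> p)"
    using iso_inv[OF assms(2)] s by auto
  obtain b where b: "iso_arr (hom C A P) b" "csrc C b = v \<Zsemi> q" "ctgt C b = u \<Zsemi> q"
    "(\<chi> \<lhd> q) \<odot> b = idc C (u \<Zsemi> q)" "b \<odot> (\<chi> \<lhd> q) = idc C (v \<Zsemi> q)"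
    using iso_inv[OF assms(3)] s by auto
  have c: "a \<in> cell C" "b \<in> cell C" using a(1) b(1) by (auto elim!: iso_homE)
  have vpq: "(v \<Zsemi> p) \<Zsemi> ctgt C d = (v \<Zsemi> q) \<Zsemi> csrc C d" "(u \<Zsemi> p) \<Zsemi> ctgt C d = (u \<Zsemi> q) \<Zsemi> csrc C d"
    using pq_eq s by (simp_all add: cmp_assoc)
  have ci: "is_inverse (hom C A X) ((\<chi> \<lhd> p) \<lhd> ctgt C d) (a \<lhd> ctgt C d)"
    unfolding is_inverse_hom using a s c
    by (auto simp: carr_hom whisk_r_vcmp[symmetric])
  have "is_inverse (hom C A X) ((\<chi> \<lhd> q) \<lhd> csrc C d) (b \<lhd> csrc C d)"
    unfolding is_inverse_hom using b s c
    by (auto simp: carr_hom whisk_r_vcmp[symmetric])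
  moreover have "(\<chi> \<lhd> q) \<lhd> csrc C d = (\<chi> \<lhd> p) \<lhd> ctgt C d"
    using s pq_eq by (simp add: whisk_r_cmp[symmetric])
  ultimately have "a \<lhd> ctgt C d = b \<lhd> csrc C d"
    using category.inverse_unique[OF hom_category ci] s mor_obj(1)[of u] by simp
  then obtain \<psi> where \<psi>: "\<psi> \<in> carr (hom C A Q)" "\<psi> \<lhd> p = a" "\<psi> \<lhd> q = b"
    using pair_cell_ex1[of a A b] a b c s by (auto simp: carr_hom)
  have "csrc C (\<psi> \<lhd> p) = v \<Zsemi> p" "csrc C (\<psi> \<lhd> q) = v \<Zsemi> q" "ctgt C (\<psi> \<lhd> p) = u \<Zsemi> p" "ctgt C (\<psi> \<lhd> q) = u \<Zsemi> q"
    using \<psi> a b by simp_all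
  then have \<psi>s: "csrc C \<psi> = v" "ctgt C \<psi> = u"
    using \<psi>(1) s by (auto intro!: pair_eqI[of _ A] simp: carr_hom mors_def)
  have \<psi>c: "\<psi> \<in> cell C" using \<psi> by (simp add: carr_hom)
  have "\<chi> \<odot> \<psi> = idc C u"
    by (rule pair_cell_eqI[of _ A]) (use s \<psi> \<psi>s \<psi>c a b in \<open>simp_all add: carr_hom whisk_r_vcmp\<close>)
  moreover have "\<psi> \<odot> \<chi> = idc C v"
    by (rule pair_cell_eqI[of _ A]) (use s \<psi> \<psi>s \<psi>c a b in \<open>simp_all add: carr_hom whisk_r_vcmp\<close>)
  ultimately show ?thesis
    using s \<psi>s \<psi>c by (intro iso_homI[where b=\<psi>]) simp_all
qed

text \<open>\<open>ord_cat 2\<close> is two copies of \<open>ord_cat 1\<close> glued end to start,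
  so its functors are composable pairs, and these are classified by the pullback \<open>Q\<close>.
  The evaluation functor sends the two generating arrows to the two projections of the universal
  pair.\<close>

definition ev2 :: "(nat, nat \<times> nat, 'a, 'c) fnctr" where
  "ev2 = pair_chain (hom C Q X) (p \<rhd> d) (q \<rhd> d)"

lemma ev2:
  shows "is_functor ev2" "fdom ev2 = ord_cat 2" "fcod ev2 = hom C Q X"
    and "fa ev2 (0, 1) = p \<rhd> d" "fa ev2 (1, 2) = q \<rhd> d" "fa ev2 (0, 2) = (p \<rhd> d) \<odot> (q \<rhd> d)"
    and "fo ev2 0 = p \<Zsemi> csrc C d" "fo ev2 1 = p \<Zsemi> ctgt C d" "fo ev2 2 = q \<Zsemi> ctgt C d"
proof -
  have a: "category (hom C Q X)" "p \<rhd> d \<in> carr (hom C Q X)" "q \<rhd> d \<in> carr (hom C Q X)"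
    "ccod (hom C Q X) (p \<rhd> d) = cdom (hom C Q X) (q \<rhd> d)"
    using pq_eq by (auto simp: carr_hom intro: hom_category)
  show "is_functor ev2" "fdom ev2 = ord_cat 2" "fcod ev2 = hom C Q X"
    "fa ev2 (0, 1) = p \<rhd> d" "fa ev2 (1, 2) = q \<rhd> d" "fa ev2 (0, 2) = (p \<rhd> d) \<odot> (q \<rhd> d)"
    using pair_chain[OF a] unfolding ev2_def by (simp_all only: hom_simps)
  note E = functor_to_homD(5,6)[OF this(1-3)]
  show "fo ev2 0 = p \<Zsemi> csrc C d" "fo ev2 1 = p \<Zsemi> ctgt C d" "fo ev2 2 = q \<Zsemi> ctgt C d"
    using E[of 0 1] E[of 1 2] \<open>fa ev2 (0, 1) = p \<rhd> d\<close> \<open>fa ev2 (1, 2) = q \<rhd> d\<close> by simp_all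
qed

lemma ev2_pre:
  assumes "u \<in> mors C A Q"
  shows "is_functor (fcmp ev2 (pre C u X))" "fdom (fcmp ev2 (pre C u X)) = ord_cat 2"
    "fcod (fcmp ev2 (pre C u X)) = hom C A X"
    "fa (fcmp ev2 (pre C u X)) (0, 1) = (u \<Zsemi> p) \<rhd> d"
    "fa (fcmp ev2 (pre C u X)) (1, 2) = (u \<Zsemi> q) \<rhd> d"
    "fo (fcmp ev2 (pre C u X)) 0 = (u \<Zsemi> p) \<Zsemi> csrc C d"
    "fo (fcmp ev2 (pre C u X)) 1 = (u \<Zsemi> p) \<Zsemi> ctgt C d"
    "fo (fcmp ev2 (pre C u X)) 2 = (u \<Zsemi> q) \<Zsemi> ctgt C d"
  using assms ev2
  by (auto simp: fcmp_simps mors_def whisk_l_cmp cmp_assoc carr_hom category_ord_cat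
      intro!: is_functor_fcmp is_functor_pre)

lemma ev2_pre_eq_iff:
  assumes "u \<in> mors C A Q" "is_functor F" "fdom F = ord_cat 2" "fcod F = hom C A X"
  shows "fcmp ev2 (pre C u X) = F \<longleftrightarrow> (u \<Zsemi> p) \<rhd> d = fa F (0, 1) \<and> (u \<Zsemi> q) \<rhd> d = fa F (1, 2)"
  using functor_eq_ord2[OF ev2_pre(1,2)[OF assms(1)] assms(2,3)] ev2_pre(3-5)[OF assms(1)] assms(4)
  by auto

lemma ev2_mor_ex1:
  assumes F: "is_functor F" "fdom F = ord_cat 2" "fcod F = hom C A X"
  shows "\<exists>!u. u \<in> mors C A Q \<and> fcmp ev2 (pre C u X) = F"
proof -
  note E = functor_to_homD[OF F]
  define f g where "f = fa F (0, 1)" and "g = fa F (1, 2)"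
  have f: "f \<in> cell C" "tgt C (csrc C f) = X" "src C (csrc C f) = A"
    and g: "g \<in> cell C" "tgt C (csrc C g) = X" "src C (csrc C g) = A" and fg: "ctgt C f = csrc C g"
    unfolding f_def g_def using E(4-6)[of 0 1] E(4-6)[of 1 2] E(2,3)[of 0] E(2,3)[of 1] by simp_all
  obtain v where v: "v \<in> mors C A P" "v \<rhd> d = f" "v \<Zsemi> ctgt C d = ctgt C f" by (rule mor_ex[OF f])
  obtain w where w: "w \<in> mors C A P" "w \<rhd> d = g" "w \<Zsemi> csrc C d = csrc C g" by (rule mor_ex[OF g])
  \<comment> \<open>\<open>f\<close> ends where \<open>g\<close> starts, at the value of
    \<open>F\<close> at 1; this is the matching condition of the pullback.\<close>
  have ex: "\<exists>!t. t \<in> mors C A Q \<and> t \<Zsemi> p = v \<and> t \<Zsemi> q = w"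
    using v w fg by (intro pair_ex1) auto
  have "fcmp ev2 (pre C t X) = F \<longleftrightarrow> t \<Zsemi> p = v \<and> t \<Zsemi> q = w" if t: "t \<in> mors C A Q" for t
  proof -
    have "t \<Zsemi> p \<in> mors C A P" "t \<Zsemi> q \<in> mors C A P" using t by (simp_all add: mors_def)
    then show ?thesis
      using ev2_pre_eq_iff[OF t F] mor_eqI[of "t \<Zsemi> p" A v] mor_eqI[of "t \<Zsemi> q" A w] v w
      unfolding f_def g_def by metis
  qed
  then show ?thesis using ex by (simp cong: conj_cong)
qed

text \<open>A transformation has three components \<open>a\<close>, \<open>b\<close>,
  \<open>c\<close>. The pairs \<open>(a, b)\<close> and \<open>(b, c)\<close> are commutative
  squares, hence 2-cells into the arrow object, and these agree over the shared middle component
  \<open>b\<close>, so the pullback glues them.\<close>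

lemma ev2_cell_ex1:
  assumes \<nu>: "is_ntrans \<nu>" "fdom (nsrc \<nu>) = ord_cat 2" "fcod (nsrc \<nu>) = hom C A X"
  shows "\<exists>!\<chi>. \<chi> \<in> carr (hom C A Q) \<and> fwhisk ev2 (pre2 C \<chi> X) = \<nu>"
proof -
  note N = is_ntransD[OF \<nu>(1), unfolded \<nu>(2,3)]
  obtain u where u: "u \<in> mors C A Q" "fcmp ev2 (pre C u X) = nsrc \<nu>"
    using ev2_mor_ex1[OF N(1) \<nu>(2,3)] by blast
  obtain v where v: "v \<in> mors C A Q" "fcmp ev2 (pre C v X) = ntgt \<nu>"
    using ev2_mor_ex1[OF N(2-4)] by blast
  have inj: "w = w'" if "w \<in> mors C A Q" "w' \<in> mors C A Q" "fcmp ev2 (pre C w X) = fcmp ev2 (pre C w' X)" for w w'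
    using ev2_mor_ex1[OF ev2_pre(1-3)[OF that(1)]] that by metis
  note U = ev2_pre[OF u(1), unfolded u(2)] and V = ev2_pre[OF v(1), unfolded v(2)]
  have s: "u \<in> mor C" "src C u = A" "tgt C u = Q" "v \<in> mor C" "src C v = A" "tgt C v = Q"
    using u v by (auto simp: mors_def)
  define a b c where "a = nc \<nu> 0" and "b = nc \<nu> 1" and "c = nc \<nu> 2"
  note abc = this
  have a: "a \<in> cells C ((u \<Zsemi> p) \<Zsemi> csrc C d) ((v \<Zsemi> p) \<Zsemi> csrc C d)"
    and b: "b \<in> cells C ((u \<Zsemi> p) \<Zsemi> ctgt C d) ((v \<Zsemi> p) \<Zsemi> ctgt C d)"
    and c: "c \<in> cells C ((u \<Zsemi> q) \<Zsemi> ctgt C d) ((v \<Zsemi> q) \<Zsemi> ctgt C d)"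
    using N(6)[of 0] N(6)[of 1] N(6)[of 2] U(6-8) V(6-8) unfolding abc
    by (simp_all add: chom_def cells_def carr_hom)
  \<comment> \<open>The middle component has to be typed twice, as target side of the first square
    and as source side of the second; \<open>pq_eq\<close> identifies the two types.\<close>
  have b': "b \<in> cells C ((u \<Zsemi> q) \<Zsemi> csrc C d) ((v \<Zsemi> q) \<Zsemi> csrc C d)"
    using b s pq_eq by (simp add: cmp_assoc)
  have n1: "a \<odot> ((v \<Zsemi> p) \<rhd> d) = ((u \<Zsemi> p) \<rhd> d) \<odot> b" and n2: "b \<odot> ((v \<Zsemi> q) \<rhd> d) = ((u \<Zsemi> q) \<rhd> d) \<odot> c"
    using N(7)[of "(0, 1)"] N(7)[of "(1, 2)"] U(4,5) V(4,5) unfolding abc by simp_all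
  have up: "u \<Zsemi> p \<in> mors C A P" "v \<Zsemi> p \<in> mors C A P" "u \<Zsemi> q \<in> mors C A P" "v \<Zsemi> q \<in> mors C A P"
    using s by (simp_all add: mors_def)
  obtain \<alpha> where \<alpha>: "\<alpha> \<in> cells C (u \<Zsemi> p) (v \<Zsemi> p)" "\<alpha> \<lhd> csrc C d = a" "\<alpha> \<lhd> ctgt C d = b"
    using cell_ump[OF up(1,2) a b n1] by blast
  obtain \<beta> where \<beta>: "\<beta> \<in> cells C (u \<Zsemi> q) (v \<Zsemi> q)" "\<beta> \<lhd> csrc C d = b" "\<beta> \<lhd> ctgt C d = c"
    using cell_ump[OF up(3,4) b' c n2] by blast
  have "\<alpha> \<in> carr (hom C A P)" "\<beta> \<in> carr (hom C A P)"
    using \<alpha>(1) \<beta>(1) up by (auto simp: cells_def carr_hom mors_def)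
  then have "\<exists>!\<chi>. \<chi> \<in> carr (hom C A Q) \<and> \<chi> \<lhd> p = \<alpha> \<and> \<chi> \<lhd> q = \<beta>"
    using \<alpha>(3) \<beta>(2) by (intro pair_cell_ex1) simp_all
  then obtain \<chi> where \<chi>: "\<chi> \<in> carr (hom C A Q)" "\<chi> \<lhd> p = \<alpha>" "\<chi> \<lhd> q = \<beta>" by blast
  have \<chi>e: "csrc C (\<chi> \<lhd> p) = u \<Zsemi> p" "csrc C (\<chi> \<lhd> q) = u \<Zsemi> q" "ctgt C (\<chi> \<lhd> p) = v \<Zsemi> p" "ctgt C (\<chi> \<lhd> q) = v \<Zsemi> q"
    unfolding \<chi>(2,3) using \<alpha>(1) \<beta>(1) by (simp_all add: cells_def)
  have \<chi>m: "\<chi> \<in> cell C" "src C (csrc C \<chi>) = A" "tgt C (csrc C \<chi>) = Q" using \<chi>(1) by (auto simp: carr_hom)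
  \<comment> \<open>The pullback property leaves the ends of \<chi> open; they are determined by
    their composites with \<open>p\<close> and \<open>q\<close>.\<close>
  have "csrc C \<chi> = u"
    by (rule pair_eqI[of _ A]) (use \<chi>m \<chi>e(1,2) u in \<open>simp_all add: mors_def\<close>)
  moreover have "ctgt C \<chi> = v"
    by (rule pair_eqI[of _ A]) (use \<chi>m \<chi>e(3,4) v in \<open>simp_all add: mors_def\<close>)
  ultimately have \<chi>s: "csrc C \<chi> = u" "ctgt C \<chi> = v" by simp_all
  have cc: "nc (fwhisk ev2 (pre2 C \<psi> X)) 0 = (\<psi> \<lhd> p) \<lhd> csrc C d"
      "nc (fwhisk ev2 (pre2 C \<psi> X)) 1 = (\<psi> \<lhd> p) \<lhd> ctgt C d"
      "nc (fwhisk ev2 (pre2 C \<psi> X)) 1 = (\<psi> \<lhd> q) \<lhd> csrc C d"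
      "nc (fwhisk ev2 (pre2 C \<psi> X)) 2 = (\<psi> \<lhd> q) \<lhd> ctgt C d"
    if "\<psi> \<in> carr (hom C A Q)" for \<psi>
    using that ev2(2,7-9) pq_eq by (auto simp: fwhisk_simps carr_hom mors_def whisk_r_cmp[symmetric])
  have nt: "is_ntrans (fwhisk ev2 (pre2 C \<psi> X))" if "\<psi> \<in> carr (hom C A Q)" for \<psi>
    using that ev2(1-3) by (intro is_ntrans_fwhisk is_ntrans_pre2) (auto simp: carr_hom category_ord_cat)
  have "fwhisk ev2 (pre2 C \<chi> X) = \<nu>"
  proof (rule ntrans_eqI[OF nt[OF \<chi>(1)] \<nu>(1)])
    show "nsrc (fwhisk ev2 (pre2 C \<chi> X)) = nsrc \<nu>" "ntgt (fwhisk ev2 (pre2 C \<chi> X)) = ntgt \<nu>"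
      using u v by (simp_all add: fwhisk_simps \<chi>s)
    fix j assume "j \<in> cobj (fdom (nsrc (fwhisk ev2 (pre2 C \<chi> X))))"
    then have "j = 0 \<or> j = 1 \<or> j = 2" using ev2(2) by (auto simp: fwhisk_simps fcmp_simps)
    then show "nc (fwhisk ev2 (pre2 C \<chi> X)) j = nc \<nu> j"
      using cc[OF \<chi>(1)] \<alpha> \<beta> unfolding \<chi>(2,3) abc by auto
  qed
  moreover have "\<psi> = \<chi>" if \<psi>: "\<psi> \<in> carr (hom C A Q)" "fwhisk ev2 (pre2 C \<psi> X) = \<nu>" for \<psi>
  proof -
    have "nsrc (fwhisk ev2 (pre2 C \<psi> X)) = nsrc \<nu>" "ntgt (fwhisk ev2 (pre2 C \<psi> X)) = ntgt \<nu>"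
      unfolding \<psi>(2) by simp_all
    then have "fcmp ev2 (pre C (csrc C \<psi>) X) = fcmp ev2 (pre C u X)"
      "fcmp ev2 (pre C (ctgt C \<psi>) X) = fcmp ev2 (pre C v X)"
      using u v by (simp_all add: fwhisk_simps)
    then have \<psi>s: "csrc C \<psi> = u" "ctgt C \<psi> = v"
      using \<psi>(1) u(1) v(1) by (auto intro!: inj simp: carr_hom mors_def)
    have \<psi>c: "\<psi> \<in> cell C" using \<psi>(1) by (simp add: carr_hom)
    have "\<psi> \<lhd> p = \<alpha>"
      by (rule cell_eqI[OF _ \<alpha>(1) up(1)])
         (use \<psi>s \<psi>c s cc(1,2)[OF \<psi>(1)] \<alpha>(2,3) in \<open>auto simp: cells_def \<psi>(2) abc\<close>)
    moreover have "\<psi> \<lhd> q = \<beta>"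
      by (rule cell_eqI[OF _ \<beta>(1) up(3)])
         (use \<psi>s \<psi>c s cc(3,4)[OF \<psi>(1)] \<beta>(2,3) in \<open>auto simp: cells_def \<psi>(2) abc\<close>)
    ultimately show ?thesis using pair_cell_eqI[OF \<psi>(1) \<chi>(1)] \<chi> by simp
  qed
  ultimately show ?thesis using \<chi>(1) by blast
qed

lemma is_cotensor_ev2: "is_cotensor C (ord_cat 2) X Q ev2"
  unfolding is_cotensor_def
proof (intro conjI ballI)
  fix A assume A: "A \<in> obj C"
  let ?T = "cotensor_functor C (ord_cat 2) X Q ev2 A"
  have T: "is_functor ?T"
    using ev2 A by (intro is_functor_cotensor_functor) (simp_all add: category_ord_cat)
  have s: "fdom ?T = hom C A Q" "cobj (fcod ?T) = {F. is_functor F \<and> fdom F = ord_cat 2 \<and> fcod F = hom C A X}"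
    "carr (fcod ?T) = {\<nu>. is_ntrans \<nu> \<and> fdom (nsrc \<nu>) = ord_cat 2 \<and> fcod (nsrc \<nu>) = hom C A X}"
    by (simp_all add: cotensor_functor_def Fun_def)
  have o: "fo ?T u = fcmp ev2 (pre C u X)" if "u \<in> mors C A Q" for u
    using that by (simp add: cotensor_functor_def)
  have a: "fa ?T \<phi> = fwhisk ev2 (pre2 C \<phi> X)" if "\<phi> \<in> carr (hom C A Q)" for \<phi>
    using that by (simp add: cotensor_functor_def)
  show "cat_iso ?T"
  proof (rule cat_isoI[OF T])
    show "category (fdom ?T)" using A by (simp add: s hom_category)
    show "bij_betw (fo ?T) (cobj (fdom ?T)) (cobj (fcod ?T))"
      by (rule bij_betw_ex1I) (use is_functorD(1)[OF T] ev2_mor_ex1 o in \<open>auto simp: s cong: conj_cong\<close>)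
    show "bij_betw (fa ?T) (carr (fdom ?T)) (carr (fcod ?T))"
      by (rule bij_betw_ex1I) (use is_functorD(2)[OF T] ev2_cell_ex1 a in \<open>auto simp: s cong: conj_cong\<close>)
  qed
qed (use ev2 in simp_all)

end

text \<open>A hom-category into the terminal object has a single arrow, so every morphism to it is
  an isofibration, and agreement over it is no condition: the pullback over it is a product. This
  supplies the product in which the nerve's isofibration condition is stated.\<close>

lemma (in two_category) ex_product:
  assumes "pita C" "X \<in> obj C" "Y \<in> obj C"
  shows "\<exists>P p q. strict_product C X Y P p q"
proof -
  obtain T where T: "T \<in> obj C" "\<And>A. A \<in> obj C \<Longrightarrow> one_morphism_category (hom C A T)"
    using assms(1) unfolding pita_def strict_terminal_def by blast
  have ex: "\<exists>!m. m \<in> carr (hom C A T)" if "A \<in> obj C" for A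
    using T(2)[OF that] unfolding one_morphism_category_def by blast
  have exm: "\<exists>f. f \<in> mors C A T" if A: "A \<in> obj C" for A
  proof -
    obtain m where "m \<in> carr (hom C A T)" using ex[OF A] by blast
    then have "csrc C m \<in> mors C A T" by (auto simp: carr_hom mors_def)
    then show ?thesis by blast
  qed
  \<comment> \<open>Terminality is given as uniqueness of 2-cells; uniqueness of morphisms follows
    by comparing identity 2-cells.\<close>
  have eqm: "f = g" if "f \<in> mors C A T" "g \<in> mors C A T" for f g A
  proof -
    have "idc C f \<in> carr (hom C A T)" "idc C g \<in> carr (hom C A T)"
      using that by (simp_all add: carr_hom mors_def)
    moreover have "A \<in> obj C" using that by (auto simp: mors_def)
    ultimately have "idc C f = idc C g" using ex by blast
    then have "csrc C (idc C f) = csrc C (idc C g)" by simp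
    then show ?thesis using that by (simp add: mors_def)
  qed
  obtain f where f: "f \<in> mors C X T" using exm assms by blast
  obtain g where g: "g \<in> mors C Y T" using exm assms by blast
  have s: "f \<in> mor C" "src C f = X" "tgt C f = T" "g \<in> mor C" "src C g = Y" "tgt C g = T"
    using f g by (auto simp: mors_def)
  have "isofibration C f"
    unfolding isofibration_def cat_isofibration_def
  proof (intro conjI ballI allI impI)
    fix A u m assume A: "A \<in> obj C" and u: "u \<in> cobj (fdom (post C A f))"
      and m: "iso_arr (fcod (post C A f)) m \<and> cdom (fcod (post C A f)) m = fo (post C A f) u"
    have u': "u \<in> mors C A X" and i: "idc C u \<in> carr (hom C A X)" using u s by (simp_all add: carr_hom mors_def)
    have "idc C u \<lhd> f \<in> carr (hom C A T)" "m \<in> carr (hom C A T)"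
      using u' s m by (auto simp: carr_hom mors_def iso_arr_def is_inverse_hom)
    then have "idc C u \<lhd> f = m" using ex[OF A] by blast
    then show "\<exists>l. iso_arr (fdom (post C A f)) l \<and> cdom (fdom (post C A f)) l = u \<and> fa (post C A f) l = m"
      using iso_idc[OF u'] u' i s by (intro exI[of _ "idc C u"]) (simp add: mors_def)
  qed (use s in simp)
  then obtain p q where pq: "strict_pullback C p q f g"
    using assms(1) s unfolding pita_def by metis
  note D = strict_pullbackD[OF pq]
  have "cat_pullback (post C B f) (post C B g) = cat_prod (hom C B X) (hom C B Y)" for B
  proof -
    have o: "fo (post C B f) x = fo (post C B g) y" if "x \<in> mors C B X" "y \<in> mors C B Y" for x y
      using that s by (auto intro!: eqm[of _ B] simp: mors_def)
    have a: "fa (post C B f) x = fa (post C B g) y" if "x \<in> carr (hom C B X)" "y \<in> carr (hom C B Y)" for x y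
    proof -
      have "B \<in> obj C" using that by (auto simp: carr_hom)
      moreover have "fa (post C B f) x \<in> carr (hom C B T)" "fa (post C B g) y \<in> carr (hom C B T)"
        using that s by (auto simp: carr_hom)
      ultimately show ?thesis using ex by blast
    qed
    have "{(x, y). x \<in> mors C B X \<and> y \<in> mors C B Y \<and> fo (post C B f) x = fo (post C B g) y} = mors C B X \<times> mors C B Y"
      using o by auto
    moreover have "{(x, y). x \<in> carr (hom C B X) \<and> y \<in> carr (hom C B Y) \<and> fa (post C B f) x = fa (post C B g) y}
        = carr (hom C B X) \<times> carr (hom C B Y)"
      using a by auto
    ultimately show ?thesis using s by (simp add: cat_pullback_def cat_prod_def)
  qed
  then have "strict_product C X Y (src C p) p q"
    using pq s unfolding strict_product_def strict_pullback_def by simp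
  then show ?thesis by blast
qed

section \<open>Cores\<close>

context two_category
begin

lemma arrowwise_isoD:
  assumes "arrowwise_iso C f" "\<alpha> \<in> cell C" "tgt C (csrc C \<alpha>) = src C f"
  shows "iso_arr (hom C (src C (csrc C \<alpha>)) (tgt C f)) (\<alpha> \<lhd> f)"
  using assms unfolding arrowwise_iso_def by (simp add: carr_hom)

lemma arrowwise_isoI:
  assumes "f \<in> mor C"
    and "\<And>\<alpha>. \<lbrakk>\<alpha> \<in> cell C; tgt C (csrc C \<alpha>) = src C f\<rbrakk>
      \<Longrightarrow> iso_arr (hom C (src C (csrc C \<alpha>)) (tgt C f)) (\<alpha> \<lhd> f)"
  shows "arrowwise_iso C f"
  using assms unfolding arrowwise_iso_def by (auto simp: carr_hom)

lemma arrowwise_iso_cmp_right: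
  assumes "arrowwise_iso C i" "f \<in> mor C" "tgt C i = src C f"
  shows "arrowwise_iso C (i \<Zsemi> f)"
proof (rule arrowwise_isoI)
  have i: "i \<in> mor C" using assms by (simp add: arrowwise_iso_def)
  then show "i \<Zsemi> f \<in> mor C" using assms by simp
  fix \<alpha> assume \<alpha>: "\<alpha> \<in> cell C" "tgt C (csrc C \<alpha>) = src C (i \<Zsemi> f)"
  then have \<alpha>': "tgt C (csrc C \<alpha>) = src C i" using i assms by simp
  from post_iso_arr[of _ f, OF arrowwise_isoD[OF assms(1) \<alpha>(1) \<alpha>', unfolded assms(3)] assms(2)]
  show "iso_arr (hom C (src C (csrc C \<alpha>)) (tgt C (i \<Zsemi> f))) (\<alpha> \<lhd> (i \<Zsemi> f))"
    using \<alpha> \<alpha>' i assms by (simp add: whisk_r_cmp)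
qed

lemma arrowwise_iso_cmp_left:
  assumes "arrowwise_iso C i" "u \<in> mor C" "tgt C u = src C i"
  shows "arrowwise_iso C (u \<Zsemi> i)"
proof (rule arrowwise_isoI)
  have i: "i \<in> mor C" using assms by (simp add: arrowwise_iso_def)
  then show "u \<Zsemi> i \<in> mor C" using assms by simp
  fix \<alpha> assume \<alpha>: "\<alpha> \<in> cell C" "tgt C (csrc C \<alpha>) = src C (u \<Zsemi> i)"
  then show "iso_arr (hom C (src C (csrc C \<alpha>)) (tgt C (u \<Zsemi> i))) (\<alpha> \<lhd> (u \<Zsemi> i))"
    using arrowwise_isoD[OF assms(1), of "\<alpha> \<lhd> u"] i assms by (simp add: whisk_r_cmp)
qed

lemma arrowwise_iso_groupoid:
  assumes "groupoid_obj C A" "f \<in> mors C A X"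
  shows "arrowwise_iso C f"
proof (rule arrowwise_isoI)
  fix \<alpha> assume \<alpha>: "\<alpha> \<in> cell C" "tgt C (csrc C \<alpha>) = src C f"
  then have "\<alpha> \<in> carr (hom C (src C (csrc C \<alpha>)) A)" "src C (csrc C \<alpha>) \<in> obj C"
    using assms by (auto simp: carr_hom mors_def)
  then have "iso_arr (hom C (src C (csrc C \<alpha>)) A) \<alpha>"
    using assms(1) unfolding groupoid_obj_def groupoid_def by blast
  then show "iso_arr (hom C (src C (csrc C \<alpha>)) (tgt C f)) (\<alpha> \<lhd> f)"
    using post_iso_arr[of "src C (csrc C \<alpha>)" f \<alpha>] assms(2) \<alpha> by (simp add: mors_def)
qed (use assms in \<open>simp add: mors_def\<close>)

text \<open>Interchanging \<alpha> with \<chi> gives a square between the whiskerings of \<alpha>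
  with the two ends of \<chi>. Its other two sides are whiskerings of the invertible \<chi>, so
  \<open>iso_conj\<close> applies.\<close>

lemma arrowwise_iso_transfer:
  assumes \<chi>: "iso_arr (hom C A X) \<chi>" and u: "arrowwise_iso C (csrc C \<chi>)"
  shows "arrowwise_iso C (ctgt C \<chi>)"
proof (rule arrowwise_isoI)
  have c: "\<chi> \<in> cell C" "src C (csrc C \<chi>) = A" "tgt C (csrc C \<chi>) = X" using \<chi> by (auto elim!: iso_homE)
  then show "ctgt C \<chi> \<in> mor C" by simp
  fix \<alpha> assume \<alpha>: "\<alpha> \<in> cell C" "tgt C (csrc C \<alpha>) = src C (ctgt C \<chi>)"
  then have \<alpha>A: "tgt C (csrc C \<alpha>) = A" using c by simp
  have iso: "iso_arr (hom C (src C (csrc C \<alpha>)) X) (csrc C \<alpha> \<rhd> \<chi>)"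
    "iso_arr (hom C (src C (csrc C \<alpha>)) X) (ctgt C \<alpha> \<rhd> \<chi>)"
    using pre_iso_arr[of "csrc C \<alpha>" X \<chi>] pre_iso_arr[of "ctgt C \<alpha>" X \<chi>] \<chi> \<alpha> \<alpha>A c mor_obj(2)[of "csrc C \<chi>"]
    by simp_all
  have "iso_arr (hom C (src C (csrc C \<alpha>)) X) (\<alpha> \<lhd> csrc C \<chi>)"
    using arrowwise_isoD[OF u \<alpha>(1)] c \<alpha>A by simp
  from iso_conj[OF _ _ iso _ _ _ this, of "\<alpha> \<lhd> ctgt C \<chi>"]
  show "iso_arr (hom C (src C (csrc C \<alpha>)) (tgt C (ctgt C \<chi>))) (\<alpha> \<lhd> ctgt C \<chi>)"
    using hcmp_whisk[OF \<alpha>(1) c(1)] c \<alpha>(1) \<alpha>A by simp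
qed

lemma core_mor_eqI:
  assumes "is_core C X K i" "u \<in> mors C A K" "v \<in> mors C A K" "u \<Zsemi> i = v \<Zsemi> i"
  shows "u = v"
proof -
  have "v \<Zsemi> i \<in> mors C A X" using assms is_coreD[OF assms(1)] by (simp add: mors_def)
  from is_core_ump(1)[OF assms(1) this is_core_ump(3)[OF assms(1,3)]] assms show ?thesis by blast
qed

lemma core_cell_eqI:
  assumes "is_core C X K i" "\<chi> \<in> carr (hom C A K)" "\<chi>' \<in> carr (hom C A K)" "\<chi> \<lhd> i = \<chi>' \<lhd> i"
  shows "\<chi> = \<chi>'"
proof -
  note D = is_coreD[OF assms(1)]
  have "csrc C \<chi>' \<in> mors C A K" "ctgt C \<chi>' \<in> mors C A K" using assms(3) by (auto simp: carr_hom mors_def)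
  then have "arrowwise_iso C (csrc C (\<chi>' \<lhd> i))" "arrowwise_iso C (ctgt C (\<chi>' \<lhd> i))"
    using is_core_ump(3)[OF assms(1)] assms(3) D by (auto simp: carr_hom)
  from is_core_ump(2)[OF assms(1) is_core_ump(4)[OF assms(1,3)] this] assms show ?thesis by blast
qed

text \<open>Composition with \<open>i\<close> makes \<chi> invertible, and the inverse is a 2-cell
  between morphisms that factor through \<open>i\<close>; it therefore lifts to the core. The
  objects of a nerve thus belong to the index set of the families of functors.\<close>

lemma core_groupoid:
  assumes "is_core C X K i"
  shows "groupoid_obj C K"
  unfolding groupoid_obj_def groupoid_def
proof (intro conjI ballI)
  note D = is_coreD[OF assms]
  show "K \<in> obj C" by (fact D)
  fix A assume A: "A \<in> obj C"
  then show "category (hom C A K)" using D by (intro hom_category)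
  fix \<chi> assume \<chi>: "\<chi> \<in> carr (hom C A K)"
  have c: "\<chi> \<in> cell C" "src C (csrc C \<chi>) = A" "tgt C (csrc C \<chi>) = K" using \<chi> by (auto simp: carr_hom)
  obtain b where b: "iso_arr (hom C A X) b" "csrc C b = ctgt C (\<chi> \<lhd> i)" "ctgt C b = csrc C (\<chi> \<lhd> i)"
    "(\<chi> \<lhd> i) \<odot> b = idc C (csrc C (\<chi> \<lhd> i))" "b \<odot> (\<chi> \<lhd> i) = idc C (ctgt C (\<chi> \<lhd> i))"
    by (rule iso_inv[OF is_core_ump(4)[OF assms \<chi>]])
  have "csrc C \<chi> \<in> mors C A K" "ctgt C \<chi> \<in> mors C A K" using c by (auto simp: mors_def)
  note aw = this[THEN is_core_ump(3)[OF assms]]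
  have s: "csrc C (\<chi> \<lhd> i) = csrc C \<chi> \<Zsemi> i" "ctgt C (\<chi> \<lhd> i) = ctgt C \<chi> \<Zsemi> i" using c D by simp_all
  obtain \<psi> where \<psi>: "\<psi> \<in> carr (hom C A K)" "\<psi> \<lhd> i = b"
    using is_core_ump(2)[OF assms b(1)] aw b(2,3) s by auto
  have \<psi>c: "\<psi> \<in> cell C" "src C (csrc C \<psi>) = A" "tgt C (csrc C \<psi>) = K" using \<psi> by (auto simp: carr_hom)
  have \<psi>s: "csrc C \<psi> \<Zsemi> i = ctgt C \<chi> \<Zsemi> i" "ctgt C \<psi> \<Zsemi> i = csrc C \<chi> \<Zsemi> i"
    using \<psi>c whisk_r_cell(2,3)[of i \<psi>] D b(2,3) s \<psi>(2) by auto
  have \<psi>t: "csrc C \<psi> = ctgt C \<chi>" "ctgt C \<psi> = csrc C \<chi>"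
    using \<psi>s \<psi>c c by (auto intro!: core_mor_eqI[OF assms, of _ A] simp: mors_def)
  have "\<chi> \<odot> \<psi> = idc C (csrc C \<chi>)" "\<psi> \<odot> \<chi> = idc C (ctgt C \<chi>)"
    by (rule core_cell_eqI[OF assms, of _ A];
        use \<psi>(2) \<psi>c \<psi>t c b s D in \<open>simp add: carr_hom whisk_r_vcmp\<close>)+
  then show "iso_arr (hom C A K) \<chi>"
    using \<psi>c \<psi>t c by (intro iso_homI[where b=\<psi>]) simp_all
qed

lemma core_map_ex:
  assumes "is_core C X K i" "is_core C Y L j" "f \<in> mors C X Y"
  obtains h where "h \<in> mors C K L" "h \<Zsemi> j = i \<Zsemi> f"
proof -
  note D = is_coreD[OF assms(1)]
  have "i \<Zsemi> f \<in> mors C K Y" "arrowwise_iso C (i \<Zsemi> f)"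
    using D assms(3) by (auto simp: mors_def intro: arrowwise_iso_cmp_right)
  from is_core_ump(1)[OF assms(2) this] that show ?thesis by blast
qed

end

section \<open>Nerves\<close>

lemma is_functor_delta1:
  assumes "a \<le> l" shows "is_functor (delta [a] l)"
  unfolding is_functor_def delta_def Let_def using assms by (auto simp: PiE_iff)

lemma is_functor_delta2:
  assumes "a \<le> b" "b \<le> l" shows "is_functor (delta [a, b] l)"
  unfolding is_functor_def delta_def Let_def using assms by (auto simp: PiE_iff le_Suc_eq)

lemma delta_simps:
  "fdom (delta [a] l) = ord_cat 0" "fcod (delta [a] l) = ord_cat l"
  "fo (delta [a] l) 0 = a" "fa (delta [a] l) (0, 0) = (a, a)"
  "fdom (delta [a, b] l) = ord_cat 1" "fcod (delta [a, b] l) = ord_cat l"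
  "fa (delta [a, b] l) (0, 1) = (a, b)"
  by (simp_all add: delta_def Let_def)

text \<open>All choices needed for a nerve of \<open>X\<close>. Besides the cores \<open>K0\<close>,
  \<open>K1\<close>, \<open>K2\<close> of \<open>X\<close>, of the arrow object \<open>P\<close> and
  of the pairs \<open>Q\<close>, these are \<open>s\<close>, which classifies the identity 2-cell,
  \<open>m\<close>, which classifies the composite of the universal pair, and the maps
  \<open>n0\<close>, \<open>n1\<close>, \<open>e\<close>, \<open>n01\<close>, \<open>n12\<close>,
  \<open>n02\<close> between cores that become source, target, identities, first arrow, second arrow
  and composite. \<open>Z\<close> is the product of \<open>K0\<close> with itself and
  \<open>h\<close> pairs \<open>n0\<close> with \<open>n1\<close>. Existence of such data is
  \<open>nerve_data_ex\<close>.\<close>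

locale nerve_data = composable_pairs C X P d p q
  for C :: "('o, 'a, 'c) two_cat" (structure) and X P d p q +
  fixes ev1 and K0 K1 K2 Z :: 'o and i0 i1 i2 s m n0 n1 e n01 n12 n02 z0 z1 h :: 'a
  assumes arrow_obj: "is_arrow_object C X P ev1" and d_eq: "d = fa ev1 (0, 1)"
    and core0: "is_core C X K0 i0" and core1: "is_core C P K1 i1" and core2: "is_core C Q K2 i2"
    and s: "s \<in> mors C X P" "s \<rhd> d = idc C (idm C X)"
    and m: "m \<in> mors C Q P" "m \<rhd> d = (p \<rhd> d) \<odot> (q \<rhd> d)"
    and n0: "n0 \<in> mors C K1 K0" "n0 \<Zsemi> i0 = i1 \<Zsemi> csrc C d"
    and n1: "n1 \<in> mors C K1 K0" "n1 \<Zsemi> i0 = i1 \<Zsemi> ctgt C d"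
    and e: "e \<in> mors C K0 K1" "e \<Zsemi> i1 = i0 \<Zsemi> s"
    and n01: "n01 \<in> mors C K2 K1" "n01 \<Zsemi> i1 = i2 \<Zsemi> p"
    and n12: "n12 \<in> mors C K2 K1" "n12 \<Zsemi> i1 = i2 \<Zsemi> q"
    and n02: "n02 \<in> mors C K2 K1" "n02 \<Zsemi> i1 = i2 \<Zsemi> m"
    and prod: "strict_product C K0 K0 Z z0 z1"
    and h: "h \<in> mors C K1 Z" "h \<Zsemi> z0 = n0" "h \<Zsemi> z1 = n1"
begin

definition D :: "('o, 'a) icat" where
  "D = \<lparr>c0 = K0, c1 = K1, c2 = K2, pi0 = n0, pi1 = n1, ie = e, pi01 = n01, pi12 = n12, pi02 = n02\<rparr>"

lemma ty [simp]:
  "i0 \<in> mor C" "src C i0 = K0" "tgt C i0 = X" "i1 \<in> mor C" "src C i1 = K1" "tgt C i1 = P"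
  "i2 \<in> mor C" "src C i2 = K2" "tgt C i2 = Q"
  "K0 \<in> obj C" "K1 \<in> obj C" "K2 \<in> obj C"
  "s \<in> mor C" "src C s = X" "tgt C s = P" "m \<in> mor C" "src C m = Q" "tgt C m = P"
  "n0 \<in> mor C" "src C n0 = K1" "tgt C n0 = K0" "n1 \<in> mor C" "src C n1 = K1" "tgt C n1 = K0"
  "e \<in> mor C" "src C e = K0" "tgt C e = K1"
  "n01 \<in> mor C" "src C n01 = K2" "tgt C n01 = K1"
  "n12 \<in> mor C" "src C n12 = K2" "tgt C n12 = K1"
  "n02 \<in> mor C" "src C n02 = K2" "tgt C n02 = K1"
  "z0 \<in> mor C" "src C z0 = Z" "tgt C z0 = K0" "z1 \<in> mor C" "src C z1 = Z" "tgt C z1 = K0"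
  "h \<in> mor C" "src C h = K1" "tgt C h = Z"
  using is_coreD[OF core0] is_coreD[OF core1] is_coreD[OF core2] s m n0 n1 e n01 n12 n02 h
    strict_productD[OF prod]
  by (auto simp: mors_def)

lemma s_ends: "s \<Zsemi> csrc C d = idm C X" "s \<Zsemi> ctgt C d = idm C X"
  using whisk_l_cell(2,3)[of s d] s by auto

lemma m_ends: "m \<Zsemi> csrc C d = p \<Zsemi> csrc C d" "m \<Zsemi> ctgt C d = q \<Zsemi> ctgt C d"
  using whisk_l_cell(2,3)[of m d] m pq_eq by auto

text \<open>The defining equations of the structure maps on generalized elements \<open>u\<close>,
  bracketed so that a core inclusion can be traded for a map between the original objects.\<close>

lemma whisk_eqs:
  assumes "u \<in> mor C"
  shows "tgt C u = K1 \<Longrightarrow> (u \<Zsemi> n0) \<Zsemi> i0 = (u \<Zsemi> i1) \<Zsemi> csrc C d"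
    "tgt C u = K1 \<Longrightarrow> (u \<Zsemi> n1) \<Zsemi> i0 = (u \<Zsemi> i1) \<Zsemi> ctgt C d"
    "tgt C u = K0 \<Longrightarrow> (u \<Zsemi> e) \<Zsemi> i1 = (u \<Zsemi> i0) \<Zsemi> s"
    "tgt C u = K2 \<Longrightarrow> (u \<Zsemi> n01) \<Zsemi> i1 = (u \<Zsemi> i2) \<Zsemi> p"
    "tgt C u = K2 \<Longrightarrow> (u \<Zsemi> n12) \<Zsemi> i1 = (u \<Zsemi> i2) \<Zsemi> q"
    "tgt C u = K2 \<Longrightarrow> (u \<Zsemi> n02) \<Zsemi> i1 = (u \<Zsemi> i2) \<Zsemi> m"
  using assms n0 n1 e n01 n12 n02 by (simp_all add: cmp_assoc)

text \<open>Morphisms into the object \<open>K1\<close> of arrows are compared through the 2-cells into \<open>X\<close> that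
  they classify.\<close>

abbreviation V :: "'a \<Rightarrow> 'c" where
  "V u \<equiv> (u \<Zsemi> i1) \<rhd> d"

text \<open>Composition with a core inclusion is injective, and \<open>d\<close> is
  universal.\<close>

lemma V_eqI:
  assumes "u \<in> mors C A K1" "v \<in> mors C A K1" "V u = V v"
  shows "u = v"
proof (rule core_mor_eqI[OF core1 assms(1,2)])
  show "u \<Zsemi> i1 = v \<Zsemi> i1"
    by (rule mor_eqI[OF _ _ assms(3)]) (use assms in \<open>auto simp: mors_def\<close>)
qed

lemma V_ends:
  assumes "u \<in> mor C" "tgt C u = K1"
  shows "V u \<in> cell C" "csrc C (V u) = u \<Zsemi> n0 \<Zsemi> i0" "ctgt C (V u) = u \<Zsemi> n1 \<Zsemi> i0"
  using assms whisk_eqs(1,2)[of u] by simp_all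

lemma V_e:
  assumes "v \<in> mor C" "tgt C v = K0"
  shows "V (v \<Zsemi> e) = idc C (v \<Zsemi> i0)"
proof -
  have "V (v \<Zsemi> e) = (v \<Zsemi> i0) \<rhd> (s \<rhd> d)"
    using whisk_eqs(3)[OF assms] assms by (simp add: whisk_l_cmp)
  then show ?thesis using s assms by simp
qed

text \<open>With \<open>V_e\<close> this says that internal composition and internal identities
  become vertical composition and identity 2-cells. The unit and associativity axioms of the
  internal category thereby reduce to those of the hom-categories.\<close>

lemma V_comp:
  assumes "t \<in> mor C" "tgt C t = K2"
  shows "V (t \<Zsemi> n02) = V (t \<Zsemi> n01) \<odot> V (t \<Zsemi> n12)"
proof -
  have "V (t \<Zsemi> n02) = (t \<Zsemi> i2) \<rhd> (m \<rhd> d)"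
    using whisk_eqs(6)[OF assms] assms by (simp add: whisk_l_cmp)
  also have "\<dots> = ((t \<Zsemi> i2) \<rhd> (p \<rhd> d)) \<odot> ((t \<Zsemi> i2) \<rhd> (q \<rhd> d))"
    using m assms pq_eq by (simp add: whisk_l_vcmp)
  also have "\<dots> = V (t \<Zsemi> n01) \<odot> V (t \<Zsemi> n12)"
    using whisk_eqs(4,5)[OF assms] assms by (simp add: whisk_l_cmp)
  finally show ?thesis .
qed

section \<open>The nerve as an internal double category\<close>

lemma n01_n1: "n01 \<Zsemi> n1 = n12 \<Zsemi> n0"
proof (rule core_mor_eqI[OF core0])
  show "n01 \<Zsemi> n1 \<Zsemi> i0 = n12 \<Zsemi> n0 \<Zsemi> i0"
    using whisk_eqs(1)[of n12] whisk_eqs(2)[of n01] n01 n12 pq_eq by (simp add: cmp_assoc)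
qed (simp_all add: mors_def)

text \<open>A matching pair of morphisms into \<open>K1\<close> gives a morphism \<open>t\<close>
  into \<open>Q\<close> by the pullback property. Invertibility of a 2-cell into \<open>Q\<close>
  can be tested after \<open>p\<close> and \<open>q\<close>, where the composites of
  \<open>t\<close> factor through the arrow-wise iso \<open>i1\<close>; so \<open>t\<close> is an
  arrow-wise iso and lifts to \<open>K2\<close>. Uniqueness combines that of the core with that of
  the pullback.\<close>

lemma is_pullback_K2: "is_pullback (und C) n01 n12 n1 n0"
  unfolding is_pullback_def
proof (intro conjI ballI impI)
  fix A a b assume A: "A \<in> cobj (und C)" and a: "a \<in> chom (und C) A (cdom (und C) n1)"
    and b: "b \<in> chom (und C) A (cdom (und C) n0)" and ab: "a \<cdot>\<^bsub>und C\<^esub> n1 = b \<cdot>\<^bsub>und C\<^esub> n0"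
  have a': "a \<in> mor C" "src C a = A" "tgt C a = K1" and b': "b \<in> mor C" "src C b = A" "tgt C b = K1"
    and ab': "a \<Zsemi> n1 = b \<Zsemi> n0"
    using a b ab by (auto simp: chom_def)
  have "(a \<Zsemi> i1) \<Zsemi> ctgt C d = (b \<Zsemi> i1) \<Zsemi> csrc C d"
    using whisk_eqs(2)[of a] whisk_eqs(1)[of b] ab' a' b' by simp
  then obtain t where t: "t \<in> mors C A Q" "t \<Zsemi> p = a \<Zsemi> i1" "t \<Zsemi> q = b \<Zsemi> i1"
    using pair_ex1[of "a \<Zsemi> i1" A "b \<Zsemi> i1"] a' b' by (auto simp: mors_def)
  have ts: "t \<in> mor C" "src C t = A" "tgt C t = Q" using t by (auto simp: mors_def)
  have "arrowwise_iso C t"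
  proof (rule arrowwise_isoI)
    fix \<alpha> assume \<alpha>: "\<alpha> \<in> cell C" "tgt C (csrc C \<alpha>) = src C t"
    let ?B = "src C (csrc C \<alpha>)"
    have aw: "arrowwise_iso C (a \<Zsemi> i1)" "arrowwise_iso C (b \<Zsemi> i1)"
      using a' b' is_coreD(6)[OF core1] by (auto intro: arrowwise_iso_cmp_left)
    have "iso_arr (hom C ?B P) (\<alpha> \<lhd> (a \<Zsemi> i1))" "iso_arr (hom C ?B P) (\<alpha> \<lhd> (b \<Zsemi> i1))"
      using arrowwise_isoD[OF aw(1) \<alpha>(1)] arrowwise_isoD[OF aw(2) \<alpha>(1)] \<alpha>(2) a' b' ts by simp_all
    then have "iso_arr (hom C ?B P) ((\<alpha> \<lhd> t) \<lhd> p)" "iso_arr (hom C ?B P) ((\<alpha> \<lhd> t) \<lhd> q)"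
      using t(2,3)[symmetric] ts \<alpha> by (simp_all add: whisk_r_cmp)
    then show "iso_arr (hom C ?B (tgt C t)) (\<alpha> \<lhd> t)"
      using pair_cell_iso[of "\<alpha> \<lhd> t" ?B] ts \<alpha> by (simp add: carr_hom)
  qed (use ts in simp)
  then obtain t' where t': "t' \<in> mors C A K2" "t' \<Zsemi> i2 = t"
    using is_core_ump(1)[OF core2 t(1)] by blast
  have ts': "t' \<in> mor C" "src C t' = A" "tgt C t' = K2" using t' by (auto simp: mors_def)
  have e1: "t' \<Zsemi> n01 = a"
    by (rule core_mor_eqI[OF core1, of _ A]) (use whisk_eqs(4)[of t'] ts' a' t t' in \<open>simp_all add: mors_def\<close>)
  have e2: "t' \<Zsemi> n12 = b"
    by (rule core_mor_eqI[OF core1, of _ A]) (use whisk_eqs(5)[of t'] ts' b' t t' in \<open>simp_all add: mors_def\<close>)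
  have uniq: "w = t'" if w: "w \<in> mor C" "src C w = A" "tgt C w = K2" "w \<Zsemi> n01 = a" "w \<Zsemi> n12 = b" for w
  proof (rule core_mor_eqI[OF core2 _ t'(1)])
    show "w \<in> mors C A K2" using w by (simp add: mors_def)
    show "w \<Zsemi> i2 = t' \<Zsemi> i2"
    proof (rule pair_eqI[of _ A])
      show "w \<Zsemi> i2 \<Zsemi> p = t' \<Zsemi> i2 \<Zsemi> p" using whisk_eqs(4)[of w] w t t' by simp
      show "w \<Zsemi> i2 \<Zsemi> q = t' \<Zsemi> i2 \<Zsemi> q" using whisk_eqs(5)[of w] w t t' by simp
    qed (use w ts' in \<open>simp_all add: mors_def\<close>)
  qed
  show "\<exists>!t. t \<in> chom (und C) A (cdom (und C) n01) \<and> t \<cdot>\<^bsub>und C\<^esub> n01 = a \<and> t \<cdot>\<^bsub>und C\<^esub> n12 = b"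
  proof (rule ex1I[of _ t'])
    show "t' \<in> chom (und C) A (cdom (und C) n01) \<and> t' \<cdot>\<^bsub>und C\<^esub> n01 = a \<and> t' \<cdot>\<^bsub>und C\<^esub> n12 = b"
      using e1 e2 ts' by (simp add: chom_def)
    fix w assume "w \<in> chom (und C) A (cdom (und C) n01) \<and> w \<cdot>\<^bsub>und C\<^esub> n01 = a \<and> w \<cdot>\<^bsub>und C\<^esub> n12 = b"
    then show "w = t'" by (intro uniq) (simp_all add: chom_def)
  qed
qed (use n01_n1 in \<open>simp_all add: chom_def\<close>)

lemma internal_category_D: "internal_category (und C) D"
proof
  show "is_pullback (und C) (pi01 D) (pi12 D) (pi1 D) (pi0 D)"
    using is_pullback_K2 by (simp add: D_def)
  have "e \<Zsemi> n0 = idm C K0" "e \<Zsemi> n1 = idm C K0"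
    by (rule core_mor_eqI[OF core0, of _ K0];
        use whisk_eqs(1,2)[of e] e s_ends in \<open>simp add: mors_def cmp_assoc\<close>)+
  then show "ie D \<cdot>\<^bsub>und C\<^esub> pi0 D = cid (und C) (c0 D)" "ie D \<cdot>\<^bsub>und C\<^esub> pi1 D = cid (und C) (c0 D)"
    by (simp_all add: D_def)
  have "n02 \<Zsemi> n0 = n01 \<Zsemi> n0" "n02 \<Zsemi> n1 = n12 \<Zsemi> n1"
    by (rule core_mor_eqI[OF core0, of _ K2];
        use whisk_eqs(1,2)[of n02] whisk_eqs(1)[of n01] whisk_eqs(2)[of n12] n02 n01 n12 m_ends
        in \<open>simp add: mors_def cmp_assoc\<close>)+
  then show "pi02 D \<cdot>\<^bsub>und C\<^esub> pi0 D = pi01 D \<cdot>\<^bsub>und C\<^esub> pi0 D" "pi02 D \<cdot>\<^bsub>und C\<^esub> pi1 D = pi12 D \<cdot>\<^bsub>und C\<^esub> pi1 D"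
    by (simp_all add: D_def)
next
  fix t assume t: "t \<in> chom (und C) (c1 D) (c2 D)" "t \<cdot>\<^bsub>und C\<^esub> pi01 D = pi0 D \<cdot>\<^bsub>und C\<^esub> ie D"
    "t \<cdot>\<^bsub>und C\<^esub> pi12 D = cid (und C) (c1 D)"
  then have t': "t \<in> mor C" "src C t = K1" "tgt C t = K2" "t \<Zsemi> n01 = n0 \<Zsemi> e" "t \<Zsemi> n12 = idm C K1"
    by (auto simp: D_def chom_def)
  \<comment> \<open>\<open>V_comp\<close> writes the left side as a composite whose first factor is
    an identity 2-cell by \<open>V_e\<close>, so \<open>V\<close> takes the same value on both
    sides.\<close>
  have "t \<Zsemi> n02 = idm C K1"
    by (rule V_eqI[of _ K1])
       (use V_comp[of t] V_e[of n0] V_ends[of "idm C K1"] t' in \<open>simp_all add: mors_def\<close>)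
  then show "t \<cdot>\<^bsub>und C\<^esub> pi02 D = cid (und C) (c1 D)" by (simp add: D_def)
next
  fix t assume t: "t \<in> chom (und C) (c1 D) (c2 D)" "t \<cdot>\<^bsub>und C\<^esub> pi01 D = cid (und C) (c1 D)"
    "t \<cdot>\<^bsub>und C\<^esub> pi12 D = pi1 D \<cdot>\<^bsub>und C\<^esub> ie D"
  then have t': "t \<in> mor C" "src C t = K1" "tgt C t = K2" "t \<Zsemi> n01 = idm C K1" "t \<Zsemi> n12 = n1 \<Zsemi> e"
    by (auto simp: D_def chom_def)
  have "t \<Zsemi> n02 = idm C K1"
    by (rule V_eqI[of _ K1])
       (use V_comp[of t] V_e[of n1] V_ends[of "idm C K1"] t' in \<open>simp_all add: mors_def\<close>)
  then show "t \<cdot>\<^bsub>und C\<^esub> pi02 D = cid (und C) (c1 D)" by (simp add: D_def)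
next
  fix A a b u v
  assume "a \<in> chom (und C) A (c2 D)" "b \<in> chom (und C) A (c2 D)" "u \<in> chom (und C) A (c2 D)"
    "v \<in> chom (und C) A (c2 D)" "a \<cdot>\<^bsub>und C\<^esub> pi12 D = b \<cdot>\<^bsub>und C\<^esub> pi01 D"
    "u \<cdot>\<^bsub>und C\<^esub> pi01 D = a \<cdot>\<^bsub>und C\<^esub> pi02 D" "u \<cdot>\<^bsub>und C\<^esub> pi12 D = b \<cdot>\<^bsub>und C\<^esub> pi12 D"
    "v \<cdot>\<^bsub>und C\<^esub> pi01 D = a \<cdot>\<^bsub>und C\<^esub> pi01 D" "v \<cdot>\<^bsub>und C\<^esub> pi12 D = b \<cdot>\<^bsub>und C\<^esub> pi02 D"
  then have t: "a \<in> mor C" "src C a = A" "tgt C a = K2" "b \<in> mor C" "src C b = A" "tgt C b = K2"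
    "u \<in> mor C" "src C u = A" "tgt C u = K2" "v \<in> mor C" "src C v = A" "tgt C v = K2"
    and eq: "a \<Zsemi> n12 = b \<Zsemi> n01" "u \<Zsemi> n01 = a \<Zsemi> n02" "u \<Zsemi> n12 = b \<Zsemi> n12"
    "v \<Zsemi> n01 = a \<Zsemi> n01" "v \<Zsemi> n12 = b \<Zsemi> n02"
    by (auto simp: D_def chom_def)
  \<comment> \<open>Vertical composition is constrained only for composable 2-cells, so
    associativity needs the matching condition explicitly.\<close>
  have j: "ctgt C (V (w \<Zsemi> n01)) = csrc C (V (w \<Zsemi> n12))" if "w \<in> mor C" "tgt C w = K2" for w
    using that V_ends(3)[of "w \<Zsemi> n01"] V_ends(2)[of "w \<Zsemi> n12"] n01_n1 by (simp add: cmp_assoc)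
  have "V (u \<Zsemi> n02) = (V (a \<Zsemi> n01) \<odot> V (a \<Zsemi> n12)) \<odot> V (b \<Zsemi> n12)"
    using V_comp[of u] V_comp[of a] t eq by simp
  also have "\<dots> = V (a \<Zsemi> n01) \<odot> (V (a \<Zsemi> n12) \<odot> V (b \<Zsemi> n12))"
    by (rule vcmp_assoc) (use j[of a] j[of b] t eq in simp_all)
  also have "\<dots> = V (v \<Zsemi> n02)"
    using V_comp[of v] V_comp[of b] t eq by simp
  finally have "u \<Zsemi> n02 = v \<Zsemi> n02"
    using t by (intro V_eqI[of _ A]) (simp_all add: mors_def)
  then show "u \<cdot>\<^bsub>und C\<^esub> pi02 D = v \<cdot>\<^bsub>und C\<^esub> pi02 D" by (simp add: D_def)
qed (simp_all add: D_def chom_def)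

text \<open>An isomorphism \<open>w\<close> into the product is a pair of isomorphisms at the ends
  of the arrow classified by \<open>u\<close>. Transport in the arrow object lifts it to \<chi>, and
  the core property then lifts \<chi> to a 2-cell \<open>l\<close> into \<open>K1\<close>.\<close>

lemma isofibration_h: "isofibration C h"
  unfolding isofibration_def cat_isofibration_def
proof (intro conjI ballI allI impI)
  fix A u w assume A: "A \<in> obj C" and "u \<in> cobj (fdom (post C A h))"
    and "iso_arr (fcod (post C A h)) w \<and> cdom (fcod (post C A h)) w = fo (post C A h) u"
  then have u: "u \<in> mor C" "src C u = A" "tgt C u = K1"
    and w: "iso_arr (hom C A Z) w" "csrc C w = u \<Zsemi> h"
    by (auto simp: mors_def)
  have wc: "w \<in> cell C" "src C (csrc C w) = A" "tgt C (csrc C w) = Z" using w by (auto elim!: iso_homE)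
  define a b where "a = w \<lhd> z0" and "b = w \<lhd> z1"
  have iab: "iso_arr (hom C A X) (a \<lhd> i0)" "iso_arr (hom C A X) (b \<lhd> i0)"
    unfolding a_def b_def
    using w(1) A post_iso_arr[of A z0 w] post_iso_arr[of A z1 w]
      post_iso_arr[of A i0 "w \<lhd> z0"] post_iso_arr[of A i0 "w \<lhd> z1"] by simp_all
  have s: "csrc C (a \<lhd> i0) = (u \<Zsemi> i1) \<Zsemi> csrc C d" "csrc C (b \<lhd> i0) = (u \<Zsemi> i1) \<Zsemi> ctgt C d"
    unfolding a_def b_def using w(2) wc u h whisk_eqs(1,2)[of u] by (simp_all add: cmp_assoc)
  obtain v \<chi> where v: "v \<in> mors C A P" "\<chi> \<in> cells C (u \<Zsemi> i1) v" "\<chi> \<lhd> csrc C d = a \<lhd> i0"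
    "\<chi> \<lhd> ctgt C d = b \<lhd> i0" "iso_arr (hom C A P) \<chi>"
    by (rule iso_transport[OF _ iab(1) s(1) iab(2) s(2)]) (use u in \<open>auto simp: mors_def\<close>)
  have \<chi>s: "\<chi> \<in> cell C" "csrc C \<chi> = u \<Zsemi> i1" "ctgt C \<chi> = v" using v by (auto simp: cells_def)
  \<comment> \<open>The core property asks for arrow-wise isos at both ends of \<chi>: its source
    factors through \<open>i1\<close>, and its target is isomorphic to the source.\<close>
  have aw: "arrowwise_iso C (csrc C \<chi>)"
    using \<chi>s u is_coreD(6)[OF core1] by (auto intro: arrowwise_iso_cmp_left)
  obtain l where l: "l \<in> carr (hom C A K1)" "l \<lhd> i1 = \<chi>"
    using is_core_ump(2)[OF core1 v(5) aw arrowwise_iso_transfer[OF v(5) aw]] by blast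
  have lc: "l \<in> cell C" "src C (csrc C l) = A" "tgt C (csrc C l) = K1" using l by (auto simp: carr_hom)
  have il: "iso_arr (hom C A K1) l"
    using core_groupoid[OF core1] A l unfolding groupoid_obj_def groupoid_def by blast
  have "csrc C l = u"
    by (rule core_mor_eqI[OF core1, of _ A])
       (use lc u \<chi>s whisk_r_cell(2)[of i1 l] l(2) in \<open>auto simp: mors_def\<close>)
  \<comment> \<open>That \<open>l\<close> lies over \<open>w\<close> is tested on the two
    projections of the product, and there after the core inclusion \<open>i0\<close>, where
    \<open>l\<close> has become \<chi>.\<close>
  have k0: "(l \<lhd> h) \<lhd> z0 = w \<lhd> z0"
  proof (rule core_cell_eqI[OF core0, of _ A])
    have "((l \<lhd> h) \<lhd> z0) \<lhd> i0 = l \<lhd> (n0 \<Zsemi> i0)"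
      using lc by (simp add: whisk_r_cmp h(2)[symmetric])
    also have "\<dots> = (l \<lhd> i1) \<lhd> csrc C d" using lc by (simp add: n0 whisk_r_cmp)
    finally show "((l \<lhd> h) \<lhd> z0) \<lhd> i0 = (w \<lhd> z0) \<lhd> i0" using l v by (simp add: a_def)
  qed (use lc wc in \<open>simp_all add: carr_hom\<close>)
  have k1: "(l \<lhd> h) \<lhd> z1 = w \<lhd> z1"
  proof (rule core_cell_eqI[OF core0, of _ A])
    have "((l \<lhd> h) \<lhd> z1) \<lhd> i0 = l \<lhd> (n1 \<Zsemi> i0)"
      using lc by (simp add: whisk_r_cmp h(3)[symmetric])
    also have "\<dots> = (l \<lhd> i1) \<lhd> ctgt C d" using lc by (simp add: n1 whisk_r_cmp)
    finally show "((l \<lhd> h) \<lhd> z1) \<lhd> i0 = (w \<lhd> z1) \<lhd> i0" using l v by (simp add: b_def)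
  qed (use lc wc in \<open>simp_all add: carr_hom\<close>)
  have "\<exists>!\<chi>. \<chi> \<in> carr (hom C A Z) \<and> \<chi> \<lhd> z0 = w \<lhd> z0 \<and> \<chi> \<lhd> z1 = w \<lhd> z1"
    by (rule strict_product_ump(2)[OF prod]) (use wc in \<open>simp_all add: carr_hom\<close>)
  moreover have "l \<lhd> h \<in> carr (hom C A Z)" "w \<in> carr (hom C A Z)" using lc wc by (simp_all add: carr_hom)
  ultimately have "l \<lhd> h = w" using k0 k1 by blast
  then show "\<exists>l. iso_arr (fdom (post C A h)) l \<and> cdom (fdom (post C A h)) l = u \<and> fa (post C A h) l = w"
    using il \<open>csrc C l = u\<close> l(1) by (intro exI[of _ l]) simp
qed simp

lemma internal_double_category_D: "internal_double_category C D"
  unfolding internal_double_category_def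
  using internal_category_D isofibration_h prod h by (auto simp: is_pairing_def D_def)

section \<open>Structure maps of the nerve as maps induced by functors of linear orders\<close>

lemma ev1: "is_functor ev1" "fdom ev1 = ord_cat 1" "fcod ev1 = hom C P X"
  using arrow_obj by (auto simp: is_cotensor_def)

lemma ev1_simps:
  "fa ev1 (0, 1) = d" "fo ev1 0 = csrc C d" "fo ev1 1 = ctgt C d" "j \<le> 1 \<Longrightarrow> fa ev1 (j, j) = idc C (fo ev1 j)"
  using functor_to_homD(5,6)[OF ev1, of 0 1] functor_to_homD(7)[OF ev1] by (simp_all add: d_eq)

lemma ev0: "is_functor (ev0 C X)" "fdom (ev0 C X) = ord_cat 0" "fcod (ev0 C X) = hom C X X"
  "fo (ev0 C X) 0 = idm C X" "fa (ev0 C X) (0, 0) = idc C (idm C X)"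
  by (auto simp: is_functor_def ev0_def PiE_iff mors_def carr_hom)

text \<open>Both functors have source \<open>ord_cat 1\<close>, so only their values at
  \<open>(0, 1)\<close> must agree. The case \<open>a = b\<close> includes the degeneracy
  \<open>delta [0, 0] 0\<close>.\<close>

lemma cotensor_map_ord1:
  assumes "a \<le> b" "b \<le> l" "is_functor ev'" "fdom ev' = ord_cat l" "fcod ev' = hom C R X"
    "t \<in> mors C R P" "t \<rhd> d = fa ev' (a, b)"
  shows "is_cotensor_map C X R ev' P ev1 (delta [a, b] l) t"
  unfolding is_cotensor_map_def
proof (intro conjI functor_eq_ord1)
  have t: "t \<in> mor C" "src C t = R" "tgt C t = P" using assms by (auto simp: mors_def)
  show "is_functor (fcmp ev1 (pre C t X))" "is_functor (fcmp (delta [a, b] l) ev')"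
    using ev1 t assms is_functor_delta2[OF assms(1,2)]
    by (auto intro!: is_functor_fcmp is_functor_pre simp: delta_simps category_ord_cat)
  show "fa (fcmp ev1 (pre C t X)) (0, 1) = fa (fcmp (delta [a, b] l) ev') (0, 1)"
    using ev1(2) ev1_simps(1) t assms delta_simps(5-7) by (simp add: fcmp_simps carr_hom)
qed (use assms ev1 in \<open>auto simp: fcmp_simps delta_simps mors_def\<close>)

text \<open>\<open>X\<close> with \<open>ev0\<close> stands for the cotensor with
  \<open>ord_cat 0\<close>, so the two vertex inclusions induce the two ends of
  \<open>d\<close>.\<close>

lemma cotensor_map_ord0:
  assumes "a \<le> 1"
  shows "is_cotensor_map C X P ev1 X (ev0 C X) (delta [a] 1) (fo ev1 a)"
  unfolding is_cotensor_map_def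
proof (intro conjI functor_eqI)
  have t: "fo ev1 a \<in> mor C" "src C (fo ev1 a) = P" "tgt C (fo ev1 a) = X"
    using functor_to_homD(1-3)[OF ev1] assms by auto
  then show "fo ev1 a \<in> mors C P X" by (simp add: mors_def)
  show "is_functor (fcmp (ev0 C X) (pre C (fo ev1 a) X))" "is_functor (fcmp (delta [a] 1) ev1)"
    using ev0 ev1 t is_functor_delta1[OF assms]
    by (auto intro!: is_functor_fcmp is_functor_pre simp: delta_simps category_ord_cat)
  show "fo (fcmp (ev0 C X) (pre C (fo ev1 a) X)) x = fo (fcmp (delta [a] 1) ev1) x"
    if "x \<in> cobj (fdom (fcmp (ev0 C X) (pre C (fo ev1 a) X)))" for x
    using that ev0 t by (simp add: fcmp_simps delta_simps mors_def)
  show "fa (fcmp (ev0 C X) (pre C (fo ev1 a) X)) x = fa (fcmp (delta [a] 1) ev1) x"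
    if "x \<in> carr (fdom (fcmp (ev0 C X) (pre C (fo ev1 a) X)))" for x
    using that ev0 t ev1_simps(4)[OF assms] by (auto simp: fcmp_simps delta_simps carr_hom)
qed (use ev0 ev1 functor_to_homD(1-3)[OF ev1] assms in \<open>auto simp: fcmp_simps delta_simps\<close>)

text \<open>The witnesses are the induced maps before cores are taken: \<open>p\<close>,
  \<open>q\<close> and \<open>m\<close> out of \<open>Q\<close>, the two ends of \<open>d\<close>
  out of \<open>P\<close>, and \<open>s\<close> out of \<open>X\<close>.\<close>

theorem is_nerve_via_D: "is_nerve_via C X D i0 P ev1 i1 Q ev2 i2"
  unfolding is_nerve_via_def is_nerve_map_def
proof (intro conjI)
  show "\<exists>t. is_cotensor_map C X Q ev2 P ev1 (delta [0, 1] 2) t \<and> is_core_map C i2 i1 t (pi01 D)"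
    using cotensor_map_ord1[OF _ _ ev2(1-3), of 0 1 p] ev2(4) n01
    by (intro exI[of _ p]) (auto simp: is_core_map_def D_def mors_def)
  show "\<exists>t. is_cotensor_map C X Q ev2 P ev1 (delta [1, 2] 2) t \<and> is_core_map C i2 i1 t (pi12 D)"
    using cotensor_map_ord1[OF _ _ ev2(1-3), of 1 2 q] ev2(5) n12
    by (intro exI[of _ q]) (auto simp: is_core_map_def D_def mors_def)
  show "\<exists>t. is_cotensor_map C X Q ev2 P ev1 (delta [0, 2] 2) t \<and> is_core_map C i2 i1 t (pi02 D)"
    using cotensor_map_ord1[OF _ _ ev2(1-3), of 0 2 m] ev2(6) n02 m
    by (intro exI[of _ m]) (auto simp: is_core_map_def D_def mors_def)
  show "\<exists>t. is_cotensor_map C X P ev1 X (ev0 C X) (delta [0] 1) t \<and> is_core_map C i1 i0 t (pi0 D)"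
    using cotensor_map_ord0[of 0] ev1_simps n0
    by (intro exI[of _ "csrc C d"]) (auto simp: is_core_map_def D_def mors_def)
  show "\<exists>t. is_cotensor_map C X P ev1 X (ev0 C X) (delta [1] 1) t \<and> is_core_map C i1 i0 t (pi1 D)"
    using cotensor_map_ord0[of 1] ev1_simps n1
    by (intro exI[of _ "ctgt C d"]) (auto simp: is_core_map_def D_def mors_def)
  show "\<exists>t. is_cotensor_map C X X (ev0 C X) P ev1 (delta [0, 0] 0) t \<and> is_core_map C i0 i1 t (ie D)"
    using cotensor_map_ord1[OF _ _ ev0(1-3), of 0 0 s] ev0 e s
    by (intro exI[of _ s]) (auto simp: is_core_map_def D_def mors_def)
qed (use internal_double_category_D arrow_obj is_cotensor_ev2 core0 core1 core2 in \<open>simp_all add: D_def\<close>)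

text \<open>The 2-cell of the tautological cocone. Whiskering it with a morphism \<open>u\<close>
  into \<open>K1\<close> gives \<open>V u\<close>, which is how the identities for \<open>V\<close>
  turn into the cocone equations.\<close>

abbreviation "univ_cell \<equiv> i1 \<rhd> d"

lemma univ_cell: "univ_cell \<in> cell C" "csrc C univ_cell = n0 \<Zsemi> i0" "ctgt C univ_cell = n1 \<Zsemi> i0"
  using n0 n1 by simp_all

section \<open>The original object as the strict quotient of its nerve\<close>

lemma strict_quotient_D:
  assumes "groupoidant C"
  shows "strict_quotient C D X (i0, univ_cell)"
proof -
  have "\<forall>X D i0 X1 ev1 i1 X2 ev2 i2. is_nerve_via C X D i0 X1 ev1 i1 X2 ev2 i2 \<longrightarrow>
        strict_quotient C D X (i0, i1 \<rhd> fa ev1 (0, 1))"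
    using assms unfolding groupoidant_def by blast
  then show ?thesis using is_nerve_via_D unfolding d_eq by blast
qed

lemma cocone_iso:
  assumes "groupoidant C" "Y \<in> obj C"
  shows "cat_iso (cocone_functor C D X (i0, univ_cell) Y)"
  using strict_quotient_D[OF assms(1)] assms(2) unfolding strict_quotient_def by blast

lemma cocone_functor_simps:
  "fdom (cocone_functor C D X (i0, univ_cell) Y) = hom C X Y"
  "fcod (cocone_functor C D X (i0, univ_cell) Y) = Cocone C D Y"
  "f \<in> mors C X Y \<Longrightarrow> fo (cocone_functor C D X (i0, univ_cell) Y) f = (i0 \<Zsemi> f, univ_cell \<lhd> f)"
  "\<alpha> \<in> carr (hom C X Y) \<Longrightarrow> fa (cocone_functor C D X (i0, univ_cell) Y) \<alpha> =
    ((i0 \<Zsemi> csrc C \<alpha>, univ_cell \<lhd> csrc C \<alpha>), i0 \<rhd> \<alpha>, (i0 \<Zsemi> ctgt C \<alpha>, univ_cell \<lhd> ctgt C \<alpha>))"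
  by (simp_all add: cocone_functor_def cocone_post_def)

lemma quotient_mor_eqI:
  assumes "groupoidant C" "f \<in> mors C X Y" "g \<in> mors C X Y"
    "i0 \<Zsemi> f = i0 \<Zsemi> g" "univ_cell \<lhd> f = univ_cell \<lhd> g"
  shows "f = g"
proof -
  have Y: "Y \<in> obj C" using assms by (auto simp: mors_def)
  have "inj_on (fo (cocone_functor C D X (i0, univ_cell) Y)) (mors C X Y)"
    using cat_isoD(2)[OF cocone_iso[OF assms(1) Y]] unfolding cocone_functor_simps hom_simps bij_betw_def
    by (rule conjunct1)
  moreover have "fo (cocone_functor C D X (i0, univ_cell) Y) f = fo (cocone_functor C D X (i0, univ_cell) Y) g"
    using assms(2-5) cocone_functor_simps(3) by simp
  ultimately show ?thesis using assms(2,3) by (rule inj_onD)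
qed

text \<open>An arrow of \<open>Cocone\<close> consists of its two ends and one 2-cell on
  \<open>K0\<close>. Once the ends are fixed, the comparison functor is therefore tested by
  whiskering with \<open>i0\<close>.\<close>

lemma quotient_cell_eqI:
  assumes "groupoidant C" "f \<in> mors C X Y" "\<alpha> \<in> cells C f g" "\<beta> \<in> cells C f g" "i0 \<rhd> \<alpha> = i0 \<rhd> \<beta>"
  shows "\<alpha> = \<beta>"
proof -
  have Y: "Y \<in> obj C" using assms by (auto simp: mors_def)
  have c: "\<alpha> \<in> carr (hom C X Y)" "\<beta> \<in> carr (hom C X Y)"
    using assms by (auto simp: carr_hom cells_def mors_def)
  have "inj_on (fa (cocone_functor C D X (i0, univ_cell) Y)) (carr (hom C X Y))"
    using cat_isoD(3)[OF cocone_iso[OF assms(1) Y]] unfolding cocone_functor_simps bij_betw_def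
    by (rule conjunct1)
  moreover have "fa (cocone_functor C D X (i0, univ_cell) Y) \<alpha> = fa (cocone_functor C D X (i0, univ_cell) Y) \<beta>"
    using assms(3-5) cocone_functor_simps(4) c by (simp add: cells_def)
  ultimately show ?thesis using c by (rule inj_onD)
qed

lemma quotient_mor_ex:
  assumes "groupoidant C" "Y \<in> obj C" "\<gamma> \<in> mors C K0 Y" "\<gamma>' \<in> cells C (n0 \<Zsemi> \<gamma>) (n1 \<Zsemi> \<gamma>)"
    "e \<rhd> \<gamma>' = idc C \<gamma>" "n02 \<rhd> \<gamma>' = (n01 \<rhd> \<gamma>') \<odot> (n12 \<rhd> \<gamma>')"
  obtains f where "f \<in> mors C X Y" "i0 \<Zsemi> f = \<gamma>" "univ_cell \<lhd> f = \<gamma>'"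
proof -
  have "(\<gamma>, \<gamma>') \<in> cobj (Cocone C D Y)"
    using assms by (simp add: Cocone_def is_cocone_def D_def)
  then obtain f where "f \<in> mors C X Y" "fo (cocone_functor C D X (i0, univ_cell) Y) f = (\<gamma>, \<gamma>')"
    using bij_betw_ex1D[OF cat_isoD(2)[OF cocone_iso[OF assms(1,2)]], of "(\<gamma>, \<gamma>')"]
    unfolding cocone_functor_simps(1,2) hom_simps by blast
  then show ?thesis using that cocone_functor_simps(3) by simp
qed

lemma quotient_cell_ex:
  assumes "groupoidant C" "f \<in> mors C X Y" "g \<in> mors C X Y" "a \<in> cells C (i0 \<Zsemi> f) (i0 \<Zsemi> g)"
    "(n0 \<rhd> a) \<odot> (univ_cell \<lhd> g) = (univ_cell \<lhd> f) \<odot> (n1 \<rhd> a)"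
  obtains \<theta> where "\<theta> \<in> cells C f g" "i0 \<rhd> \<theta> = a"
proof -
  have Y: "Y \<in> obj C" using assms by (auto simp: mors_def)
  note T = cocone_iso[OF assms(1) Y]
  have cc: "is_cocone C D Y (i0 \<Zsemi> f, univ_cell \<lhd> f)" if "f \<in> mors C X Y" for f
  proof -
    have "fo (cocone_functor C D X (i0, univ_cell) Y) f \<in> cobj (Cocone C D Y)"
      using is_functorD(1)[OF cat_isoD(1)[OF T], unfolded cocone_functor_simps(1,2) hom_simps, OF that] .
    then show ?thesis using cocone_functor_simps(3)[OF that] by (simp add: Cocone_def)
  qed
  let ?a = "((i0 \<Zsemi> f, univ_cell \<lhd> f), a, (i0 \<Zsemi> g, univ_cell \<lhd> g))"
  have "?a \<in> carr (Cocone C D Y)"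
    using assms cc[OF assms(2)] cc[OF assms(3)] by (simp add: Cocone_def D_def)
  then obtain \<theta> where \<theta>: "\<theta> \<in> carr (hom C X Y)" "fa (cocone_functor C D X (i0, univ_cell) Y) \<theta> = ?a"
    using bij_betw_ex1D[OF cat_isoD(3)[OF T], of ?a] unfolding cocone_functor_simps(1,2) by blast
  then have e: "i0 \<Zsemi> csrc C \<theta> = i0 \<Zsemi> f" "univ_cell \<lhd> csrc C \<theta> = univ_cell \<lhd> f"
    "i0 \<Zsemi> ctgt C \<theta> = i0 \<Zsemi> g" "univ_cell \<lhd> ctgt C \<theta> = univ_cell \<lhd> g" "i0 \<rhd> \<theta> = a"
    using cocone_functor_simps(4)[OF \<theta>(1)] by simp_all
  have m: "csrc C \<theta> \<in> mors C X Y" "ctgt C \<theta> \<in> mors C X Y" using \<theta>(1) by (auto simp: carr_hom mors_def)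
  \<comment> \<open>Surjectivity on arrows yields some \<theta> between unknown morphisms; its ends
    induce the same cocones as \<open>f\<close> and \<open>g\<close>, hence equal them.\<close>
  have "csrc C \<theta> = f" "ctgt C \<theta> = g"
    using quotient_mor_eqI[OF assms(1) m(1) assms(2) e(1,2)] quotient_mor_eqI[OF assms(1) m(2) assms(3) e(3,4)]
    by simp_all
  then show ?thesis using that e(5) \<theta>(1) by (auto simp: cells_def carr_hom)
qed

section \<open>Natural families indexed by the groupoids\<close>

lemma K_gpds: "K0 \<in> gpds C" "K1 \<in> gpds C" "K2 \<in> gpds C"
  using core_groupoid[OF core0] core_groupoid[OF core1] core_groupoid[OF core2] by (simp_all add: gpds_def)

lemma gpd_mor_factor:
  assumes "A \<in> gpds C" "u \<in> mors C A X"
  obtains v where "v \<in> mors C A K0" "u = v \<Zsemi> i0"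
proof -
  have "arrowwise_iso C u" using assms by (intro arrowwise_iso_groupoid) (auto simp: gpds_def)
  from is_core_ump(1)[OF core0 assms(2) this] that show ?thesis by blast
qed

text \<open>\<phi> is classified by a morphism from \<open>A\<close> to the arrow object. Since
  \<open>A\<close> is a groupoid, this morphism is an arrow-wise iso, so it lifts to
  \<open>K1\<close>.\<close>

lemma gpd_cell_factor:
  assumes "A \<in> gpds C" "\<phi> \<in> carr (hom C A X)"
  obtains w where "w \<in> mors C A K1" "\<phi> = w \<rhd> univ_cell"
proof -
  have \<phi>: "\<phi> \<in> cell C" "tgt C (csrc C \<phi>) = X" "src C (csrc C \<phi>) = A" using assms(2) by (auto simp: carr_hom)
  obtain u where u: "u \<in> mors C A P" "u \<rhd> d = \<phi>" by (rule mor_ex[OF \<phi>])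
  have "arrowwise_iso C u" using assms u(1) by (intro arrowwise_iso_groupoid) (auto simp: gpds_def)
  from is_core_ump(1)[OF core1 u(1) this] obtain w where w: "w \<in> mors C A K1" "w \<Zsemi> i1 = u" by blast
  have "w \<rhd> univ_cell = \<phi>" using u w by (simp add: whisk_l_cmp[symmetric] mors_def)
  with w that show ?thesis by blast
qed

text \<open>Two test objects decide: at \<open>K0\<close> the functors are evaluated on
  \<open>i0\<close>, at \<open>K1\<close> on the universal 2-cell. The results are the two
  components of the induced cocones.\<close>

lemma mor_eq_if_post_eq:
  assumes g: "groupoidant C" and f: "f \<in> mors C X Y" "f' \<in> mors C X Y"
    and eq: "\<And>A. A \<in> gpds C \<Longrightarrow> post C A f = post C A f'"
  shows "f = f'"
proof (rule quotient_mor_eqI[OF g f])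
  have s: "src C f = X" "src C f' = X" using f by (auto simp: mors_def)
  have "fo (post C K0 f) i0 = fo (post C K0 f') i0" using eq[OF K_gpds(1)] by simp
  then show "i0 \<Zsemi> f = i0 \<Zsemi> f'" using s by (simp add: mors_def)
  have "fa (post C K1 f) univ_cell = fa (post C K1 f') univ_cell" using eq[OF K_gpds(2)] by simp
  then show "univ_cell \<lhd> f = univ_cell \<lhd> f'" using s by (simp add: carr_hom)
qed

lemma cell_eq_if_post2_eq:
  assumes g: "groupoidant C" and f: "f \<in> mors C X Y" and \<alpha>: "\<alpha> \<in> cells C f f'" and \<beta>: "\<beta> \<in> cells C f f'"
    and eq: "\<And>A. A \<in> gpds C \<Longrightarrow> post2 C A \<alpha> = post2 C A \<beta>"
  shows "\<alpha> = \<beta>"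
proof (rule quotient_cell_eqI[OF g f \<alpha> \<beta>])
  have "nc (post2 C K0 \<alpha>) i0 = nc (post2 C K0 \<beta>) i0" using eq[OF K_gpds(1)] by simp
  then show "i0 \<rhd> \<alpha> = i0 \<rhd> \<beta>" using f \<alpha> \<beta> by (simp add: post2_def mors_def cells_def)
qed

lemma mor_of_natural_family:
  assumes g: "groupoidant C" and Y: "Y \<in> obj C"
    and F: "\<And>A. A \<in> gpds C \<Longrightarrow> is_functor (F A) \<and> fdom (F A) = hom C A X \<and> fcod (F A) = hom C A Y"
    and nat: "\<And>A A' u. \<lbrakk>A \<in> gpds C; A' \<in> gpds C; u \<in> mors C A' A\<rbrakk>
      \<Longrightarrow> fcmp (F A) (pre C u Y) = fcmp (pre C u X) (F A')"
  obtains f where "f \<in> mors C X Y" "\<And>A. A \<in> gpds C \<Longrightarrow> F A = post C A f"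
proof -
  have FD: "x \<in> mors C A X \<Longrightarrow> fo (F A) x \<in> mors C A Y"
    "\<phi> \<in> carr (hom C A X) \<Longrightarrow> fa (F A) \<phi> \<in> carr (hom C A Y)"
    "\<phi> \<in> carr (hom C A X) \<Longrightarrow> csrc C (fa (F A) \<phi>) = fo (F A) (csrc C \<phi>)"
    "\<phi> \<in> carr (hom C A X) \<Longrightarrow> ctgt C (fa (F A) \<phi>) = fo (F A) (ctgt C \<phi>)"
    "x \<in> mors C A X \<Longrightarrow> fa (F A) (idc C x) = idc C (fo (F A) x)"
    "\<lbrakk>\<phi> \<in> carr (hom C A X); \<psi> \<in> carr (hom C A X); ctgt C \<phi> = csrc C \<psi>\<rbrakk>
      \<Longrightarrow> fa (F A) (\<phi> \<odot> \<psi>) = fa (F A) \<phi> \<odot> fa (F A) \<psi>"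
    if "A \<in> gpds C" for A x \<phi> \<psi>
  proof -
    have "is_functor (F A)" and d: "fdom (F A) = hom C A X" "fcod (F A) = hom C A Y" using F[OF that] by auto
    note is_functorD[OF this(1), unfolded d, simplified]
    then show "x \<in> mors C A X \<Longrightarrow> fo (F A) x \<in> mors C A Y"
      "\<phi> \<in> carr (hom C A X) \<Longrightarrow> fa (F A) \<phi> \<in> carr (hom C A Y)"
      "\<phi> \<in> carr (hom C A X) \<Longrightarrow> csrc C (fa (F A) \<phi>) = fo (F A) (csrc C \<phi>)"
      "\<phi> \<in> carr (hom C A X) \<Longrightarrow> ctgt C (fa (F A) \<phi>) = fo (F A) (ctgt C \<phi>)"
      "x \<in> mors C A X \<Longrightarrow> fa (F A) (idc C x) = idc C (fo (F A) x)"
      "\<lbrakk>\<phi> \<in> carr (hom C A X); \<psi> \<in> carr (hom C A X); ctgt C \<phi> = csrc C \<psi>\<rbrakk>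
        \<Longrightarrow> fa (F A) (\<phi> \<odot> \<psi>) = fa (F A) \<phi> \<odot> fa (F A) \<psi>"
      by blast+
  qed
  \<comment> \<open>\<open>No\<close> and \<open>Na\<close> are the naturality equation evaluated at
    an object and at an arrow of a hom-category; they move precomposition with \<open>u\<close>
    through the family.\<close>
  have No: "fo (F A') (u \<Zsemi> x) = u \<Zsemi> fo (F A) x"
    if "A \<in> gpds C" "A' \<in> gpds C" "u \<in> mors C A' A" "x \<in> mors C A X" for A A' u x
  proof -
    have "fo (fcmp (F A) (pre C u Y)) x = fo (fcmp (pre C u X) (F A')) x" using nat[OF that(1-3)] by simp
    then show ?thesis using that F[OF that(1)] FD(1)[OF that(1,4)] by (simp add: fcmp_simps mors_def)
  qed
  have Na: "fa (F A') (u \<rhd> x) = u \<rhd> fa (F A) x"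
    if "A \<in> gpds C" "A' \<in> gpds C" "u \<in> mors C A' A" "x \<in> carr (hom C A X)" for A A' u x
  proof -
    have "fa (fcmp (F A) (pre C u Y)) x = fa (fcmp (pre C u X) (F A')) x" using nat[OF that(1-3)] by simp
    then show ?thesis using that F[OF that(1)] FD(2)[OF that(1,4)] by (simp add: fcmp_simps carr_hom mors_def)
  qed
  define \<gamma> \<gamma>' where "\<gamma> = fo (F K0) i0" and "\<gamma>' = fa (F K1) univ_cell"
  have i0m: "i0 \<in> mors C K0 X" and uc: "univ_cell \<in> carr (hom C K1 X)" by (simp_all add: mors_def carr_hom)
  have nm: "n0 \<in> mors C K1 K0" "n1 \<in> mors C K1 K0" "e \<in> mors C K0 K1"
    "n01 \<in> mors C K2 K1" "n12 \<in> mors C K2 K1" "n02 \<in> mors C K2 K1" by (simp_all add: mors_def)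
  have \<gamma>: "\<gamma> \<in> mors C K0 Y" unfolding \<gamma>_def using FD(1)[OF K_gpds(1) i0m] .
  have \<gamma>': "\<gamma>' \<in> cells C (n0 \<Zsemi> \<gamma>) (n1 \<Zsemi> \<gamma>)"
    using FD(2-4)[OF K_gpds(2) uc] No[OF K_gpds(1,2) nm(1) i0m] No[OF K_gpds(1,2) nm(2) i0m]
    unfolding \<gamma>_def \<gamma>'_def univ_cell(2,3) by (simp add: cells_def carr_hom)
  \<comment> \<open>With this, \<open>V_e\<close> and \<open>V_comp\<close> at identity morphisms
    become the cocone equations for \<open>univ_cell\<close> itself.\<close>
  have V: "V u = u \<rhd> univ_cell" if "u \<in> mor C" "tgt C u = K1" for u
    using that by (simp add: whisk_l_cmp)
  have "e \<rhd> univ_cell = idc C i0" using V_e[of "idm C K0"] V[of e] by simp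
  then have e\<gamma>: "e \<rhd> \<gamma>' = idc C \<gamma>"
    using Na[OF K_gpds(2,1) nm(3) uc] FD(5)[OF K_gpds(1) i0m] unfolding \<gamma>_def \<gamma>'_def by simp
  have "n02 \<rhd> univ_cell = (n01 \<rhd> univ_cell) \<odot> (n12 \<rhd> univ_cell)"
    using V_comp[of "idm C K2"] V[of n01] V[of n12] V[of n02] by simp
  \<comment> \<open>Functoriality of \<open>F K2\<close> may only be applied to a composable
    pair.\<close>
  moreover have "ctgt C (n01 \<rhd> univ_cell) = csrc C (n12 \<rhd> univ_cell)"
    using V_ends(3)[of n01] V_ends(2)[of n12] V[of n01] V[of n12] n01_n1 by simp
  \<comment> \<open>Naturality along the three maps from \<open>K2\<close> to \<open>K1\<close>
    turns each whiskering of \<gamma>' into a value of \<open>F K2\<close>, and this functor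
    preserves the composite.\<close>
  ultimately have "n02 \<rhd> \<gamma>' = (n01 \<rhd> \<gamma>') \<odot> (n12 \<rhd> \<gamma>')"
    using Na[OF K_gpds(2,3) nm(4) uc] Na[OF K_gpds(2,3) nm(5) uc] Na[OF K_gpds(2,3) nm(6) uc]
      FD(6)[OF K_gpds(3), of "n01 \<rhd> univ_cell" "n12 \<rhd> univ_cell"]
    unfolding \<gamma>'_def by (simp add: carr_hom)
  from quotient_mor_ex[OF g Y \<gamma> \<gamma>' e\<gamma> this]
  obtain f where f: "f \<in> mors C X Y" "i0 \<Zsemi> f = \<gamma>" "univ_cell \<lhd> f = \<gamma>'" .
  have fs: "f \<in> mor C" "src C f = X" "tgt C f = Y" using f by (auto simp: mors_def)
  have "F A = post C A f" if A: "A \<in> gpds C" for A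
  proof (rule functor_eqI)
    have Ao: "A \<in> obj C" using A by (simp add: gpds_def groupoid_obj_def)
    show "is_functor (F A)" "is_functor (post C A f)" "fdom (F A) = fdom (post C A f)" "fcod (F A) = fcod (post C A f)"
      using F[OF A] fs Ao by (simp_all add: is_functor_post)
    fix u assume "u \<in> cobj (fdom (F A))"
    then have u: "u \<in> mors C A X" using F[OF A] by simp
    obtain v where v: "v \<in> mors C A K0" "u = v \<Zsemi> i0" by (rule gpd_mor_factor[OF A u])
    have "fo (F A) u = v \<Zsemi> (i0 \<Zsemi> f)" unfolding v(2) using No[OF K_gpds(1) A v(1) i0m] f(2) by (simp add: \<gamma>_def)
    also have "\<dots> = u \<Zsemi> f" using v fs by (simp add: mors_def cmp_assoc)
    finally show "fo (F A) u = fo (post C A f) u" using u fs by simp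
  next
    fix \<phi> assume "\<phi> \<in> carr (fdom (F A))"
    then have \<phi>: "\<phi> \<in> carr (hom C A X)" using F[OF A] by simp
    obtain w where w: "w \<in> mors C A K1" "\<phi> = w \<rhd> univ_cell" by (rule gpd_cell_factor[OF A \<phi>])
    have "fa (F A) \<phi> = w \<rhd> (univ_cell \<lhd> f)"
      unfolding w(2) using Na[OF K_gpds(2) A w(1) uc] f(3) by (simp add: \<gamma>'_def)
    also have "\<dots> = \<phi> \<lhd> f" unfolding w(2) by (rule whisk_lr[symmetric]) (use w fs in \<open>simp_all add: mors_def\<close>)
    finally show "fa (F A) \<phi> = fa (post C A f) \<phi>" using \<phi> fs by simp
  qed
  with f(1) that show ?thesis by blast
qed

lemma cell_of_natural_family:
  assumes g: "groupoidant C" and f: "f \<in> mors C X Y" "f' \<in> mors C X Y"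
    and \<alpha>: "\<And>A. A \<in> gpds C \<Longrightarrow> is_ntrans (\<alpha> A) \<and> nsrc (\<alpha> A) = post C A f \<and> ntgt (\<alpha> A) = post C A f'"
    and nat: "\<And>A A' u. \<lbrakk>A \<in> gpds C; A' \<in> gpds C; u \<in> mors C A' A\<rbrakk>
      \<Longrightarrow> whiskf (\<alpha> A) (pre C u Y) = fwhisk (pre C u X) (\<alpha> A')"
  obtains \<theta> where "\<theta> \<in> cells C f f'" "\<And>A. A \<in> gpds C \<Longrightarrow> \<alpha> A = post2 C A \<theta>"
proof -
  have fs: "f \<in> mor C" "src C f = X" "tgt C f = Y" "f' \<in> mor C" "src C f' = X" "tgt C f' = Y"
    using f by (auto simp: mors_def)
  have c: "nc (\<alpha> A) x \<in> cells C (x \<Zsemi> f) (x \<Zsemi> f')" if "A \<in> gpds C" "x \<in> mors C A X" for A x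
    using is_ntransD(6)[of "\<alpha> A" x] \<alpha>[OF that(1)] that fs by (auto simp: chom_def cells_def carr_hom)
  have N: "nc (\<alpha> A') (u \<Zsemi> x) = u \<rhd> nc (\<alpha> A) x"
    if "A \<in> gpds C" "A' \<in> gpds C" "u \<in> mors C A' A" "x \<in> mors C A X" for A A' u x
  proof -
    have "nc (whiskf (\<alpha> A) (pre C u Y)) x = nc (fwhisk (pre C u X) (\<alpha> A')) x" using nat[OF that(1-3)] by simp
    moreover have "nc (\<alpha> A) x \<in> carr (hom C A Y)" using c[OF that(1,4)] that fs by (auto simp: cells_def carr_hom mors_def)
    ultimately show ?thesis using that \<alpha>[OF that(1)] fs by (simp add: whiskf_def fwhisk_simps mors_def)
  qed
  have i0m: "i0 \<in> mors C K0 X" and uc: "univ_cell \<in> carr (hom C K1 X)" by (simp_all add: mors_def carr_hom)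
  have nm: "n0 \<in> mors C K1 K0" "n1 \<in> mors C K1 K0" by (simp_all add: mors_def)
  define a where "a = nc (\<alpha> K0) i0"
  have a: "a \<in> cells C (i0 \<Zsemi> f) (i0 \<Zsemi> f')" unfolding a_def using c[OF K_gpds(1) i0m] .
  \<comment> \<open>Naturality of the transformation at \<open>K1\<close>, evaluated at the
    universal 2-cell. Naturality in the groupoid then moves \<open>n0\<close> and \<open>n1\<close>
    outside, which produces the equation for a morphism of cocones.\<close>
  have "(univ_cell \<lhd> f) \<odot> nc (\<alpha> K1) (n1 \<Zsemi> i0) = nc (\<alpha> K1) (n0 \<Zsemi> i0) \<odot> (univ_cell \<lhd> f')"
    using is_ntransD(7)[of "\<alpha> K1" univ_cell] \<alpha>[OF K_gpds(2)] uc fs univ_cell by simp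
  then have "(n0 \<rhd> a) \<odot> (univ_cell \<lhd> f') = (univ_cell \<lhd> f) \<odot> (n1 \<rhd> a)"
    using N[OF K_gpds(1,2) nm(1) i0m] N[OF K_gpds(1,2) nm(2) i0m] by (simp add: a_def)
  from quotient_cell_ex[OF g f a this]
  obtain \<theta> where \<theta>: "\<theta> \<in> cells C f f'" "i0 \<rhd> \<theta> = a" .
  have \<theta>s: "\<theta> \<in> cell C" "csrc C \<theta> = f" "ctgt C \<theta> = f'" using \<theta> by (auto simp: cells_def)
  have "\<alpha> A = post2 C A \<theta>" if A: "A \<in> gpds C" for A
  proof (rule ntrans_eqI)
    have Ao: "A \<in> obj C" using A by (simp add: gpds_def groupoid_obj_def)
    show "is_ntrans (\<alpha> A)" "is_ntrans (post2 C A \<theta>)" "nsrc (\<alpha> A) = nsrc (post2 C A \<theta>)" "ntgt (\<alpha> A) = ntgt (post2 C A \<theta>)"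
      using \<alpha>[OF A] \<theta>s is_ntrans_post2[OF \<theta>s(1) Ao] by (simp_all add: post2_def)
    fix u assume "u \<in> cobj (fdom (nsrc (\<alpha> A)))"
    then have u: "u \<in> mors C A X" using \<alpha>[OF A] fs by simp
    obtain v where v: "v \<in> mors C A K0" "u = v \<Zsemi> i0" by (rule gpd_mor_factor[OF A u])
    have "nc (\<alpha> A) u = v \<rhd> (i0 \<rhd> \<theta>)" unfolding v(2) using N[OF K_gpds(1) A v(1) i0m] \<theta>(2) by (simp add: a_def)
    also have "\<dots> = u \<rhd> \<theta>" using v \<theta>s fs by (simp add: whisk_l_cmp mors_def)
    finally show "nc (\<alpha> A) u = nc (post2 C A \<theta>) u" using u \<theta>s fs by (simp add: post2_def)
  qed
  with \<theta>(1) that show ?thesis by blast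
qed

end

lemma nerve_data_ex:
  fixes C :: "('o, 'a, 'c) two_cat" (structure)
  assumes g: "groupoidant C" and X: "X \<in> obj C"
  obtains P d p q ev1 K0 K1 K2 Z i0 i1 i2 s m n0 n1 e n01 n12 n02 z0 z1 h
  where "nerve_data C X P d p q ev1 K0 K1 K2 Z i0 i1 i2 s m n0 n1 e n01 n12 n02 z0 z1 h"
proof -
  have pita: "pita C" and cores: "\<And>X. X \<in> obj C \<Longrightarrow> \<exists>K i. is_core C X K i"
    using g unfolding groupoidant_def by blast+
  interpret two_category C using pita unfolding pita_def by blast
  obtain P ev1 where ao: "is_arrow_object C X P ev1" using pita X unfolding pita_def by blast
  define d where "d = fa ev1 (0, 1)"
  interpret arrow_object C X P d unfolding d_def using arrow_object_ump[OF ao] .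
  \<comment> \<open>The isofibration must be the first leg of the cospan, so the pullback is along
    the source morphism: the first arrow of a pair ends where the second begins.\<close>
  obtain p q where pq: "strict_pullback C p q (ctgt C d) (csrc C d)"
    using pita isofibration_d1 unfolding pita_def by (metis d_simps(1,4) d_cell(3))
  interpret composable_pairs C X P d p q by unfold_locales (fact pq)
  obtain K0 i0 where c0: "is_core C X K0 i0" using cores X by blast
  obtain K1 i1 where c1: "is_core C P K1 i1" using cores P_obj by blast
  obtain K2 i2 where c2: "is_core C Q K2 i2" using cores pq_simps by blast
  obtain s where s: "s \<in> mors C X P" "s \<rhd> d = idc C (idm C X)"
    by (rule mor_ex[of "idc C (idm C X)" X]) (use X in simp_all)
  have pqd: "(p \<rhd> d) \<odot> (q \<rhd> d) \<in> cell C" "csrc C ((p \<rhd> d) \<odot> (q \<rhd> d)) = p \<Zsemi> csrc C d"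
    using pq_eq by simp_all
  obtain m where m: "m \<in> mors C Q P" "m \<rhd> d = (p \<rhd> d) \<odot> (q \<rhd> d)"
    by (rule mor_ex[OF pqd(1), of Q]) (use pqd in simp_all)
  obtain n0 where n0: "n0 \<in> mors C K1 K0" "n0 \<Zsemi> i0 = i1 \<Zsemi> csrc C d"
    by (rule core_map_ex[OF c1 c0, of "csrc C d"]) (simp_all add: mors_def)
  obtain n1 where n1: "n1 \<in> mors C K1 K0" "n1 \<Zsemi> i0 = i1 \<Zsemi> ctgt C d"
    by (rule core_map_ex[OF c1 c0, of "ctgt C d"]) (simp_all add: mors_def)
  obtain e where e: "e \<in> mors C K0 K1" "e \<Zsemi> i1 = i0 \<Zsemi> s"
    by (rule core_map_ex[OF c0 c1 s(1)])
  obtain n01 where n01: "n01 \<in> mors C K2 K1" "n01 \<Zsemi> i1 = i2 \<Zsemi> p"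
    by (rule core_map_ex[OF c2 c1, of p]) (simp_all add: mors_def)
  obtain n12 where n12: "n12 \<in> mors C K2 K1" "n12 \<Zsemi> i1 = i2 \<Zsemi> q"
    by (rule core_map_ex[OF c2 c1, of q]) (simp_all add: mors_def)
  obtain n02 where n02: "n02 \<in> mors C K2 K1" "n02 \<Zsemi> i1 = i2 \<Zsemi> m"
    by (rule core_map_ex[OF c2 c1 m(1)])
  have K0: "K0 \<in> obj C" using is_coreD(2)[OF c0] .
  obtain Z z0 z1 where z: "strict_product C K0 K0 Z z0 z1" using ex_product[OF pita K0 K0] by blast
  obtain h where h: "h \<in> mors C K1 Z" "h \<Zsemi> z0 = n0" "h \<Zsemi> z1 = n1"
    using strict_product_ump(1)[OF z n0(1) n1(1)] by blast
  have "nerve_data C X P d p q ev1 K0 K1 K2 Z i0 i1 i2 s m n0 n1 e n01 n12 n02 z0 z1 h"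
    by unfold_locales (fact ao d_def c0 c1 c2 s m n0 n1 e n01 n12 n02 z h)+
  then show ?thesis by (rule that)
qed

section \<open>The restricted Yoneda 2-functor\<close>

lemma gpd_simps [simp]:
  "obj (gpd C) = obj C \<inter> gpds C" "mor (gpd C) = {f \<in> mor C. src C f \<in> gpds C \<and> tgt C f \<in> gpds C}"
  "cell (gpd C) = {\<alpha> \<in> cell C. src C (csrc C \<alpha>) \<in> gpds C \<and> tgt C (csrc C \<alpha>) \<in> gpds C}"
  "src (gpd C) = src C" "tgt (gpd C) = tgt C" "idm (gpd C) = idm C" "cmp (gpd C) = cmp C"
  "csrc (gpd C) = csrc C" "ctgt (gpd C) = ctgt C" "idc (gpd C) = idc C" "vcmp (gpd C) = vcmp C"
  "hcmp (gpd C) = hcmp C"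
  by (simp_all add: gpd_def full_sub_def)

lemma op2_simps [simp]:
  "obj (op2 C) = obj C" "mor (op2 C) = mor C" "cell (op2 C) = cell C"
  "src (op2 C) = tgt C" "tgt (op2 C) = src C" "idm (op2 C) = idm C" "cmp (op2 C) f g = cmp C g f"
  "csrc (op2 C) = csrc C" "ctgt (op2 C) = ctgt C" "idc (op2 C) = idc C" "vcmp (op2 C) = vcmp C"
  "hcmp (op2 C) \<alpha> \<beta> = hcmp C \<beta> \<alpha>"
  by (simp_all add: op2_def)

lemma Cat_simps [simp]:
  "obj Cat = {K. category K}" "mor Cat = {F. is_functor F \<and> category (fdom F) \<and> category (fcod F)}"
  "src Cat = fdom" "tgt Cat = fcod" "idm Cat = fid" "cmp Cat = fcmp"
  "cell Cat = {\<nu>. is_ntrans \<nu> \<and> category (fdom (nsrc \<nu>)) \<and> category (fcod (nsrc \<nu>))}"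
  "csrc Cat = nsrc" "ctgt Cat = ntgt" "idc Cat = nid" "vcmp Cat = nvcomp" "hcmp Cat = nhcomp"
  by (simp_all add: Cat_def)

text \<open>Whiskering in an abstract 2-category is horizontal composition with an identity 2-cell,
  whereas families of natural transformations are compared through \<open>fwhisk\<close> and
  \<open>whiskf\<close>. This lemma and the next one identify the two notions in \<open>Cat\<close>;
  the extra identity factor is removed by the identity law of the target category.\<close>

lemma nhcomp_nid_left:
  assumes "is_functor F" "is_ntrans \<nu>" "fcod F = fdom (nsrc \<nu>)" "category (fcod (nsrc \<nu>))"
  shows "nhcomp (nid F) \<nu> = fwhisk F \<nu>"
proof -
  note N = is_ntransD[OF assms(2)]
  have "fa (nsrc \<nu>) (cid (fcod F) (fo F x)) \<cdot>\<^bsub>fcod (nsrc \<nu>)\<^esub> nc \<nu> (fo F x) = nc \<nu> (fo F x)"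
    if "x \<in> cobj (fdom F)" for x
  proof -
    have x: "fo F x \<in> cobj (fdom (nsrc \<nu>))" using is_functorD(1)[OF assms(1) that] assms(3) by simp
    then show ?thesis
      using is_functorD(5)[OF N(1) x] N(6)[OF x] category.id_comp[OF assms(4), of "nc \<nu> (fo F x)"] assms(3)
      by (simp add: chom_def)
  qed
  then show ?thesis
    by (simp add: nhcomp_def nid_def fwhisk_def cong: restrict_cong)
qed

lemma nhcomp_nid_right:
  assumes "is_ntrans \<mu>" "is_functor G" "fcod (nsrc \<mu>) = fdom G" "category (fcod G)"
  shows "nhcomp \<mu> (nid G) = whiskf \<mu> G"
proof -
  note M = is_ntransD[OF assms(1)]
  have "fa G (nc \<mu> x) \<cdot>\<^bsub>fcod G\<^esub> nc (nid G) (fo (ntgt \<mu>) x) = fa G (nc \<mu> x)"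
    if "x \<in> cobj (fdom (nsrc \<mu>))" for x
  proof -
    have t: "fo (ntgt \<mu>) x \<in> cobj (fdom G)" using is_functorD(1)[OF M(2), of x] M(3,4) assms(3) that by simp
    have m: "nc \<mu> x \<in> carr (fdom G)" "ccod (fdom G) (nc \<mu> x) = fo (ntgt \<mu>) x"
      using M(6)[OF that] assms(3) by (simp_all add: chom_def)
    show ?thesis
      using t is_functorD(2,4)[OF assms(2) m(1)] m(2)
        category.comp_id[OF assms(4), of "fa G (nc \<mu> x)"] by (simp add: nid_def)
  qed
  then show ?thesis
    by (simp add: nhcomp_def whiskf_def nid_def[of G] cong: restrict_cong)
qed

context two_category
begin

lemma pre_idm: "A \<in> obj C \<Longrightarrow> pre C (idm C A) X = fid (hom C A X)"
  unfolding pre_def fid_def by (auto simp: mors_def carr_hom intro!: restrict_ext)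

lemma post_idm: "X \<in> obj C \<Longrightarrow> post C A (idm C X) = fid (hom C A X)"
  unfolding post_def fid_def by (auto simp: mors_def carr_hom intro!: restrict_ext)

lemma pre_cmp:
  "\<lbrakk>u \<in> mor C; v \<in> mor C; tgt C u = src C v\<rbrakk> \<Longrightarrow> pre C (u \<Zsemi> v) X = fcmp (pre C v X) (pre C u X)"
  unfolding pre_def fcmp_def by (auto simp: mors_def carr_hom cmp_assoc whisk_l_cmp intro!: restrict_ext)

lemma post_cmp:
  "\<lbrakk>f \<in> mor C; g \<in> mor C; tgt C f = src C g\<rbrakk> \<Longrightarrow> post C A (f \<Zsemi> g) = fcmp (post C A f) (post C A g)"
  unfolding post_def fcmp_def by (auto simp: mors_def carr_hom cmp_assoc whisk_r_cmp intro!: restrict_ext)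

lemma pre2_idc: "u \<in> mor C \<Longrightarrow> pre2 C (idc C u) X = nid (pre C u X)"
  unfolding pre2_def nid_def by (auto simp: mors_def intro!: restrict_ext)

lemma post2_idc: "f \<in> mor C \<Longrightarrow> post2 C A (idc C f) = nid (post C A f)"
  unfolding post2_def nid_def by (auto simp: mors_def intro!: restrict_ext)

lemma pre2_vcmp:
  assumes "\<alpha> \<in> cell C" "\<beta> \<in> cell C" "ctgt C \<alpha> = csrc C \<beta>"
  shows "pre2 C (\<alpha> \<odot> \<beta>) X = nvcomp (pre2 C \<alpha> X) (pre2 C \<beta> X)"
  using assms cell_mor(4)[OF assms(1)] unfolding pre2_def nvcomp_def
  by (auto simp: mors_def whisk_r_vcmp intro!: restrict_ext)

lemma post2_vcmp:
  assumes "\<alpha> \<in> cell C" "\<beta> \<in> cell C" "ctgt C \<alpha> = csrc C \<beta>"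
  shows "post2 C A (\<alpha> \<odot> \<beta>) = nvcomp (post2 C A \<alpha>) (post2 C A \<beta>)"
  using assms cell_mor(3)[OF assms(1)] unfolding post2_def nvcomp_def
  by (auto simp: mors_def whisk_l_vcmp intro!: restrict_ext)

text \<open>Precomposition is contravariant in 1-cells, hence the reversed order.
  \<open>nhcomp\<close> applies the source functor of its second factor first, which matches the
  second decomposition of \<open>hcmp_whisk\<close>; the covariant \<open>post2_hcmp\<close> uses
  the first.\<close>

lemma pre2_hcmp:
  assumes "\<alpha> \<in> cell C" "\<beta> \<in> cell C" "tgt C (csrc C \<alpha>) = src C (csrc C \<beta>)"
  shows "pre2 C (\<alpha> \<star> \<beta>) X = nhcomp (pre2 C \<beta> X) (pre2 C \<alpha> X)"
proof -
  have "(\<alpha> \<star> \<beta>) \<lhd> f = (csrc C \<alpha> \<rhd> (\<beta> \<lhd> f)) \<odot> (\<alpha> \<lhd> (ctgt C \<beta> \<Zsemi> f))"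
    if "f \<in> mor C" "src C f = tgt C (csrc C \<beta>)" for f
    using that assms hcmp_whisk(2)[OF assms] by (simp add: whisk_r_vcmp whisk_r_cmp whisk_lr)
  then show ?thesis
    using assms unfolding nhcomp_def
    by (simp add: pre2_def pre_cmp) (auto simp: mors_def carr_hom pre_def intro!: restrict_ext)
qed

lemma post2_hcmp:
  assumes "\<alpha> \<in> cell C" "\<beta> \<in> cell C" "tgt C (csrc C \<alpha>) = src C (csrc C \<beta>)"
  shows "post2 C A (\<alpha> \<star> \<beta>) = nhcomp (post2 C A \<alpha>) (post2 C A \<beta>)"
proof -
  have "u \<rhd> (\<alpha> \<star> \<beta>) = ((u \<rhd> \<alpha>) \<lhd> csrc C \<beta>) \<odot> ((u \<Zsemi> ctgt C \<alpha>) \<rhd> \<beta>)"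
    if "u \<in> mor C" "tgt C u = src C (csrc C \<alpha>)" for u
    using that assms hcmp_whisk(1)[OF assms] by (simp add: whisk_l_vcmp whisk_l_cmp whisk_lr)
  then show ?thesis
    using assms unfolding nhcomp_def
    by (simp add: post2_def post_cmp) (auto simp: mors_def carr_hom post_def intro!: restrict_ext)
qed

text \<open>Precomposition and postcomposition commute by associativity. The 1-dimensional form here
  and \<open>pre2_post\<close> give strict naturality of \<open>yo_mor\<close> on 1-cells and
  2-cells; \<open>pre_post2\<close> gives the modification axiom for \<open>yo_cell\<close>.\<close>

lemma pre_post:
  assumes "u \<in> mors C A' A" "f \<in> mor C"
  shows "fcmp (pre C u (src C f)) (post C A' f) = fcmp (post C A f) (pre C u (tgt C f))"
  using assms unfolding pre_def post_def fcmp_def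
  by (auto simp: mors_def carr_hom cmp_assoc whisk_lr intro!: restrict_ext)

lemma pre2_post:
  assumes "\<phi> \<in> cell C" "f \<in> mor C" "src C (csrc C \<phi>) = A'" "tgt C (csrc C \<phi>) = A"
  shows "whiskf (pre2 C \<phi> (src C f)) (post C A' f) = fwhisk (post C A f) (pre2 C \<phi> (tgt C f))"
  using assms pre_post[of "csrc C \<phi>" A' A f] pre_post[of "ctgt C \<phi>" A' A f]
  unfolding whiskf_def fwhisk_def pre2_def
  by (auto simp: mors_def) (auto simp: mors_def carr_hom post_def pre_def whisk_r_cmp intro!: restrict_ext)

lemma pre_post2:
  assumes "u \<in> mors C A' A" "\<alpha> \<in> cell C" "src C (csrc C \<alpha>) = X" "tgt C (csrc C \<alpha>) = Y"
  shows "whiskf (post2 C A \<alpha>) (pre C u Y) = fwhisk (pre C u X) (post2 C A' \<alpha>)"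
  using assms pre_post[of u A' A "csrc C \<alpha>"] pre_post[of u A' A "ctgt C \<alpha>"]
  unfolding whiskf_def fwhisk_def post2_def
  by (auto simp: mors_def) (auto simp: mors_def carr_hom post_def pre_def whisk_l_cmp intro!: restrict_ext)

section \<open>Well-definedness of the restricted Yoneda 2-functor\<close>

lemma yo_obj_simps [simp]:
  "tdom (yo_obj C X) = op2 (gpd C)" "tcod (yo_obj C X) = Cat"
  "A \<in> obj C \<Longrightarrow> A \<in> gpds C \<Longrightarrow> to (yo_obj C X) A = hom C A X"
  "u \<in> mor C \<Longrightarrow> src C u \<in> gpds C \<Longrightarrow> tgt C u \<in> gpds C \<Longrightarrow> tm (yo_obj C X) u = pre C u X"
  "\<phi> \<in> cell C \<Longrightarrow> src C (csrc C \<phi>) \<in> gpds C \<Longrightarrow> tgt C (csrc C \<phi>) \<in> gpds C \<Longrightarrow> tc (yo_obj C X) \<phi> = pre2 C \<phi> X"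
  by (simp_all add: yo_obj_def)

lemma yo_mor_simps [simp]:
  "tnsrc (yo_mor C f) = yo_obj C (src C f)" "tntgt (yo_mor C f) = yo_obj C (tgt C f)"
  "A \<in> obj C \<Longrightarrow> A \<in> gpds C \<Longrightarrow> tnc (yo_mor C f) A = post C A f"
  by (simp_all add: yo_mor_def)

lemma yo_cell_simps [simp]:
  "tmsrc (yo_cell C \<alpha>) = yo_mor C (csrc C \<alpha>)" "tmtgt (yo_cell C \<alpha>) = yo_mor C (ctgt C \<alpha>)"
  "A \<in> obj C \<Longrightarrow> A \<in> gpds C \<Longrightarrow> tmc (yo_cell C \<alpha>) A = post2 C A \<alpha>"
  by (simp_all add: yo_cell_def)

lemma two_functor_yo_obj:
  assumes "X \<in> obj C"
  shows "two_functor (yo_obj C X)"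
  unfolding two_functor_def Let_def
proof (intro conjI ballI impI)
  show "to (yo_obj C X) \<in> obj (tdom (yo_obj C X)) \<rightarrow>\<^sub>E obj (tcod (yo_obj C X))"
    using assms by (auto simp: yo_obj_def intro: hom_category)
  show "tm (yo_obj C X) \<in> mor (tdom (yo_obj C X)) \<rightarrow>\<^sub>E mor (tcod (yo_obj C X))"
    using assms by (auto simp: yo_obj_def intro!: hom_category is_functor_pre)
  show "tc (yo_obj C X) \<in> cell (tdom (yo_obj C X)) \<rightarrow>\<^sub>E cell (tcod (yo_obj C X))"
    using assms by (auto simp: yo_obj_def intro!: hom_category is_ntrans_pre2)
qed (use assms in \<open>auto simp: pre_idm pre_cmp pre2_idc pre2_vcmp pre2_hcmp\<close>)

lemma strict_nat_yo_mor:
  assumes "f \<in> mor C"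
  shows "strict_nat (yo_mor C f)"
  unfolding strict_nat_def Let_def
proof (intro conjI ballI)
  fix \<phi> assume "\<phi> \<in> cell (tdom (tnsrc (yo_mor C f)))"
  then have \<phi>: "\<phi> \<in> cell C" "src C (csrc C \<phi>) \<in> gpds C" "tgt C (csrc C \<phi>) \<in> gpds C" by simp_all
  \<comment> \<open>Both whiskerings in \<open>Cat\<close> are first reduced to
    \<open>whiskf\<close> and \<open>fwhisk\<close>, the form in which \<open>pre2_post\<close>
    compares them.\<close>
  have "nhcomp (pre2 C \<phi> (src C f)) (nid (post C (src C (csrc C \<phi>)) f)) =
      whiskf (pre2 C \<phi> (src C f)) (post C (src C (csrc C \<phi>)) f)"
    using \<phi> assms by (intro nhcomp_nid_right is_ntrans_pre2 is_functor_post) (auto intro: hom_category)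
  moreover have "nhcomp (nid (post C (tgt C (csrc C \<phi>)) f)) (pre2 C \<phi> (tgt C f)) =
      fwhisk (post C (tgt C (csrc C \<phi>)) f) (pre2 C \<phi> (tgt C f))"
    using \<phi> assms by (intro nhcomp_nid_left is_ntrans_pre2 is_functor_post) (auto intro: hom_category)
  ultimately show "tc (tnsrc (yo_mor C f)) \<phi> \<lhd>\<^bsub>tcod (tnsrc (yo_mor C f))\<^esub>
        tnc (yo_mor C f) (tgt (tdom (tnsrc (yo_mor C f))) (csrc (tdom (tnsrc (yo_mor C f))) \<phi>)) =
      tnc (yo_mor C f) (src (tdom (tnsrc (yo_mor C f))) (csrc (tdom (tnsrc (yo_mor C f))) \<phi>)) \<rhd>\<^bsub>tcod (tnsrc (yo_mor C f))\<^esub>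
        tc (tntgt (yo_mor C f)) \<phi>"
    using \<phi> assms pre2_post[OF \<phi>(1) assms refl refl] by (simp add: whisk_l_def whisk_r_def)
next
  fix u assume "u \<in> mor (tdom (tnsrc (yo_mor C f)))"
  then have u: "u \<in> mor C" "src C u \<in> gpds C" "tgt C u \<in> gpds C" by simp_all
  then show "tm (tnsrc (yo_mor C f)) u \<Zsemi>\<^bsub>tcod (tnsrc (yo_mor C f))\<^esub> tnc (yo_mor C f) (tgt (tdom (tnsrc (yo_mor C f))) u) =
      tnc (yo_mor C f) (src (tdom (tnsrc (yo_mor C f))) u) \<Zsemi>\<^bsub>tcod (tnsrc (yo_mor C f))\<^esub> tm (tntgt (yo_mor C f)) u"
    using assms pre_post[of u "src C u" "tgt C u" f] by (simp add: mors_def)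
next
  fix A assume "A \<in> obj (tdom (tnsrc (yo_mor C f)))"
  then show "tnc (yo_mor C f) A \<in> mors (tcod (tnsrc (yo_mor C f))) (to (tnsrc (yo_mor C f)) A) (to (tntgt (yo_mor C f)) A)"
    using assms by (simp add: mors_def[of Cat] is_functor_post hom_category)
qed (use assms in \<open>auto simp: two_functor_yo_obj yo_mor_def\<close>)

lemma whisk_Cat:
  assumes "F \<in> mor Cat" "\<nu> \<in> cell Cat" "fcod F = fdom (nsrc \<nu>)"
  shows "F \<rhd>\<^bsub>Cat\<^esub> \<nu> = fwhisk F \<nu>"
  using assms by (simp add: whisk_l_def nhcomp_nid_left)

lemma whisk_Cat':
  assumes "F \<in> mor Cat" "\<nu> \<in> cell Cat" "fcod (nsrc \<nu>) = fdom F"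
  shows "\<nu> \<lhd>\<^bsub>Cat\<^esub> F = whiskf \<nu> F"
  using assms by (simp add: whisk_r_def nhcomp_nid_right)

lemma modification_yo_cell:
  assumes "\<alpha> \<in> cell C"
  shows "modification (yo_cell C \<alpha>)"
  unfolding modification_def Let_def
proof (intro conjI ballI)
  fix u assume "u \<in> mor (tdom (tnsrc (tmsrc (yo_cell C \<alpha>))))"
  then have u: "u \<in> mor C" "src C u \<in> gpds C" "tgt C u \<in> gpds C" by simp_all
  let ?X = "src C (csrc C \<alpha>)" and ?Y = "tgt C (csrc C \<alpha>)"
  have "pre C u ?X \<rhd>\<^bsub>Cat\<^esub> post2 C (src C u) \<alpha> = fwhisk (pre C u ?X) (post2 C (src C u) \<alpha>)"
    using assms u is_ntrans_post2[OF assms, of "src C u"] is_functor_pre[of u ?X]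
    by (intro whisk_Cat) (auto simp: post2_def hom_category)
  moreover have "post2 C (tgt C u) \<alpha> \<lhd>\<^bsub>Cat\<^esub> pre C u ?Y = whiskf (post2 C (tgt C u) \<alpha>) (pre C u ?Y)"
    using assms u is_ntrans_post2[OF assms, of "tgt C u"] is_functor_pre[of u ?Y]
    by (intro whisk_Cat') (auto simp: post2_def hom_category)
  ultimately show "tm (tnsrc (tmsrc (yo_cell C \<alpha>))) u \<rhd>\<^bsub>tcod (tnsrc (tmsrc (yo_cell C \<alpha>)))\<^esub>
        tmc (yo_cell C \<alpha>) (tgt (tdom (tnsrc (tmsrc (yo_cell C \<alpha>)))) u) =
      tmc (yo_cell C \<alpha>) (src (tdom (tnsrc (tmsrc (yo_cell C \<alpha>)))) u) \<lhd>\<^bsub>tcod (tnsrc (tmsrc (yo_cell C \<alpha>)))\<^esub>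
        tm (tntgt (tmsrc (yo_cell C \<alpha>))) u"
    using u assms pre_post2[of u "src C u" "tgt C u" \<alpha>] by (simp add: mors_def)
next
  fix A assume "A \<in> obj (tdom (tnsrc (tmsrc (yo_cell C \<alpha>))))"
  then show "tmc (yo_cell C \<alpha>) A \<in> cells (tcod (tnsrc (tmsrc (yo_cell C \<alpha>))))
      (tnc (tmsrc (yo_cell C \<alpha>)) A) (tnc (tmtgt (yo_cell C \<alpha>)) A)"
    using assms is_ntrans_post2[OF assms, of A] by (simp add: cells_def post2_def hom_category)
qed (use assms in \<open>auto simp: strict_nat_yo_mor yo_cell_def\<close>)

lemma two_functor_restricted_yoneda: "two_functor (restricted_yoneda C)"
proof -
  have s: "tdom (restricted_yoneda C) = C" "tcod (restricted_yoneda C) = TwoFun (op2 (gpd C)) Cat"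
    "to (restricted_yoneda C) = restrict (yo_obj C) (obj C)"
    "tm (restricted_yoneda C) = restrict (yo_mor C) (mor C)"
    "tc (restricted_yoneda C) = restrict (yo_cell C) (cell C)"
    by (simp_all add: restricted_yoneda_def)
  show ?thesis
    unfolding two_functor_def Let_def s
  proof (intro conjI ballI impI)
    show "restrict (yo_obj C) (obj C) \<in> obj C \<rightarrow>\<^sub>E obj (TwoFun (op2 (gpd C)) Cat)"
      by (auto simp: TwoFun_def two_functor_yo_obj)
    show "restrict (yo_mor C) (mor C) \<in> mor C \<rightarrow>\<^sub>E mor (TwoFun (op2 (gpd C)) Cat)"
      by (auto simp: TwoFun_def strict_nat_yo_mor)
    show "restrict (yo_cell C) (cell C) \<in> cell C \<rightarrow>\<^sub>E cell (TwoFun (op2 (gpd C)) Cat)"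
      by (auto simp: TwoFun_def modification_yo_cell)
    fix X assume "X \<in> obj C"
    then show "restrict (yo_mor C) (mor C) (idm C X) = idm (TwoFun (op2 (gpd C)) Cat) (restrict (yo_obj C) (obj C) X)"
      by (auto simp: TwoFun_def yo_mor_def post_idm intro!: restrict_ext)
  next
    fix f g assume "f \<in> mor C" "g \<in> mor C" "tgt C f = src C g"
    then show "restrict (yo_mor C) (mor C) (f \<Zsemi> g) = restrict (yo_mor C) (mor C) f \<Zsemi>\<^bsub>TwoFun (op2 (gpd C)) Cat\<^esub> restrict (yo_mor C) (mor C) g"
      by (auto simp: TwoFun_def yo_mor_def post_cmp intro!: restrict_ext)
  next
    fix f assume "f \<in> mor C"
    then show "restrict (yo_cell C) (cell C) (idc C f) = idc (TwoFun (op2 (gpd C)) Cat) (restrict (yo_mor C) (mor C) f)"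
      by (auto simp: TwoFun_def yo_cell_def post2_idc intro!: restrict_ext)
  next
    fix \<alpha> \<beta> assume "\<alpha> \<in> cell C" "\<beta> \<in> cell C" "ctgt C \<alpha> = csrc C \<beta>"
    then show "restrict (yo_cell C) (cell C) (\<alpha> \<odot> \<beta>) =
        restrict (yo_cell C) (cell C) \<alpha> \<odot>\<^bsub>TwoFun (op2 (gpd C)) Cat\<^esub> restrict (yo_cell C) (cell C) \<beta>"
      by (auto simp: TwoFun_def yo_cell_def post2_vcmp intro!: restrict_ext)
  next
    fix \<alpha> \<beta> assume "\<alpha> \<in> cell C" "\<beta> \<in> cell C" "tgt C (csrc C \<alpha>) = src C (csrc C \<beta>)"
    then show "restrict (yo_cell C) (cell C) (\<alpha> \<star> \<beta>) =
        restrict (yo_cell C) (cell C) \<alpha> \<star>\<^bsub>TwoFun (op2 (gpd C)) Cat\<^esub> restrict (yo_cell C) (cell C) \<beta>"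
      by (auto simp: TwoFun_def yo_cell_def yo_mor_def post2_hcmp post_cmp intro!: restrict_ext)
  qed (auto simp: TwoFun_def)
qed

text \<open>The functor laws are read off the preservation clauses of \<open>two_functor\<close>,
  which makes the lemma applicable to the bare record \<open>TwoFun (op2 (gpd C)) Cat\<close> as
  target.\<close>

lemma is_functor_hom_functor:
  assumes "two_functor F" "tdom F = C" "X \<in> obj C" "Y \<in> obj C"
  shows "is_functor (hom_functor F X Y)"
proof -
  have H: "tm F \<in> mor C \<rightarrow>\<^sub>E mor (tcod F)" "tc F \<in> cell C \<rightarrow>\<^sub>E cell (tcod F)"
    "\<forall>f \<in> mor C. src (tcod F) (tm F f) = to F (src C f) \<and> tgt (tcod F) (tm F f) = to F (tgt C f)"
    "\<forall>\<alpha> \<in> cell C. csrc (tcod F) (tc F \<alpha>) = tm F (csrc C \<alpha>) \<and> ctgt (tcod F) (tc F \<alpha>) = tm F (ctgt C \<alpha>)"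
    "\<forall>f \<in> mor C. tc F (idc C f) = idc (tcod F) (tm F f)"
    "\<forall>\<alpha> \<in> cell C. \<forall>\<beta> \<in> cell C. ctgt C \<alpha> = csrc C \<beta> \<longrightarrow> tc F (\<alpha> \<odot> \<beta>) = tc F \<alpha> \<odot>\<^bsub>tcod F\<^esub> tc F \<beta>"
    using assms(1) unfolding two_functor_def Let_def assms(2) by blast+
  have m: "tm F f \<in> mors (tcod F) (to F X) (to F Y)" if "f \<in> mors C X Y" for f
    using that H(1,3) by (auto simp: mors_def PiE_iff)
  have t: "cobj (hom (tcod F) a b) = mors (tcod F) a b" "cdom (hom (tcod F) a b) = csrc (tcod F)"
    "ccod (hom (tcod F) a b) = ctgt (tcod F)" "cid (hom (tcod F) a b) = idc (tcod F)"
    "ccomp (hom (tcod F) a b) = vcmp (tcod F)" for a b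
    by (simp_all add: hom_def)
  have s: "fdom (hom_functor F X Y) = hom C X Y" "fcod (hom_functor F X Y) = hom (tcod F) (to F X) (to F Y)"
    by (simp_all add: hom_functor_def assms)
  have o: "fo (hom_functor F X Y) f = tm F f" if "f \<in> mors C X Y" for f
    using that by (simp add: hom_functor_def assms)
  have a: "fa (hom_functor F X Y) \<alpha> = tc F \<alpha>" if "\<alpha> \<in> carr (hom C X Y)" for \<alpha>
    using that by (simp add: hom_functor_def assms)
  have c: "csrc C \<alpha> \<in> mors C X Y" "ctgt C \<alpha> \<in> mors C X Y" "\<alpha> \<in> cell C" if "\<alpha> \<in> carr (hom C X Y)" for \<alpha>
    using that by (auto simp: carr_hom mors_def)
  show ?thesis
    unfolding is_functor_def s hom_simps t
  proof (intro conjI ballI impI)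
    show "fo (hom_functor F X Y) \<in> mors C X Y \<rightarrow>\<^sub>E mors (tcod F) (to F X) (to F Y)"
      using m by (auto simp: hom_functor_def assms)
    have "tc F \<alpha> \<in> carr (hom (tcod F) (to F X) (to F Y))" if "\<alpha> \<in> carr (hom C X Y)" for \<alpha>
      using c[OF that] m H(2,4) by (simp add: hom_def PiE_iff)
    then show "fa (hom_functor F X Y) \<in> carr (hom C X Y) \<rightarrow>\<^sub>E carr (hom (tcod F) (to F X) (to F Y))"
      by (auto simp: hom_functor_def assms)
    fix \<alpha> assume \<alpha>: "\<alpha> \<in> carr (hom C X Y)"
    show "csrc (tcod F) (fa (hom_functor F X Y) \<alpha>) = fo (hom_functor F X Y) (csrc C \<alpha>)"
      "ctgt (tcod F) (fa (hom_functor F X Y) \<alpha>) = fo (hom_functor F X Y) (ctgt C \<alpha>)"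
      using c[OF \<alpha>] H(4) by (simp_all add: o a \<alpha>)
    fix \<beta> assume \<beta>: "\<beta> \<in> carr (hom C X Y)" "ctgt C \<alpha> = csrc C \<beta>"
    have "\<alpha> \<odot> \<beta> \<in> carr (hom C X Y)" using \<alpha> \<beta> by (simp add: carr_hom)
    then show "fa (hom_functor F X Y) (\<alpha> \<odot> \<beta>) = fa (hom_functor F X Y) \<alpha> \<odot>\<^bsub>tcod F\<^esub> fa (hom_functor F X Y) \<beta>"
      using c(3)[OF \<alpha>] c(3)[OF \<beta>(1)] H(6) \<beta> by (simp add: a \<alpha>)
  next
    fix f assume f: "f \<in> mors C X Y"
    then have "idc C f \<in> carr (hom C X Y)" by (simp add: carr_hom mors_def)
    then show "fa (hom_functor F X Y) (idc C f) = idc (tcod F) (fo (hom_functor F X Y) f)"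
      using f H(5) by (simp add: o a mors_def)
  qed
qed

end

lemma gpds_obj: "A \<in> gpds C \<Longrightarrow> A \<in> obj C"
  by (simp add: gpds_def groupoid_obj_def)

section \<open>The four detailed statements and full faithfulness\<close>

context
  fixes C :: "('o, 'a, 'c) two_cat" (structure)
  assumes groupoidant: "groupoidant C"
begin

interpretation two_category C
  using groupoidant unfolding groupoidant_def pita_def by blast

lemma mor_eq_iff_post_eq:
  assumes "f \<in> mors C X Y" "g \<in> mors C X Y"
  shows "f = g \<longleftrightarrow> (\<forall>A \<in> gpds C. post C A f = post C A g)"
proof -
  have X: "X \<in> obj C" using assms by (auto simp: mors_def)
  obtain P d p q ev1 K0 K1 K2 Z i0 i1 i2 s m n0 n1 e n01 n12 n02 z0 z1 h
    where N: "nerve_data C X P d p q ev1 K0 K1 K2 Z i0 i1 i2 s m n0 n1 e n01 n12 n02 z0 z1 h"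
    by (rule nerve_data_ex[OF groupoidant X])
  show ?thesis using nerve_data.mor_eq_if_post_eq[OF N groupoidant assms] by blast
qed

lemma cell_eq_iff_post2_eq:
  assumes "f \<in> mors C X Y" "\<alpha> \<in> cells C f g" "\<beta> \<in> cells C f g"
  shows "\<alpha> = \<beta> \<longleftrightarrow> (\<forall>A \<in> gpds C. post2 C A \<alpha> = post2 C A \<beta>)"
proof -
  have X: "X \<in> obj C" using assms by (auto simp: mors_def)
  obtain P d p q ev1 K0 K1 K2 Z i0 i1 i2 s m n0 n1 e n01 n12 n02 z0 z1 h
    where N: "nerve_data C X P d p q ev1 K0 K1 K2 Z i0 i1 i2 s m n0 n1 e n01 n12 n02 z0 z1 h"
    by (rule nerve_data_ex[OF groupoidant X])
  show ?thesis using nerve_data.cell_eq_if_post2_eq[OF N groupoidant assms] by blast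
qed

lemma ex1_mor_of_natural_family:
  assumes "X \<in> obj C" "Y \<in> obj C"
    and F: "\<forall>A \<in> gpds C. is_functor (F A) \<and> fdom (F A) = hom C A X \<and> fcod (F A) = hom C A Y"
    and nat: "\<forall>A \<in> gpds C. \<forall>A' \<in> gpds C. \<forall>u \<in> mors C A' A.
      fcmp (F A) (pre C u Y) = fcmp (pre C u X) (F A')"
  shows "\<exists>!f. f \<in> mors C X Y \<and> (\<forall>A \<in> gpds C. F A = post C A f)"
proof -
  obtain P d p q ev1 K0 K1 K2 Z i0 i1 i2 s m n0 n1 e n01 n12 n02 z0 z1 h
    where N: "nerve_data C X P d p q ev1 K0 K1 K2 Z i0 i1 i2 s m n0 n1 e n01 n12 n02 z0 z1 h"
    by (rule nerve_data_ex[OF groupoidant assms(1)])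
  obtain f where f: "f \<in> mors C X Y" "\<And>A. A \<in> gpds C \<Longrightarrow> F A = post C A f"
    using nerve_data.mor_of_natural_family[OF N groupoidant assms(2), of F] F nat by blast
  show ?thesis
  proof (rule ex1I[of _ f])
    fix g assume "g \<in> mors C X Y \<and> (\<forall>A \<in> gpds C. F A = post C A g)"
    then have g: "g \<in> mors C X Y" "\<forall>A \<in> gpds C. F A = post C A g" by blast+
    have "\<forall>A \<in> gpds C. post C A g = post C A f"
      by (intro ballI trans[OF sym[OF bspec[OF g(2)]] f(2)])
    then show "g = f" by (rule iffD2[OF mor_eq_iff_post_eq[OF g(1) f(1)]])
  qed (use f in blast)
qed

lemma ex1_cell_of_natural_family:
  assumes f: "f \<in> mors C X Y" "g \<in> mors C X Y"
    and \<alpha>: "\<forall>A \<in> gpds C. is_ntrans (\<alpha> A) \<and> nsrc (\<alpha> A) = post C A f \<and> ntgt (\<alpha> A) = post C A g"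
    and nat: "\<forall>A \<in> gpds C. \<forall>A' \<in> gpds C. \<forall>h \<in> mors C A' A.
      whiskf (\<alpha> A) (pre C h Y) = fwhisk (pre C h X) (\<alpha> A')"
  shows "\<exists>!\<theta>. \<theta> \<in> cells C f g \<and> (\<forall>A \<in> gpds C. \<alpha> A = post2 C A \<theta>)"
proof -
  have X: "X \<in> obj C" using f by (auto simp: mors_def)
  obtain P d p q ev1 K0 K1 K2 Z i0 i1 i2 s m n0 n1 e n01 n12 n02 z0 z1 h
    where N: "nerve_data C X P d p q ev1 K0 K1 K2 Z i0 i1 i2 s m n0 n1 e n01 n12 n02 z0 z1 h"
    by (rule nerve_data_ex[OF groupoidant X])
  obtain \<theta> where \<theta>: "\<theta> \<in> cells C f g" "\<And>A. A \<in> gpds C \<Longrightarrow> \<alpha> A = post2 C A \<theta>"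
    using nerve_data.cell_of_natural_family[OF N groupoidant f, of \<alpha>] \<alpha> nat by blast
  show ?thesis
  proof (rule ex1I[of _ \<theta>])
    fix \<theta>' assume "\<theta>' \<in> cells C f g \<and> (\<forall>A \<in> gpds C. \<alpha> A = post2 C A \<theta>')"
    then have \<theta>': "\<theta>' \<in> cells C f g" "\<forall>A \<in> gpds C. \<alpha> A = post2 C A \<theta>'" by blast+
    have "\<forall>A \<in> gpds C. post2 C A \<theta>' = post2 C A \<theta>"
      by (intro ballI trans[OF sym[OF bspec[OF \<theta>'(2)]] \<theta>(2)])
    then show "\<theta>' = \<theta>" by (rule iffD2[OF cell_eq_iff_post2_eq[OF f(1) \<theta>'(1) \<theta>(1)]])
  qed (use \<theta> in blast)
qed

text \<open>Naturality of \<sigma> on 1-cells, with source and target exchanged by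
  \<open>op2\<close>, is the naturality hypothesis of (iii). Extensionality of \<open>tnc\<close>
  recovers the record from its components, so equality with \<sigma> is equality of
  families.\<close>

lemma ex1_yo_mor:
  assumes XY: "X \<in> obj C" "Y \<in> obj C"
    and \<sigma>: "strict_nat \<sigma>" "tnsrc \<sigma> = yo_obj C X" "tntgt \<sigma> = yo_obj C Y"
  shows "\<exists>!f. f \<in> mors C X Y \<and> yo_mor C f = \<sigma>"
proof -
  have ext: "tnc \<sigma> \<in> extensional (obj (gpd C))"
    and t: "\<And>A. A \<in> obj (gpd C) \<Longrightarrow> tnc \<sigma> A \<in> mors Cat (to (yo_obj C X) A) (to (yo_obj C Y) A)"
    and n: "\<And>u. u \<in> mor (gpd C) \<Longrightarrow>
      fcmp (tm (yo_obj C X) u) (tnc \<sigma> (src C u)) = fcmp (tnc \<sigma> (tgt C u)) (tm (yo_obj C Y) u)"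
    using \<sigma>(1) unfolding strict_nat_def Let_def \<sigma>(2,3) by auto
  have F: "\<forall>A \<in> gpds C. is_functor (tnc \<sigma> A) \<and> fdom (tnc \<sigma> A) = hom C A X \<and> fcod (tnc \<sigma> A) = hom C A Y"
    using t gpds_obj[of _ C] by (auto simp: mors_def)
  have nat: "\<forall>A \<in> gpds C. \<forall>A' \<in> gpds C. \<forall>u \<in> mors C A' A.
      fcmp (tnc \<sigma> A) (pre C u Y) = fcmp (pre C u X) (tnc \<sigma> A')"
  proof (intro ballI)
    fix A A' u assume "A \<in> gpds C" "A' \<in> gpds C" "u \<in> mors C A' A"
    then show "fcmp (tnc \<sigma> A) (pre C u Y) = fcmp (pre C u X) (tnc \<sigma> A')"
      using n[of u] by (simp add: mors_def)
  qed
  have iff: "yo_mor C f = \<sigma> \<longleftrightarrow> (\<forall>A \<in> gpds C. tnc \<sigma> A = post C A f)" if f: "f \<in> mors C X Y" for f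
  proof
    assume "yo_mor C f = \<sigma>"
    then show "\<forall>A \<in> gpds C. tnc \<sigma> A = post C A f" using gpds_obj[of _ C] by auto
  next
    assume "\<forall>A \<in> gpds C. tnc \<sigma> A = post C A f"
    then have "tnc (yo_mor C f) = tnc \<sigma>"
      by (intro extensionalityI[OF _ ext]) (auto simp: yo_mor_def)
    then show "yo_mor C f = \<sigma>"
      using \<sigma> f by (intro two_nat.equality) (simp_all add: mors_def)
  qed
  show ?thesis using ex1_mor_of_natural_family[OF XY F nat] iff by (simp cong: conj_cong)
qed

text \<open>The two ends of \<Theta> are strict natural transformations, hence come from unique
  morphisms \<open>f\<close> and \<open>g\<close>. The modification axiom then says that the
  components of \<Theta> form a natural family as in (iv).\<close>

lemma ex1_yo_cell:
  assumes XY: "X \<in> obj C" "Y \<in> obj C"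
    and \<Theta>: "modification \<Theta>" "tnsrc (tmsrc \<Theta>) = yo_obj C X" "tntgt (tmsrc \<Theta>) = yo_obj C Y"
  shows "\<exists>!\<alpha>. \<alpha> \<in> carr (hom C X Y) \<and> yo_cell C \<alpha> = \<Theta>"
proof -
  have st: "strict_nat (tmsrc \<Theta>)" "strict_nat (tmtgt \<Theta>)" "tnsrc (tmtgt \<Theta>) = yo_obj C X" "tntgt (tmtgt \<Theta>) = yo_obj C Y"
    and ext: "tmc \<Theta> \<in> extensional (obj (gpd C))"
    and t: "\<And>A. A \<in> obj (gpd C) \<Longrightarrow> tmc \<Theta> A \<in> cells Cat (tnc (tmsrc \<Theta>) A) (tnc (tmtgt \<Theta>) A)"
    and n: "\<And>u. u \<in> mor (gpd C) \<Longrightarrow>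
      tm (yo_obj C X) u \<rhd>\<^bsub>Cat\<^esub> tmc \<Theta> (src C u) = tmc \<Theta> (tgt C u) \<lhd>\<^bsub>Cat\<^esub> tm (yo_obj C Y) u"
    using \<Theta>(1) unfolding modification_def Let_def \<Theta>(2,3) by auto
  obtain f where f: "f \<in> mors C X Y" "yo_mor C f = tmsrc \<Theta>"
    using ex1_yo_mor[OF XY st(1) \<Theta>(2,3)] by blast
  obtain g where g: "g \<in> mors C X Y" "yo_mor C g = tmtgt \<Theta>"
    using ex1_yo_mor[OF XY st(2-4)] by blast
  have s: "f \<in> mor C" "src C f = X" "tgt C f = Y" "g \<in> mor C" "src C g = X" "tgt C g = Y"
    using f g by (auto simp: mors_def)
  have c: "is_ntrans (tmc \<Theta> A)" "nsrc (tmc \<Theta> A) = post C A f" "ntgt (tmc \<Theta> A) = post C A g" if A: "A \<in> gpds C" for A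
    using t[of A] gpds_obj[OF A] A unfolding f(2)[symmetric] g(2)[symmetric] by (auto simp: cells_def)
  have \<alpha>: "\<forall>A \<in> gpds C. is_ntrans (tmc \<Theta> A) \<and> nsrc (tmc \<Theta> A) = post C A f \<and> ntgt (tmc \<Theta> A) = post C A g"
    using c by blast
  have nat: "\<forall>A \<in> gpds C. \<forall>A' \<in> gpds C. \<forall>h \<in> mors C A' A.
      whiskf (tmc \<Theta> A) (pre C h Y) = fwhisk (pre C h X) (tmc \<Theta> A')"
  proof (intro ballI)
    fix A A' h assume A: "A \<in> gpds C" "A' \<in> gpds C" and h: "h \<in> mors C A' A"
    have hs: "h \<in> mor C" "src C h = A'" "tgt C h = A" using h by (auto simp: mors_def)
    note o = gpds_obj[OF A(1)] gpds_obj[OF A(2)]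
    have "pre C h X \<rhd>\<^bsub>Cat\<^esub> tmc \<Theta> A' = fwhisk (pre C h X) (tmc \<Theta> A')"
      using c[OF A(2)] hs s o XY is_functor_pre[OF hs(1) XY(1)] by (intro whisk_Cat) (simp_all add: hom_category)
    moreover have "tmc \<Theta> A \<lhd>\<^bsub>Cat\<^esub> pre C h Y = whiskf (tmc \<Theta> A) (pre C h Y)"
      using c[OF A(1)] hs s o XY is_functor_pre[OF hs(1) XY(2)] by (intro whisk_Cat') (simp_all add: hom_category)
    ultimately show "whiskf (tmc \<Theta> A) (pre C h Y) = fwhisk (pre C h X) (tmc \<Theta> A')"
      using n[of h] hs A by simp
  qed
  \<comment> \<open>A preimage of \<Theta> is sought among all 2-cells from \<open>X\<close> to
    \<open>Y\<close>, whereas (iv) fixes the ends. Uniqueness in \<open>ex1_yo_mor\<close> forces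
    the ends to be \<open>f\<close> and \<open>g\<close>.\<close>
  have iff: "\<theta> \<in> carr (hom C X Y) \<and> yo_cell C \<theta> = \<Theta> \<longleftrightarrow> \<theta> \<in> cells C f g \<and> (\<forall>A \<in> gpds C. tmc \<Theta> A = post2 C A \<theta>)" for \<theta>
  proof
    assume \<theta>: "\<theta> \<in> carr (hom C X Y) \<and> yo_cell C \<theta> = \<Theta>"
    then have m: "csrc C \<theta> \<in> mors C X Y" "ctgt C \<theta> \<in> mors C X Y" "\<theta> \<in> cell C"
      by (auto simp: carr_hom mors_def)
    have "yo_mor C (csrc C \<theta>) = tmsrc \<Theta>" "yo_mor C (ctgt C \<theta>) = tmtgt \<Theta>"
      using \<theta> by auto
    then have "csrc C \<theta> = f" "ctgt C \<theta> = g"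
      using ex1_yo_mor[OF XY st(1) \<Theta>(2,3)] ex1_yo_mor[OF XY st(2-4)] f g m by blast+
    then show "\<theta> \<in> cells C f g \<and> (\<forall>A \<in> gpds C. tmc \<Theta> A = post2 C A \<theta>)"
      using \<theta> m(3) gpds_obj[of _ C] by (auto simp: cells_def)
  next
    assume \<theta>: "\<theta> \<in> cells C f g \<and> (\<forall>A \<in> gpds C. tmc \<Theta> A = post2 C A \<theta>)"
    then have \<theta>s: "\<theta> \<in> cell C" "csrc C \<theta> = f" "ctgt C \<theta> = g" by (auto simp: cells_def)
    have "tmc (yo_cell C \<theta>) = tmc \<Theta>"
      using \<theta> by (intro extensionalityI[OF _ ext]) (auto simp: yo_cell_def)
    then have "yo_cell C \<theta> = \<Theta>"
      using f(2) g(2) \<theta>s by (intro two_mod.equality) simp_all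
    then show "\<theta> \<in> carr (hom C X Y) \<and> yo_cell C \<theta> = \<Theta>" using \<theta>s s by (simp add: carr_hom)
  qed
  show ?thesis unfolding iff by (rule ex1_cell_of_natural_family[OF f(1) g(1) \<alpha> nat])
qed

text \<open>Bijectivity on morphisms combines (i) and (iii), bijectivity on 2-cells combines (ii)
  and (iv); \<open>cat_isoI\<close> then provides the inverse functor.\<close>

lemma strictly_fully_faithful_restricted_yoneda: "strictly_fully_faithful (restricted_yoneda C)"
  unfolding strictly_fully_faithful_def
proof (intro ballI)
  let ?R = "restricted_yoneda C"
  have d: "tdom ?R = C" by (simp add: restricted_yoneda_def)
  fix X Y assume "X \<in> obj (tdom ?R)" "Y \<in> obj (tdom ?R)"
  then have XY: "X \<in> obj C" "Y \<in> obj C" by (simp_all add: d)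
  let ?H = "hom_functor ?R X Y"
  have H: "is_functor ?H" by (rule is_functor_hom_functor[OF two_functor_restricted_yoneda d XY])
  have s: "fdom ?H = hom C X Y" "fcod ?H = hom (TwoFun (op2 (gpd C)) Cat) (yo_obj C X) (yo_obj C Y)"
    using XY by (simp_all add: hom_functor_def restricted_yoneda_def)
  have o: "fo ?H f = yo_mor C f" if "f \<in> mors C X Y" for f
    using that by (simp add: hom_functor_def restricted_yoneda_def mors_def)
  have a: "fa ?H \<alpha> = yo_cell C \<alpha>" if "\<alpha> \<in> carr (hom C X Y)" for \<alpha>
    using that by (simp add: hom_functor_def restricted_yoneda_def carr_hom)
  show "cat_iso ?H"
  proof (rule cat_isoI[OF H])
    show "category (fdom ?H)" using XY by (simp add: s hom_category)
    show "bij_betw (fo ?H) (cobj (fdom ?H)) (cobj (fcod ?H))"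
    proof (rule bij_betw_ex1I)
      fix \<sigma> assume "\<sigma> \<in> cobj (fcod ?H)"
      then have "strict_nat \<sigma>" "tnsrc \<sigma> = yo_obj C X" "tntgt \<sigma> = yo_obj C Y"
        by (auto simp: s hom_def mors_def TwoFun_def)
      from ex1_yo_mor[OF XY this]
      show "\<exists>!f. f \<in> cobj (fdom ?H) \<and> fo ?H f = \<sigma>" using o by (simp add: s cong: conj_cong)
    qed (rule is_functorD(1)[OF H])
    show "bij_betw (fa ?H) (carr (fdom ?H)) (carr (fcod ?H))"
    proof (rule bij_betw_ex1I)
      fix \<Theta> assume "\<Theta> \<in> carr (fcod ?H)"
      then have "modification \<Theta>" "tnsrc (tmsrc \<Theta>) = yo_obj C X" "tntgt (tmsrc \<Theta>) = yo_obj C Y"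
        by (auto simp: s hom_def mors_def TwoFun_def)
      from ex1_yo_cell[OF XY this]
      show "\<exists>!\<alpha>. \<alpha> \<in> carr (fdom ?H) \<and> fa ?H \<alpha> = \<Theta>" using a by (simp add: s cong: conj_cong)
    qed (rule is_functorD(2)[OF H])
  qed
qed

end

theorem theorem6p2p1:
  fixes C :: "('o, 'a, 'c) two_cat"
  assumes "groupoidant C"
  shows
    "two_functor (restricted_yoneda C) \<and> strictly_fully_faithful (restricted_yoneda C) \<and>
     (\<forall>X \<in> obj C. \<forall>Y \<in> obj C. \<forall>f \<in> mors C X Y. \<forall>g \<in> mors C X Y.
        f = g \<longleftrightarrow> (\<forall>A \<in> gpds C. post C A f = post C A g)) \<and>
     (\<forall>X \<in> obj C. \<forall>Y \<in> obj C. \<forall>f \<in> mors C X Y. \<forall>g \<in> mors C X Y.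
        \<forall>\<alpha> \<in> cells C f g. \<forall>\<beta> \<in> cells C f g.
        \<alpha> = \<beta> \<longleftrightarrow> (\<forall>A \<in> gpds C. post2 C A \<alpha> = post2 C A \<beta>)) \<and>
     (\<forall>X \<in> obj C. \<forall>Y \<in> obj C. \<forall>F :: 'o \<Rightarrow> ('a, 'c, 'a, 'c) fnctr.
        (\<forall>A \<in> gpds C. is_functor (F A) \<and> fdom (F A) = hom C A X \<and> fcod (F A) = hom C A Y) \<and>
        (\<forall>A \<in> gpds C. \<forall>A' \<in> gpds C. \<forall>u \<in> mors C A' A.
           fcmp (F A) (pre C u Y) = fcmp (pre C u X) (F A')) \<longrightarrow>
        (\<exists>!f. f \<in> mors C X Y \<and> (\<forall>A \<in> gpds C. F A = post C A f))) \<and>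
     (\<forall>X \<in> obj C. \<forall>Y \<in> obj C. \<forall>f \<in> mors C X Y. \<forall>g \<in> mors C X Y.
        \<forall>\<alpha> :: 'o \<Rightarrow> ('a, 'c, 'a, 'c) ntrans.
        (\<forall>A \<in> gpds C. is_ntrans (\<alpha> A) \<and> nsrc (\<alpha> A) = post C A f \<and> ntgt (\<alpha> A) = post C A g) \<and>
        (\<forall>A \<in> gpds C. \<forall>A' \<in> gpds C. \<forall>h \<in> mors C A' A.
           whiskf (\<alpha> A) (pre C h Y) = fwhisk (pre C h X) (\<alpha> A')) \<longrightarrow>
        (\<exists>!\<theta>. \<theta> \<in> cells C f g \<and> (\<forall>A \<in> gpds C. \<alpha> A = post2 C A \<theta>)))"
proof (intro conjI ballI allI impI)
  show "two_functor (restricted_yoneda C)"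
    using assms unfolding groupoidant_def pita_def by (blast intro: two_category.two_functor_restricted_yoneda)
  show "strictly_fully_faithful (restricted_yoneda C)"
    by (rule strictly_fully_faithful_restricted_yoneda[OF assms])
  fix X Y assume XY: "X \<in> obj C" "Y \<in> obj C"
  show "\<exists>!f. f \<in> mors C X Y \<and> (\<forall>A \<in> gpds C. F A = post C A f)"
    if "(\<forall>A \<in> gpds C. is_functor (F A) \<and> fdom (F A) = hom C A X \<and> fcod (F A) = hom C A Y) \<and>
        (\<forall>A \<in> gpds C. \<forall>A' \<in> gpds C. \<forall>u \<in> mors C A' A.
           fcmp (F A) (pre C u Y) = fcmp (pre C u X) (F A'))" for F
    using ex1_mor_of_natural_family[OF assms XY] that by blast
  fix f g assume f: "f \<in> mors C X Y" "g \<in> mors C X Y"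
  show "f = g \<longleftrightarrow> (\<forall>A \<in> gpds C. post C A f = post C A g)"
    by (rule mor_eq_iff_post_eq[OF assms f])
  show "\<alpha> = \<beta> \<longleftrightarrow> (\<forall>A \<in> gpds C. post2 C A \<alpha> = post2 C A \<beta>)"
    if "\<alpha> \<in> cells C f g" "\<beta> \<in> cells C f g" for \<alpha> \<beta>
    by (rule cell_eq_iff_post2_eq[OF assms f(1) that])
  show "\<exists>!\<theta>. \<theta> \<in> cells C f g \<and> (\<forall>A \<in> gpds C. \<alpha> A = post2 C A \<theta>)"
    if "(\<forall>A \<in> gpds C. is_ntrans (\<alpha> A) \<and> nsrc (\<alpha> A) = post C A f \<and> ntgt (\<alpha> A) = post C A g) \<and>
        (\<forall>A \<in> gpds C. \<forall>A' \<in> gpds C. \<forall>h \<in> mors C A' A.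
           whiskf (\<alpha> A) (pre C h Y) = fwhisk (pre C h X) (\<alpha> A'))" for \<alpha>
    using ex1_cell_of_natural_family[OF assms f] that by blast
qed

end
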